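(* Let $(M,g)$, $f$, $\Gamma$, $\psi$, $\tau$, $\alpha$, $\underline u$, the exhaustion $\{M_k\}_{k\ge 1}$ of $M$ and the admissible solutions $u_k$ of the approximate Dirichlet problems on $M_k$ be as described in the context. Let $K$ be a compact subset of $M$ and assume $K\subset\subset M_m$ for some $m\in\mathbb N$. Then there is a positive constant $C$, depending on $K$ and $M_m$ (and not on $k$), such that for every $k\ge m$, $$\sup_K u_k\le C.$$
   Context: $(M,g)$ is a complete noncompact Riemannian manifold of dimension $n\ge3$, and $0<\psi\in C^\infty(M)$. For a Riemannian metric $g$, $A_g^{\tau,\alpha}=\frac{\alpha}{n-2}\left(Ric_g-\frac{\tau R_g}{2(n-1)}g\right)$, where $Ric_g,R_g$ are the Ricci and scalar curvatures. For a symmetric $(0,2)$-tensor $T$, $\lambda(g^{-1}T)$ denotes the eigenvalues of $T$ with respect to $g$. $\Gamma\subset\mathbb R^n$ is an open, symmetric, convex cone with vertex at the origin, $\partial\Gamma\ne\emptyset$, $\Gamma_n\subseteq\Gamma\subset\Gamma_1$, where $\Gamma_k=\{\lambda\in\mathbb R^n:\sigma_j(\lambda)>0,\ \forall 1\le j\le k\}$ and $\sigma_j$ is the $j$-th elementary symmetric function. $f:\Gamma\to\mathbb R$ is a smooth symmetric function such that: (i) $f_i:=\partial f/\partial\lambda_i>0$ in $\Gamma$ for $1\le i\le n$; (ii) $f$ is concave in $\Gamma$; (iii) $f(t\lambda)=tf(\lambda)$ for all $\lambda\in\Gamma$, $t>0$; and, by standing assumption, $f>0$ in $\Gamma$, $f\equiv0$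 on $\partial\Gamma$ (continuous extension) and $f(1,\dots,1)=1$. $\kappa_\Gamma$ is the largest integer $k$ such that $(-\alpha_1,\dots,-\alpha_k,\alpha_{k+1},\dots,\alpha_n)\in\Gamma$ for some $\alpha_1,\dots,\alpha_n>0$. $\vartheta_\Gamma>0$ is a fixed constant depending only on $\Gamma$ (with $\vartheta_\Gamma\le 1/n$) having the following property, the existence of such a constant being known: for every smooth symmetric concave function $\phi$ on $\Gamma$ with $\phi_i>0$ for all $i$ and with $\lim_{t\to+\infty}\phi(t\lambda)>\sigma$ for all $\lambda\in\Gamma$ and $\sigma<\sup_\Gamma\phi$, one has $\phi_i(\lambda)\ge\vartheta_\Gamma\sum_{j=1}^n\phi_j(\lambda)$ for $1\le i\le\kappa_\Gamma+1$ and every $\lambda\in\Gamma$ with $\lambda_1\le\cdots\le\lambda_n$. The parameters satisfy $\alpha\in\{1,-1\}$, $\tau\in\mathbb R$, with $\tau<1$ if $\alpha=-1$, and $\tau>1+(n-2)(1-\kappa_\Gamma\vartheta_\Gamma)$ if $\alpha=1$. $\underline g=e^{2\underline u}g$ with $\underline u\in C^\infty(M)$ is a complete metric with $\lambda(\underline g^{-1}A_{\underline g}^{\tau,\alpha})\in\Gamma$ in $M$, and there are a compact set $K_0\subset M$ and $\Lambda_0>0$ with $f(\lambda(\underline g^{-1}A_{\underline g}^{\tau,\alpha}))\ge\Lambda_0\psi$ in $M\setminus K_0$. $\{M_k\}_{k=1}^\infty$ is an exhaustion of $M$: $M=\bigcup_k M_k$, $\bar M_k=M_k\cup\partial M_k$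 is a compact $n$-manifold with smooth boundary, and $\bar M_k\subset\subset M_{k+1}$. For each $k$, $u_k$ is the unique smooth solution on $\bar M_k$ of $$f(\lambda(g^{-1}A_{g_k}^{\tau,\alpha}))=\psi e^{2u_k}\ \text{ in } M_k,\quad g_k=e^{2u_k}g,\qquad u_k=\underline u\ \text{ on }\partial M_k,$$ that is admissible, i.e. $\lambda(g^{-1}A_{g_k}^{\tau,\alpha})\in\Gamma$ in $\bar M_k$ (such a solution is known to exist). *)

theory Defs
  imports "HOL-Analysis.Analysis"
begin

section \<open>Smooth maps between normed spaces\<close>

text \<open>Both notions are meant for open domains.\<close>

primrec Ck_on :: "nat \<Rightarrow> 'a set \<Rightarrow> ('a::real_normed_vector \<Rightarrow> 'b::real_normed_vector) \<Rightarrow> bool" where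
  "Ck_on 0 S F \<longleftrightarrow> continuous_on S F"
| "Ck_on (Suc k) S F \<longleftrightarrow> (\<forall>x\<in>S. F differentiable (at x)) \<and>
      (\<forall>v. Ck_on k S (\<lambda>x. frechet_derivative F (at x) v))"

definition smooth_on :: "'a set \<Rightarrow> ('a::real_normed_vector \<Rightarrow> 'b::real_normed_vector) \<Rightarrow> bool" where
  "smooth_on S F \<longleftrightarrow> (\<forall>k. Ck_on k S F)"

definition pderiv_at :: "'n \<Rightarrow> (real^'n \<Rightarrow> real) \<Rightarrow> real^'n \<Rightarrow> real" where
  "pderiv_at i F x = frechet_derivative F (at x) (axis i 1)"


section \<open>Smooth manifolds\<close>

text \<open>The underlying space is a whole type. Charts are total functions paired with their domain;
  their values outside the domain are irrelevant.\<close>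

type_synonym ('a, 'n) chart = "'a set \<times> ('a \<Rightarrow> real^'n)"

definition chart_inv :: "('a, 'n::finite) chart \<Rightarrow> real^'n \<Rightarrow> 'a" where
  "chart_inv c = inv_into (fst c) (snd c)"

definition is_chart :: "('a::topological_space, 'n::finite) chart \<Rightarrow> bool" where
  "is_chart c \<longleftrightarrow> open (fst c) \<and> open (snd c ` fst c) \<and>
     homeomorphism (fst c) (snd c ` fst c) (snd c) (chart_inv c)"

definition compatible :: "('a, 'n::finite) chart \<Rightarrow> ('a, 'n) chart \<Rightarrow> bool" where
  "compatible c d \<longleftrightarrow>
     smooth_on (snd c ` (fst c \<inter> fst d)) (snd d \<circ> chart_inv c) \<and>
     smooth_on (snd d ` (fst c \<inter> fst d)) (snd c \<circ> chart_inv d)"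

text \<open>A smooth structure is a maximal smooth atlas.\<close>

definition smooth_structure :: "('a::topological_space, 'n::finite) chart set \<Rightarrow> bool" where
  "smooth_structure \<A> \<longleftrightarrow>
     (\<forall>c\<in>\<A>. is_chart c) \<and> (\<Union>c\<in>\<A>. fst c) = UNIV \<and>
     (\<forall>c\<in>\<A>. \<forall>d\<in>\<A>. compatible c d) \<and>
     (\<forall>c. is_chart c \<and> (\<forall>d\<in>\<A>. compatible c d) \<longrightarrow> c \<in> \<A>)"

definition smooth_fun :: "('a::topological_space, 'n::finite) chart set \<Rightarrow> 'a set \<Rightarrow> ('a \<Rightarrow> real) \<Rightarrow> bool" where
  "smooth_fun \<A> W u \<longleftrightarrow> (\<forall>c\<in>\<A>. smooth_on (snd c ` (fst c \<inter> W)) (u \<circ> chart_inv c))"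

definition chart_at :: "('a, 'n::finite) chart set \<Rightarrow> 'a \<Rightarrow> ('a, 'n) chart" where
  "chart_at \<A> p = (SOME c. c \<in> \<A> \<and> p \<in> fst c)"

text \<open>An open set whose closure is a compact submanifold of full dimension, with smooth boundary
  the topological frontier: around every frontier point there is a half-space chart.\<close>

definition smooth_compact_domain :: "('a::topological_space, 'n::finite) chart set \<Rightarrow> 'a set \<Rightarrow> bool" where
  "smooth_compact_domain \<A> D \<longleftrightarrow> open D \<and> compact (closure D) \<and>
     (\<forall>p\<in>frontier D. \<exists>c\<in>\<A>. \<exists>i. p \<in> fst c \<and>
        (\<forall>q\<in>fst c. (q \<in> D \<longleftrightarrow> snd c q $ i > 0) \<and> (q \<in> closure D \<longleftrightarrow> snd c q $ i \<ge> 0)))"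

definition exhaustion :: "('a::topological_space, 'n::finite) chart set \<Rightarrow> (nat \<Rightarrow> 'a set) \<Rightarrow> bool" where
  "exhaustion \<A> M \<longleftrightarrow> (\<Union>k\<in>{1..}. M k) = UNIV \<and>
     (\<forall>k\<ge>1. smooth_compact_domain \<A> (M k) \<and> closure (M k) \<subseteq> M (Suc k))"


section \<open>Riemannian metrics\<close>

text \<open>A symmetric (0,2)-tensor field is given by its matrix of components at each point in each
  chart. A metric is such a field that obeys the tensor transformation law and is smooth and
  positive definite.\<close>

type_synonym ('a, 'n) tensor2 = "('a, 'n) chart \<Rightarrow> 'a \<Rightarrow> real^'n^'n"

definition riemannian_metric ::
  "('a::topological_space, 'n::finite) chart set \<Rightarrow> ('a, 'n) tensor2 \<Rightarrow> bool" where
  "riemannian_metric \<A> g \<longleftrightarrow>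
     (\<forall>c\<in>\<A>. smooth_on (snd c ` fst c) (g c \<circ> chart_inv c) \<and>
        (\<forall>p\<in>fst c. transpose (g c p) = g c p \<and> (\<forall>v. v \<noteq> 0 \<longrightarrow> v \<bullet> (g c p *v v) > 0))) \<and>
     (\<forall>c\<in>\<A>. \<forall>d\<in>\<A>. \<forall>p\<in>fst c \<inter> fst d.
        let J = matrix (frechet_derivative (snd d \<circ> chart_inv c) (at (snd c p)))
        in g c p = transpose J ** g d p ** J)"

definition conformal :: "('a \<Rightarrow> real) \<Rightarrow> ('a, 'n::finite) tensor2 \<Rightarrow> ('a, 'n) tensor2" where
  "conformal u g = (\<lambda>c p. exp (2 * u p) *\<^sub>R g c p)"

definition piecewise_C1_curve ::
  "('a::topological_space, 'n::finite) chart set \<Rightarrow> (real \<Rightarrow> 'a) \<Rightarrow> bool" where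
  "piecewise_C1_curve \<A> \<gamma> \<longleftrightarrow> continuous_on {0..1} \<gamma> \<and>
     (\<exists>S. finite S \<and> (\<forall>c\<in>\<A>. (snd c \<circ> \<gamma>) C1_differentiable_on ({t\<in>{0<..<1}. \<gamma> t \<in> fst c} - S)))"

definition speed ::
  "('a, 'n::finite) chart set \<Rightarrow> ('a, 'n) tensor2 \<Rightarrow> (real \<Rightarrow> 'a) \<Rightarrow> real \<Rightarrow> real" where
  "speed \<A> g \<gamma> t =
     (let c = chart_at \<A> (\<gamma> t); v = vector_derivative (snd c \<circ> \<gamma>) (at t)
      in sqrt (v \<bullet> (g c (\<gamma> t) *v v)))"

text \<open>The length is a nonnegative Lebesgue integral, hence infinite (and not a junk value) when the
  speed is not integrable.\<close>

definition curve_length ::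
  "('a, 'n::finite) chart set \<Rightarrow> ('a, 'n) tensor2 \<Rightarrow> (real \<Rightarrow> 'a) \<Rightarrow> ennreal" where
  "curve_length \<A> g \<gamma> = (\<integral>\<^sup>+t\<in>{0<..<1}. ennreal (speed \<A> g \<gamma> t) \<partial>lborel)"

definition riem_dist ::
  "('a::topological_space, 'n::finite) chart set \<Rightarrow> ('a, 'n) tensor2 \<Rightarrow> 'a \<Rightarrow> 'a \<Rightarrow> ennreal" where
  "riem_dist \<A> g p q =
     (INF \<gamma>\<in>{\<gamma>. piecewise_C1_curve \<A> \<gamma> \<and> \<gamma> 0 = p \<and> \<gamma> 1 = q}. curve_length \<A> g \<gamma>)"

definition complete_metric ::
  "('a::topological_space, 'n::finite) chart set \<Rightarrow> ('a, 'n) tensor2 \<Rightarrow> bool" where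
  "complete_metric \<A> g \<longleftrightarrow>
     (\<forall>X::nat \<Rightarrow> 'a. (\<forall>e>0. \<exists>N. \<forall>i\<ge>N. \<forall>j\<ge>N. riem_dist \<A> g (X i) (X j) < ennreal e)
        \<longrightarrow> (\<exists>p. X \<longlonglongrightarrow> p))"


section \<open>Curvature in local coordinates\<close>

text \<open>Here \<open>G\<close> is the component matrix of a metric as a function of the coordinates. The sign
  convention is the one for which round spheres have positive Ricci curvature.\<close>

definition christoffel ::
  "(real^'n \<Rightarrow> real^'n^'n) \<Rightarrow> 'n::finite \<Rightarrow> 'n \<Rightarrow> 'n \<Rightarrow> real^'n \<Rightarrow> real" where
  "christoffel G k i j x = (1/2) * (\<Sum>l\<in>UNIV. matrix_inv (G x) $ k $ l *
     (pderiv_at i (\<lambda>y. G y $ j $ l) x + pderiv_at j (\<lambda>y. G y $ i $ l) x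
        - pderiv_at l (\<lambda>y. G y $ i $ j) x))"

text \<open>The component \<open>l\<close> of \<open>R(\<partial>\<^sub>i, \<partial>\<^sub>j) \<partial>\<^sub>k\<close>.\<close>

definition riemann ::
  "(real^'n \<Rightarrow> real^'n^'n) \<Rightarrow> 'n::finite \<Rightarrow> 'n \<Rightarrow> 'n \<Rightarrow> 'n \<Rightarrow> real^'n \<Rightarrow> real" where
  "riemann G l k i j x =
     pderiv_at i (christoffel G l j k) x - pderiv_at j (christoffel G l i k) x
     + (\<Sum>p\<in>UNIV. christoffel G l i p x * christoffel G p j k x
                  - christoffel G l j p x * christoffel G p i k x)"

definition ricci :: "(real^'n \<Rightarrow> real^'n^'n) \<Rightarrow> real^'n \<Rightarrow> real^('n::finite)^'n" where
  "ricci G x = (\<chi> j k. \<Sum>i\<in>UNIV. riemann G i k i j x)"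

definition scalar_curv :: "(real^'n \<Rightarrow> real^('n::finite)^'n) \<Rightarrow> real^'n \<Rightarrow> real" where
  "scalar_curv G x = (\<Sum>j\<in>UNIV. \<Sum>k\<in>UNIV. matrix_inv (G x) $ j $ k * ricci G x $ j $ k)"

definition A_tensor :: "real \<Rightarrow> real \<Rightarrow> ('a, 'n::finite) tensor2 \<Rightarrow> ('a, 'n) tensor2" where
  "A_tensor \<tau> \<alpha> g c p =
     (let n = real CARD('n); G = g c \<circ> chart_inv c; x = snd c p
      in (\<alpha> / (n - 2)) *\<^sub>R (ricci G x - (\<tau> * scalar_curv G x / (2 * (n - 1))) *\<^sub>R g c p))"

text \<open>The eigenvalues of \<open>G\<^sup>-\<^sup>1 T\<close> with multiplicity, in an unspecified order: they are only used
  with symmetric sets and functions.\<close>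

definition eigenvalues :: "real^'n^'n \<Rightarrow> real^'n^'n \<Rightarrow> real^('n::finite)" where
  "eigenvalues G T = (SOME l. \<forall>x. det (mat x - matrix_inv G ** T) = (\<Prod>i\<in>UNIV. x - l $ i))"

text \<open>The eigenvalues of the (0,2)-tensor \<open>T\<close> with respect to the metric \<open>g\<close> at a point; they do not
  depend on the chart.\<close>

definition eig ::
  "('a, 'n::finite) chart set \<Rightarrow> ('a, 'n) tensor2 \<Rightarrow> ('a, 'n) tensor2 \<Rightarrow> 'a \<Rightarrow> real^'n" where
  "eig \<A> g T p = (let c = chart_at \<A> p in eigenvalues (g c p) (T c p))"


section \<open>Cones and symmetric functions\<close>

definition elem_sym :: "nat \<Rightarrow> real^('n::finite) \<Rightarrow> real" where
  "elem_sym j l = (\<Sum>I | card I = j. \<Prod>i\<in>I. l $ i)"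

definition Gamma_k :: "nat \<Rightarrow> (real^('n::finite)) set" where
  "Gamma_k k = {l. \<forall>j. 1 \<le> j \<and> j \<le> k \<longrightarrow> elem_sym j l > 0}"

definition symmetric_set :: "(real^('n::finite)) set \<Rightarrow> bool" where
  "symmetric_set S \<longleftrightarrow> (\<forall>l\<in>S. \<forall>p. bij p \<longrightarrow> (\<chi> i. l $ p i) \<in> S)"

definition symmetric_fun_on :: "(real^('n::finite)) set \<Rightarrow> (real^'n \<Rightarrow> real) \<Rightarrow> bool" where
  "symmetric_fun_on S F \<longleftrightarrow> (\<forall>l\<in>S. \<forall>p. bij p \<longrightarrow> F (\<chi> i. l $ p i) = F l)"

text \<open>The library predicate \<open>cone\<close> is not suitable here, since it puts the vertex into the set.\<close>

definition admissible_cone :: "(real^('n::finite)) set \<Rightarrow> bool" where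
  "admissible_cone \<Gamma> \<longleftrightarrow> open \<Gamma> \<and> symmetric_set \<Gamma> \<and> convex \<Gamma> \<and>
     (\<forall>l\<in>\<Gamma>. \<forall>t>0. t *\<^sub>R l \<in> \<Gamma>) \<and> frontier \<Gamma> \<noteq> {} \<and>
     Gamma_k CARD('n) \<subseteq> \<Gamma> \<and> \<Gamma> \<subseteq> Gamma_k 1"

definition admissible_function :: "(real^('n::finite)) set \<Rightarrow> (real^'n \<Rightarrow> real) \<Rightarrow> bool" where
  "admissible_function \<Gamma> f \<longleftrightarrow> smooth_on \<Gamma> f \<and> symmetric_fun_on \<Gamma> f \<and>
     (\<forall>l\<in>\<Gamma>. \<forall>i. pderiv_at i f l > 0) \<and> concave_on \<Gamma> f \<and>
     (\<forall>l\<in>\<Gamma>. \<forall>t>0. f (t *\<^sub>R l) = t * f l) \<and>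
     (\<forall>l\<in>\<Gamma>. f l > 0) \<and> (\<forall>l\<in>frontier \<Gamma>. (f \<longlongrightarrow> 0) (at l within \<Gamma>)) \<and>
     f (\<chi> i. 1) = 1"

text \<open>The position (from 1 to \<open>n\<close>) of an index. The order on the index type serves only to
  enumerate the coordinates as \<open>\<lambda>\<^sub>1, \<dots>, \<lambda>\<^sub>n\<close>.\<close>

definition pos :: "'n::{finite,linorder} \<Rightarrow> nat" where
  "pos i = card {j. j \<le> i}"

definition kappa :: "(real^('n::{finite,linorder})) set \<Rightarrow> nat" where
  "kappa \<Gamma> = Max {k. k \<le> CARD('n) \<and>
     (\<exists>a::real^('n::{finite,linorder}). (\<forall>i. a $ i > 0) \<and>
        (\<chi> i. if pos i \<le> k then - a $ i else a $ i) \<in> \<Gamma>)}"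

definition theta_property :: "(real^('n::{finite,linorder})) set \<Rightarrow> real \<Rightarrow> bool" where
  "theta_property \<Gamma> \<theta> \<longleftrightarrow>
     (\<forall>\<phi>. smooth_on \<Gamma> \<phi> \<and> symmetric_fun_on \<Gamma> \<phi> \<and> concave_on \<Gamma> \<phi> \<and>
        (\<forall>l\<in>\<Gamma>. \<forall>i. pderiv_at i \<phi> l > 0) \<and>
        (\<forall>l\<in>\<Gamma>. \<forall>\<sigma>::real. ereal \<sigma> < (SUP m\<in>\<Gamma>. ereal (\<phi> m)) \<longrightarrow>
           (\<exists>L. ((\<lambda>t. ereal (\<phi> (t *\<^sub>R l))) \<longlongrightarrow> L) at_top \<and> L > ereal \<sigma>))
      \<longrightarrow> (\<forall>l\<in>\<Gamma>. (\<forall>i j. i \<le> j \<longrightarrow> l $ i \<le> l $ j) \<longrightarrow>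
           (\<forall>i. pos i \<le> kappa \<Gamma> + 1 \<longrightarrow> pderiv_at i \<phi> l \<ge> \<theta> * (\<Sum>j\<in>UNIV. pderiv_at j \<phi> l))))"


section \<open>The Dirichlet problem\<close>

text \<open>Only the values of \<open>u\<close> on the closure of \<open>D\<close> matter. Smoothness up to the boundary means that
  \<open>u\<close> has a smooth extension \<open>v\<close> to a neighbourhood of the closure. At boundary points the
  derivatives of \<open>v\<close> are determined by \<open>u\<close>, so admissibility there does not depend on \<open>v\<close>.\<close>

definition admissible_dirichlet_solution ::
  "('a::topological_space, 'n::finite) chart set \<Rightarrow> ('a, 'n) tensor2 \<Rightarrow> real \<Rightarrow> real \<Rightarrow>
   (real^'n) set \<Rightarrow> (real^'n \<Rightarrow> real) \<Rightarrow> ('a \<Rightarrow> real) \<Rightarrow> ('a \<Rightarrow> real) \<Rightarrow> 'a set \<Rightarrow> ('a \<Rightarrow> real) \<Rightarrow> bool" where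
  "admissible_dirichlet_solution \<A> g \<tau> \<alpha> \<Gamma> f \<psi> b D u \<longleftrightarrow>
     (\<exists>W v. open W \<and> closure D \<subseteq> W \<and> smooth_fun \<A> W v \<and> (\<forall>p\<in>closure D. v p = u p) \<and>
        (\<forall>p\<in>closure D. eig \<A> g (A_tensor \<tau> \<alpha> (conformal v g)) p \<in> \<Gamma>) \<and>
        (\<forall>p\<in>D. f (eig \<A> g (A_tensor \<tau> \<alpha> (conformal v g)) p) = \<psi> p * exp (2 * v p))) \<and>
     (\<forall>p\<in>frontier D. u p = b p)"

end

theory Submission
  imports Defs
begin

text \<open>
  The bound comes from the trace of the equation. Since \<open>f\<close> is concave, symmetric and homogeneous with
  \<open>f (1, \<dots>, 1) = 1\<close>, it is bounded by the mean of the eigenvalues (\<open>symmetric_concave_le_mean\<close>). The trace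
  of the modified Schouten tensor of \<open>e\<^sup>2\<^sup>u g\<close> with respect to \<open>g\<close> is \<open>- \<beta> e\<^sup>2\<^sup>u R\<close>, where \<open>R\<close> is the scalar
  curvature of \<open>e\<^sup>2\<^sup>u g\<close>, and the restrictions on \<open>\<tau>\<close> imply \<open>\<beta> > 0\<close> (\<open>trace_const_pos\<close>). Hence every admissible
  solution satisfies \<open>R \<le> - n \<psi> / \<beta>\<close> (\<open>scalar_curv_upper_bound\<close>): the solution metric has negative scalar curvature,
  bounded away from zero on compact sets.

  Such conformal metrics obey an interior upper bound that ignores boundary values, of the kind known
  for the Loewner--Nirenberg problem. By the conformal transformation law (\<open>scalar_curv_conformal\<close>), \<open>u\<close> is a
  subsolution of an elliptic equation with an exponential nonlinearity, and on a
  coordinate ball it can be compared with the barrier \<open>- ln (r\<^sup>2 - \<bar>x - a\<bar>\<^sup>2)\<close>, which is infinite at the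
  boundary (\<open>coordinate_upper_bound\<close>). Finitely many half balls cover \<open>K\<close>, and all solutions with \<open>k \<ge> m\<close> are defined
  on \<open>M\<^sub>m\<close>, so the resulting constant is independent of \<open>k\<close>.

  Two points need work. The eigenvalues are specified through a factorization of a characteristic
  polynomial, so that their sum is the trace only if the factorization exists; this uses
  the symmetry of the Ricci tensor and the spectral theorem (\<open>ricci_sym\<close>, \<open>sum_eigenvalues\<close>). And the tensors are
  given in a chart that varies from point to point, so the comparison on a coordinate ball needs the
  invariance of the scalar curvature under changes of coordinates (\<open>scalar_curv_invariant\<close>), proved by viewing the change
  of coordinates as a gauge transformation of the connection.
\<close>

section \<open>Partial derivatives and smooth functions\<close>

lemma pderiv_at_eq:
  assumes "(F has_derivative F') (at x)"
  shows "pderiv_at i F x = F' (axis i 1)"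
  using frechet_derivative_at[OF assms] by (simp add: pderiv_at_def)

lemma frechet_derivative_cong_open:
  assumes "open S" "x \<in> S" "\<And>y. y \<in> S \<Longrightarrow> F y = G y"
  shows "frechet_derivative F (at x) = frechet_derivative G (at x)"
proof -
  have "(F has_derivative D) (at x) \<longleftrightarrow> (G has_derivative D) (at x)" for D
    using has_derivative_transform_within_open[of F D x UNIV S G]
      has_derivative_transform_within_open[of G D x UNIV S F] assms by auto
  then show ?thesis by (simp add: frechet_derivative_def)
qed

lemma pderiv_at_cong_open:
  assumes "open S" "x \<in> S" "\<And>y. y \<in> S \<Longrightarrow> F y = G y"
  shows "pderiv_at i F x = pderiv_at i G x"
  using frechet_derivative_cong_open[OF assms] by (simp add: pderiv_at_def)

lemma differentiable_cong_open:
  assumes "open S" "x \<in> S" "\<And>y. y \<in> S \<Longrightarrow> F y = G y"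
  shows "F differentiable (at x) \<longleftrightarrow> G differentiable (at x)"
  using has_derivative_transform_within_open[of F _ x UNIV S G]
      has_derivative_transform_within_open[of G _ x UNIV S F] assms
  unfolding differentiable_def by auto

lemma frechet_derivative_expand:
  fixes F :: "real^'n \<Rightarrow> real"
  assumes "F differentiable (at x)"
  shows "frechet_derivative F (at x) v = (\<Sum>i\<in>UNIV. v $ i * pderiv_at i F x)"
proof -
  have L: "linear (frechet_derivative F (at x))"
    using assms by (rule linear_frechet_derivative)
  have "frechet_derivative F (at x) v = frechet_derivative F (at x) (\<Sum>i\<in>UNIV. v $ i *\<^sub>R axis i 1)"
    using basis_expansion[of v] by (simp add: scalar_mult_eq_scaleR)
  also have "\<dots> = (\<Sum>i\<in>UNIV. v $ i * pderiv_at i F x)"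
    by (simp add: linear_sum[OF L] linear_scale[OF L] pderiv_at_def)
  finally show ?thesis .
qed

lemma has_derivative_pderiv:
  fixes F :: "real^'n \<Rightarrow> real"
  assumes "F differentiable (at x)"
  shows "(F has_derivative (\<lambda>v. \<Sum>i\<in>UNIV. v $ i * pderiv_at i F x)) (at x)"
proof -
  have "(F has_derivative frechet_derivative F (at x)) (at x)"
    using assms by (simp add: frechet_derivative_works)
  then show ?thesis
    using frechet_derivative_expand[OF assms] by (metis (no_types, lifting) ext)
qed

lemma has_derivative_frechet:
  assumes "F differentiable (at x)"
  shows "(F has_derivative frechet_derivative F (at x)) (at x)"
  using assms by (simp add: frechet_derivative_works)

lemma pderiv_at_const [simp]: "pderiv_at i (\<lambda>x. c) x = 0"
  by (simp add: pderiv_at_def)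

lemma pderiv_at_add:
  assumes "F differentiable (at x)" "G differentiable (at x)"
  shows "pderiv_at i (\<lambda>x. F x + G x) x = pderiv_at i F x + pderiv_at i G x"
  using pderiv_at_eq[OF has_derivative_add[OF assms[THEN has_derivative_frechet]]]
  by (simp add: pderiv_at_def)

lemma pderiv_at_diff:
  assumes "F differentiable (at x)" "G differentiable (at x)"
  shows "pderiv_at i (\<lambda>x. F x - G x) x = pderiv_at i F x - pderiv_at i G x"
  using pderiv_at_eq[OF has_derivative_diff[OF assms[THEN has_derivative_frechet]]]
  by (simp add: pderiv_at_def)

lemma pderiv_at_minus:
  assumes "F differentiable (at x)"
  shows "pderiv_at i (\<lambda>x. - F x) x = - pderiv_at i F x"
  using pderiv_at_eq[OF has_derivative_minus[OF assms[THEN has_derivative_frechet]]]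
  by (simp add: pderiv_at_def)

lemma pderiv_at_mult:
  assumes "F differentiable (at x)" "G differentiable (at x)"
  shows "pderiv_at i (\<lambda>x. F x * G x) x = pderiv_at i F x * G x + F x * pderiv_at i G x"
  using pderiv_at_eq[OF has_derivative_mult[OF assms[THEN has_derivative_frechet]]]
  by (simp add: pderiv_at_def)

lemma pderiv_at_sum:
  assumes "\<And>a. a \<in> A \<Longrightarrow> F a differentiable (at x)"
  shows "pderiv_at i (\<lambda>x. \<Sum>a\<in>A. F a x) x = (\<Sum>a\<in>A. pderiv_at i (F a) x)"
  using pderiv_at_eq[OF has_derivative_sum[of A F "\<lambda>a. frechet_derivative (F a) (at x)"]]
    assms[THEN has_derivative_frechet]
  by (simp add: pderiv_at_def)

lemma pderiv_at_exp:
  assumes "F differentiable (at x)"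
  shows "pderiv_at i (\<lambda>x. exp (F x)) x = exp (F x) * pderiv_at i F x"
  using pderiv_at_eq[OF has_derivative_exp[OF assms[THEN has_derivative_frechet]]]
  by (simp add: pderiv_at_def)

lemma pderiv_at_compose:
  fixes H :: "real^'n \<Rightarrow> real"
  assumes "\<phi> differentiable (at x)" "H differentiable (at (\<phi> x))"
  shows "pderiv_at i (\<lambda>x. H (\<phi> x)) x
      = (\<Sum>a\<in>UNIV. pderiv_at a H (\<phi> x) * frechet_derivative \<phi> (at x) (axis i 1) $ a)"
proof -
  have "((\<lambda>x. H (\<phi> x)) has_derivative
      (\<lambda>v. \<Sum>a\<in>UNIV. frechet_derivative \<phi> (at x) v $ a * pderiv_at a H (\<phi> x))) (at x)"
    using has_derivative_compose[OF has_derivative_frechet[OF assms(1)] has_derivative_pderiv[OF assms(2)]] .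
  from pderiv_at_eq[OF this] show ?thesis by (simp add: mult.commute)
qed

lemma has_real_derivative_line:
  fixes F :: "real^'n \<Rightarrow> real"
  assumes "F differentiable (at (y + s *\<^sub>R v))"
  shows "((\<lambda>s. F (y + s *\<^sub>R v)) has_real_derivative
      (\<Sum>i\<in>UNIV. v $ i * pderiv_at i F (y + s *\<^sub>R v))) (at s)"
proof -
  have 1: "((\<lambda>s. y + s *\<^sub>R v) has_derivative (\<lambda>s. s *\<^sub>R v)) (at s)"
    by (auto intro!: derivative_eq_intros)
  have "(\<lambda>t. \<Sum>i\<in>UNIV. (t *\<^sub>R v) $ i * pderiv_at i F (y + s *\<^sub>R v))
      = (*) (\<Sum>i\<in>UNIV. v $ i * pderiv_at i F (y + s *\<^sub>R v))"
    by (simp add: fun_eq_iff sum_distrib_left mult_ac)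
  then show ?thesis
    using has_derivative_compose[OF 1 has_derivative_pderiv[OF assms]]
    unfolding has_field_derivative_def by simp
qed

lemma has_real_derivative_axis:
  fixes F :: "real^'n \<Rightarrow> real"
  assumes "F differentiable (at (y + s *\<^sub>R axis i 1))"
  shows "((\<lambda>s. F (y + s *\<^sub>R axis i 1)) has_real_derivative
      pderiv_at i F (y + s *\<^sub>R axis i 1)) (at s)"
  using has_real_derivative_line[OF assms]
  by (simp add: axis_def if_distrib[of "\<lambda>x. x * _"] cong: if_cong)

subsection \<open>Closure properties of smoothness\<close>

lemma Ck_on_cong:
  assumes "open S" "\<And>x. x \<in> S \<Longrightarrow> F x = G x" "Ck_on k S F"
  shows "Ck_on k S G"
  using assms(2,3)
proof (induction k arbitrary: F G)
  case 0
  then show ?case using continuous_on_cong[of S S F G] by simp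
next
  case (Suc k)
  have "Ck_on k S (\<lambda>x. frechet_derivative G (at x) v)" for v
    using Suc.IH[of "\<lambda>x. frechet_derivative F (at x) v" "\<lambda>x. frechet_derivative G (at x) v"]
      Suc.prems frechet_derivative_cong_open[OF assms(1), of _ F G] by fastforce
  then show ?case
    using Suc.prems differentiable_cong_open[OF assms(1), of _ F G] by auto
qed

lemma Ck_on_SucD: "Ck_on (Suc k) S F \<Longrightarrow> Ck_on k S F"
proof (induction k arbitrary: F)
  case 0
  then show ?case
    by (auto intro!: continuous_at_imp_continuous_on differentiable_imp_continuous_within)
next
  case (Suc k)
  have "\<forall>x\<in>S. F differentiable (at x)"
    using Suc.prems by simp
  moreover have "Ck_on (Suc k) S (\<lambda>x. frechet_derivative F (at x) v)" for v
    using Suc.prems by (metis Ck_on.simps(2))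
  ultimately show ?case using Suc.IH by (subst Ck_on.simps) blast
qed

lemma Ck_on_subset: "Ck_on k S F \<Longrightarrow> T \<subseteq> S \<Longrightarrow> Ck_on k T F"
  by (induction k arbitrary: F) (auto intro: continuous_on_subset)

lemma smooth_on_cong:
  "open S \<Longrightarrow> (\<And>x. x \<in> S \<Longrightarrow> F x = G x) \<Longrightarrow> smooth_on S F \<Longrightarrow> smooth_on S G"
  unfolding smooth_on_def using Ck_on_cong by blast

lemma smooth_on_subset: "smooth_on S F \<Longrightarrow> T \<subseteq> S \<Longrightarrow> smooth_on T F"
  unfolding smooth_on_def using Ck_on_subset by blast

lemma smooth_on_imp_differentiable: "smooth_on S F \<Longrightarrow> x \<in> S \<Longrightarrow> F differentiable (at x)"
  unfolding smooth_on_def by (metis Ck_on.simps(2))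

lemma smooth_on_imp_continuous_on: "smooth_on S F \<Longrightarrow> continuous_on S F"
  unfolding smooth_on_def by (metis Ck_on.simps(1))

lemma smooth_on_frechet_derivative:
  "smooth_on S F \<Longrightarrow> smooth_on S (\<lambda>x. frechet_derivative F (at x) v)"
  unfolding smooth_on_def by (metis Ck_on.simps(2))

lemma smooth_on_pderiv: "smooth_on S F \<Longrightarrow> smooth_on S (pderiv_at i F)"
  using smooth_on_frechet_derivative[of S F "axis i 1"]
  by (simp add: pderiv_at_def[abs_def])

lemma smooth_on_const: "smooth_on S (\<lambda>x. c)"
proof -
  have "Ck_on k S (\<lambda>x. c)" for k
    by (induction k arbitrary: c) auto
  then show ?thesis by (simp add: smooth_on_def)
qed

lemma Ck_on_bounded_linear:
  assumes "open S" "bounded_linear L" "Ck_on k S F"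
  shows "Ck_on k S (\<lambda>x. L (F x))"
  using assms(3)
proof (induction k arbitrary: F)
  case 0
  then show ?case
    using bounded_linear.continuous_on[OF assms(2)] by simp
next
  case (Suc k)
  have d: "((\<lambda>x. L (F x)) has_derivative (\<lambda>v. L (frechet_derivative F (at x) v))) (at x)"
    if "x \<in> S" for x
    using that Suc.prems by (auto intro!: bounded_linear.has_derivative[OF assms(2)] has_derivative_frechet)
  have "Ck_on k S (\<lambda>x. frechet_derivative (\<lambda>x. L (F x)) (at x) v)" for v
    by (rule Ck_on_cong[OF assms(1) _ Suc.IH[of "\<lambda>x. frechet_derivative F (at x) v"]])
      (use Suc.prems frechet_derivative_at[OF d] in \<open>auto simp: fun_eq_iff\<close>)
  then show ?case using d by (auto simp: differentiable_def)
qed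

lemma smooth_on_bounded_linear:
  assumes "open S" "bounded_linear L" "smooth_on S F"
  shows "smooth_on S (\<lambda>x. L (F x))"
  using Ck_on_bounded_linear[OF assms(1,2)] assms(3) by (auto simp: smooth_on_def)

lemma smooth_on_nth:
  fixes F :: "real^'m \<Rightarrow> 'b::real_normed_vector^'k"
  shows "open S \<Longrightarrow> smooth_on S F \<Longrightarrow> smooth_on S (\<lambda>x. F x $ i)"
  using smooth_on_bounded_linear[OF _ bounded_linear_vec_nth] .

lemma Ck_on_add:
  assumes "open S" "Ck_on k S F" "Ck_on k S G"
  shows "Ck_on k S (\<lambda>x. F x + G x)"
  using assms(2,3)
proof (induction k arbitrary: F G)
  case 0
  then show ?case by (auto intro: continuous_intros)
next
  case (Suc k)
  have d: "((\<lambda>x. F x + G x) has_derivative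
      (\<lambda>v. frechet_derivative F (at x) v + frechet_derivative G (at x) v)) (at x)"
    if "x \<in> S" for x
    using that Suc.prems by (auto intro!: has_derivative_add has_derivative_frechet)
  have "Ck_on k S (\<lambda>x. frechet_derivative (\<lambda>x. F x + G x) (at x) v)" for v
    by (rule Ck_on_cong[OF assms(1) _ Suc.IH[of "\<lambda>x. frechet_derivative F (at x) v"
            "\<lambda>x. frechet_derivative G (at x) v"]])
      (use Suc.prems frechet_derivative_at[OF d] in \<open>auto simp: fun_eq_iff\<close>)
  then show ?case using d by (auto simp: differentiable_def)
qed

lemma Ck_on_mult:
  fixes F G :: "'a::real_normed_vector \<Rightarrow> real"
  assumes "open S" "Ck_on k S F" "Ck_on k S G"
  shows "Ck_on k S (\<lambda>x. F x * G x)"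
  using assms(2,3)
proof (induction k arbitrary: F G)
  case 0
  then show ?case by (auto intro: continuous_intros)
next
  case (Suc k)
  have d: "((\<lambda>x. F x * G x) has_derivative
      (\<lambda>v. F x * frechet_derivative G (at x) v + frechet_derivative F (at x) v * G x)) (at x)"
    if "x \<in> S" for x
    using that Suc.prems by (auto intro!: has_derivative_mult has_derivative_frechet)
  have "Ck_on k S F" "Ck_on k S G"
    using Suc.prems by (blast intro: Ck_on_SucD)+
  then have c: "Ck_on k S (\<lambda>x. F x * frechet_derivative G (at x) v + frechet_derivative F (at x) v * G x)" for v
    using Suc.prems by (auto intro!: Ck_on_add[OF assms(1)] Suc.IH)
  have "Ck_on k S (\<lambda>x. frechet_derivative (\<lambda>x. F x * G x) (at x) v)" for v
    by (rule Ck_on_cong[OF assms(1) _ c[of v]])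
      (use frechet_derivative_at[OF d] in \<open>auto simp: fun_eq_iff\<close>)
  then show ?case using d by (auto simp: differentiable_def)
qed

lemma Ck_on_exp:
  fixes F :: "'a::real_normed_vector \<Rightarrow> real"
  assumes "open S" "Ck_on k S F"
  shows "Ck_on k S (\<lambda>x. exp (F x))"
  using assms(2)
proof (induction k arbitrary: F)
  case 0
  then show ?case by (auto intro: continuous_intros)
next
  case (Suc k)
  have d: "((\<lambda>x. exp (F x)) has_derivative
      (\<lambda>v. exp (F x) * frechet_derivative F (at x) v)) (at x)"
    if "x \<in> S" for x
    using that Suc.prems by (auto intro!: derivative_eq_intros has_derivative_frechet)
  have c: "Ck_on k S (\<lambda>x. exp (F x) * frechet_derivative F (at x) v)" for v
    using Suc.prems Ck_on_SucD[OF Suc.prems] by (auto intro!: Ck_on_mult[OF assms(1)] Suc.IH)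
  have "Ck_on k S (\<lambda>x. frechet_derivative (\<lambda>x. exp (F x)) (at x) v)" for v
    by (rule Ck_on_cong[OF assms(1) _ c[of v]])
      (use frechet_derivative_at[OF d] in \<open>auto simp: fun_eq_iff\<close>)
  then show ?case using d by (auto simp: differentiable_def)
qed

lemma Ck_on_inverse:
  fixes F :: "'a::real_normed_vector \<Rightarrow> real"
  assumes "open S" "\<And>x. x \<in> S \<Longrightarrow> F x \<noteq> 0" "Ck_on k S F"
  shows "Ck_on k S (\<lambda>x. inverse (F x))"
  using assms(3)
proof (induction k)
  case 0
  then show ?case using assms(2) by (auto intro!: continuous_intros)
next
  case (Suc k)
  have d: "((\<lambda>x. inverse (F x)) has_derivative
      (\<lambda>v. (- 1) * (inverse (F x) * frechet_derivative F (at x) v * inverse (F x)))) (at x)"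
    if "x \<in> S" for x
    using that Suc.prems assms(2)[of x]
    by (auto intro!: derivative_eq_intros has_derivative_frechet)
  have i: "Ck_on k S (\<lambda>x. inverse (F x))"
    using Suc.IH Suc.prems Ck_on_SucD by blast
  have m: "Ck_on k S (\<lambda>x. - 1)"
    using smooth_on_const[of S "-1"] unfolding smooth_on_def by blast
  have c: "Ck_on k S (\<lambda>x. (- 1) * (inverse (F x) * frechet_derivative F (at x) v * inverse (F x)))" for v
    using Suc.prems i by (intro Ck_on_mult[OF assms(1)] m) auto
  have "Ck_on k S (\<lambda>x. frechet_derivative (\<lambda>x. inverse (F x)) (at x) v)" for v
    by (rule Ck_on_cong[OF assms(1) _ c[of v]])
      (use frechet_derivative_at[OF d] in \<open>auto simp: fun_eq_iff\<close>)
  then show ?case using d by (auto simp: differentiable_def)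
qed

lemma smooth_on_add: 
  "open S \<Longrightarrow> smooth_on S F \<Longrightarrow> smooth_on S G \<Longrightarrow> smooth_on S (\<lambda>x. F x + G x)"
  by (simp add: smooth_on_def Ck_on_add)

lemma smooth_on_mult:
  fixes F G :: "'a::real_normed_vector \<Rightarrow> real"
  shows "open S \<Longrightarrow> smooth_on S F \<Longrightarrow> smooth_on S G \<Longrightarrow> smooth_on S (\<lambda>x. F x * G x)"
  by (simp add: smooth_on_def Ck_on_mult)

lemma smooth_on_exp:
  fixes F :: "'a::real_normed_vector \<Rightarrow> real"
  shows "open S \<Longrightarrow> smooth_on S F \<Longrightarrow> smooth_on S (\<lambda>x. exp (F x))"
  by (simp add: smooth_on_def Ck_on_exp)

lemma smooth_on_inverse:
  fixes F :: "'a::real_normed_vector \<Rightarrow> real"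
  shows "open S \<Longrightarrow> smooth_on S F \<Longrightarrow> (\<And>x. x \<in> S \<Longrightarrow> F x \<noteq> 0) \<Longrightarrow> smooth_on S (\<lambda>x. inverse (F x))"
  by (simp add: smooth_on_def Ck_on_inverse)

lemma smooth_on_diff:
  fixes F G :: "'a::real_normed_vector \<Rightarrow> real"
  shows "open S \<Longrightarrow> smooth_on S F \<Longrightarrow> smooth_on S G \<Longrightarrow> smooth_on S (\<lambda>x. F x - G x)"
  using smooth_on_add[of S F "\<lambda>x. (-1) * G x"] smooth_on_mult[of S "\<lambda>x. -1" G]
    smooth_on_const[of S "- 1 :: real"] by simp

lemma smooth_on_sum:
  "open S \<Longrightarrow> (\<And>a. a \<in> A \<Longrightarrow> smooth_on S (F a)) \<Longrightarrow> smooth_on S (\<lambda>x. \<Sum>a\<in>A. F a x)"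
  by (induction A rule: infinite_finite_induct) (auto intro: smooth_on_add smooth_on_const)

lemma smooth_on_prod:
  fixes F :: "'b \<Rightarrow> 'a::real_normed_vector \<Rightarrow> real"
  shows "open S \<Longrightarrow> (\<And>a. a \<in> A \<Longrightarrow> smooth_on S (F a)) \<Longrightarrow> smooth_on S (\<lambda>x. \<Prod>a\<in>A. F a x)"
  by (induction A rule: infinite_finite_induct) (auto intro: smooth_on_mult smooth_on_const)

lemmas smooth_on_intros = smooth_on_const smooth_on_add smooth_on_diff smooth_on_mult
  smooth_on_sum smooth_on_prod smooth_on_pderiv

subsection \<open>Symmetry of second derivatives\<close>

text \<open>Applying the mean value theorem first in direction \<open>i\<close> and then in direction \<open>j\<close> expresses the
second difference over a small square by one mixed derivative. The left-hand side is symmetric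
in \<open>i\<close> and \<open>j\<close>, which is what makes mixed derivatives commute.\<close>

lemma second_difference_mean_value:
  fixes F :: "real^'n \<Rightarrow> real"
  assumes "smooth_on (ball x r) F" "0 < h" "2 * h < r"
  shows "\<exists>s t. 0 < s \<and> s < h \<and> 0 < t \<and> t < h \<and>
    F (x + h *\<^sub>R axis i 1 + h *\<^sub>R axis j 1) - F (x + h *\<^sub>R axis i 1) - F (x + h *\<^sub>R axis j 1) + F x
     = h * h * pderiv_at j (pderiv_at i F) (x + s *\<^sub>R axis i 1 + t *\<^sub>R axis j 1)"
proof -
  let ?e = "\<lambda>i. axis i (1::real) :: real^'n"
  have inb: "x + s *\<^sub>R ?e i + t *\<^sub>R ?e j \<in> ball x r" if "0 \<le> s" "s \<le> h" "0 \<le> t" "t \<le> h" for s t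
  proof -
    have "norm (s *\<^sub>R ?e i + t *\<^sub>R ?e j) \<le> s + t"
      using norm_triangle_ineq[of "s *\<^sub>R ?e i" "t *\<^sub>R ?e j"] that by (simp)
    then have "dist (x + (s *\<^sub>R ?e i + t *\<^sub>R ?e j)) x < r"
      using that assms by (simp add: dist_norm)
    then show ?thesis by (simp add: dist_commute add.assoc)
  qed
  have inb0: "x + s *\<^sub>R ?e i \<in> ball x r" if "0 \<le> s" "s \<le> h" for s
    using inb[of s 0] that assms by simp
  note dF = smooth_on_imp_differentiable[OF assms(1)]
  note dF' = smooth_on_imp_differentiable[OF smooth_on_pderiv[OF assms(1)]]
  define g where "g s = F (x + s *\<^sub>R ?e i + h *\<^sub>R ?e j) - F (x + s *\<^sub>R ?e i)" for s
  define g' where "g' s = pderiv_at i F (x + s *\<^sub>R ?e i + h *\<^sub>R ?e j) - pderiv_at i F (x + s *\<^sub>R ?e i)" for s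
  have 1: "(g has_real_derivative g' s) (at s)" if "0 \<le> s" "s \<le> h" for s
  proof -
    have a: "((\<lambda>s. F (x + h *\<^sub>R ?e j + s *\<^sub>R ?e i)) has_real_derivative
       pderiv_at i F (x + h *\<^sub>R ?e j + s *\<^sub>R ?e i)) (at s)"
      using inb[of s h] that assms by (intro has_real_derivative_axis dF) (simp_all add: ac_simps)
    have b: "((\<lambda>s. F (x + s *\<^sub>R ?e i)) has_real_derivative
       pderiv_at i F (x + s *\<^sub>R ?e i)) (at s)"
      using inb0[of s] that by (intro has_real_derivative_axis dF)
    show ?thesis unfolding g_def g'_def using DERIV_diff[OF a b] by (simp add: ac_simps)
  qed
  obtain s where s: "0 < s" "s < h" "g h - g 0 = (h - 0) * g' s"
    using MVT2[of 0 h g g'] 1 assms(2) by auto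
  have 2: "((\<lambda>t. pderiv_at i F (x + s *\<^sub>R ?e i + t *\<^sub>R ?e j)) has_real_derivative
      pderiv_at j (pderiv_at i F) (x + s *\<^sub>R ?e i + t *\<^sub>R ?e j)) (at t)" if "0 \<le> t" "t \<le> h" for t
    using inb[of s t] that s by (intro has_real_derivative_axis dF') simp
  obtain t where t: "0 < t" "t < h" "pderiv_at i F (x + s *\<^sub>R ?e i + h *\<^sub>R ?e j) - pderiv_at i F (x + s *\<^sub>R ?e i + 0 *\<^sub>R ?e j)
      = (h - 0) * pderiv_at j (pderiv_at i F) (x + s *\<^sub>R ?e i + t *\<^sub>R ?e j)"
    using MVT2[of 0 h, OF _ 2] assms(2) by blast
  have "g h - g 0 = h * h * pderiv_at j (pderiv_at i F) (x + s *\<^sub>R ?e i + t *\<^sub>R ?e j)"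
    using s(3) t(3) by (simp add: g'_def)
  moreover have "g h - g 0 = F (x + h *\<^sub>R ?e i + h *\<^sub>R ?e j) - F (x + h *\<^sub>R ?e i) - F (x + h *\<^sub>R ?e j) + F x"
    by (simp add: g_def)
  ultimately show ?thesis using s t by metis
qed

lemma pderiv_at_commute:
  fixes F :: "real^'n \<Rightarrow> real"
  assumes "open S" "smooth_on S F" "x \<in> S"
  shows "pderiv_at i (pderiv_at j F) x = pderiv_at j (pderiv_at i F) x"
proof (rule ccontr)
  let ?e = "\<lambda>i. axis i (1::real) :: real^'n"
  define A where "A = pderiv_at i (pderiv_at j F)"
  define B where "B = pderiv_at j (pderiv_at i F)"
  assume "pderiv_at i (pderiv_at j F) x \<noteq> pderiv_at j (pderiv_at i F) x"
  then have ne: "\<bar>A x - B x\<bar> / 2 > 0" by (simp add: A_def B_def)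
  obtain r where r: "r > 0" "ball x r \<subseteq> S"
    using assms(1,3) open_contains_ball by blast
  have "isCont A x" "isCont B x"
    using smooth_on_imp_continuous_on[OF smooth_on_pderiv[OF smooth_on_pderiv[OF assms(2)]]]
      assms(1,3) by (auto simp: A_def B_def continuous_on_eq_continuous_at)
  then obtain d1 d2 where d: "d1 > 0" "\<And>y. dist y x < d1 \<Longrightarrow> dist (A y) (A x) < \<bar>A x - B x\<bar> / 2"
      "d2 > 0" "\<And>y. dist y x < d2 \<Longrightarrow> dist (B y) (B x) < \<bar>A x - B x\<bar> / 2"
    using ne unfolding continuous_at_eps_delta by (metis (no_types, lifting))
  define h where "h = min r (min d1 d2) / 3"
  have h: "0 < h" "2 * h < r" "2 * h < d1" "2 * h < d2"
    using r d by (auto simp: h_def min_def)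
  have near: "dist (x + s *\<^sub>R ?e i + t *\<^sub>R ?e j) x < 2 * h" if "0 < s" "s < h" "0 < t" "t < h" for s t i j
    using norm_triangle_ineq[of "s *\<^sub>R ?e i" "t *\<^sub>R ?e j"] that
    by (simp add: dist_norm add.assoc)
  have sm: "smooth_on (ball x r) F" using smooth_on_subset[OF assms(2) r(2)] .
  obtain s t where 1: "0 < s" "s < h" "0 < t" "t < h"
    "F (x + h *\<^sub>R ?e i + h *\<^sub>R ?e j) - F (x + h *\<^sub>R ?e i) - F (x + h *\<^sub>R ?e j) + F x
     = h * h * B (x + s *\<^sub>R ?e i + t *\<^sub>R ?e j)"
    using second_difference_mean_value[OF sm h(1,2), of i j] unfolding B_def by blast
  obtain s' t' where 2: "0 < s'" "s' < h" "0 < t'" "t' < h"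
    "F (x + h *\<^sub>R ?e j + h *\<^sub>R ?e i) - F (x + h *\<^sub>R ?e j) - F (x + h *\<^sub>R ?e i) + F x
     = h * h * A (x + s' *\<^sub>R ?e j + t' *\<^sub>R ?e i)"
    using second_difference_mean_value[OF sm h(1,2), of j i] unfolding A_def by blast
  have "h * h * B (x + s *\<^sub>R ?e i + t *\<^sub>R ?e j) = h * h * A (x + s' *\<^sub>R ?e j + t' *\<^sub>R ?e i)"
  proof -
    have sw: "x + h *\<^sub>R ?e j + h *\<^sub>R ?e i = x + h *\<^sub>R ?e i + h *\<^sub>R ?e j"
      by (simp add: ac_simps)
    then show ?thesis using 1(5) 2(5)[unfolded sw] by linarith
  qed
  then have eq: "B (x + s *\<^sub>R ?e i + t *\<^sub>R ?e j) = A (x + s' *\<^sub>R ?e j + t' *\<^sub>R ?e i)"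
    using h by simp
  have "dist (B (x + s *\<^sub>R ?e i + t *\<^sub>R ?e j)) (B x) < \<bar>A x - B x\<bar> / 2"
    using near[OF 1(1-4), of i j] h by (intro d) simp
  moreover have "dist (A (x + s' *\<^sub>R ?e j + t' *\<^sub>R ?e i)) (A x) < \<bar>A x - B x\<bar> / 2"
    using near[OF 2(1-4), of j i] h by (intro d) simp
  moreover have "\<bar>a - b\<bar> \<le> \<bar>u - a\<bar> + \<bar>u - b\<bar>" for a b u :: real by arith
  ultimately show False using eq unfolding dist_real_def by (smt (verit) field_sum_of_halves)
qed

section \<open>Pairs of symmetric matrices\<close>

definition posdef :: "real^'n^'n \<Rightarrow> bool" where
  "posdef G \<longleftrightarrow> transpose G = G \<and> (\<forall>v. v \<noteq> 0 \<longrightarrow> v \<bullet> (G *v v) > 0)"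

lemma symmetric_matrix_inner:
  fixes T :: "real^'n^'n"
  assumes "transpose T = T"
  shows "x \<bullet> (T *v y) = y \<bullet> (T *v x)"
  by (metis assms dot_lmul_matrix inner_commute transpose_matrix_vector)

lemma nonpos_quadratic_imp_linear_zero:
  fixes a b :: real
  assumes "\<And>t. 2 * t * a + t\<^sup>2 * b \<le> 0"
  shows "a = 0"
proof (rule ccontr)
  assume "a \<noteq> 0"
  define c where "c = \<bar>b\<bar> + 1"
  have c: "c > 0" "b \<ge> - c" by (auto simp: c_def)
  have "2 * (a / c) * a + (a / c)\<^sup>2 * (- c) \<le> 2 * (a / c) * a + (a / c)\<^sup>2 * b"
    using c by (intro add_left_mono mult_left_mono) auto
  moreover have "2 * (a / c) * a + (a / c)\<^sup>2 * (- c) = a\<^sup>2 / c"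
    using c by (simp add: power2_eq_square field_simps)
  moreover have "a\<^sup>2 / c > 0" using c \<open>a \<noteq> 0\<close> by simp
  ultimately show False using assms[of "a / c"] by linarith
qed

text \<open>The variational step of the spectral theorem, for the inner product given by \<open>G\<close>: on the
\<open>G\<close>-orthogonal complement of the eigenvectors found so far, a maximizer of the Rayleigh quotient
of \<open>T\<close> against \<open>G\<close> is a further generalized eigenvector.\<close>

lemma orthonormal_eigenvectors_extend:
  fixes G T :: "real^'n^'n"
  assumes G: "posdef G" and T: "transpose T = T"
    and S: "finite S" "card S < CARD('n)"
      "\<And>e. e \<in> S \<Longrightarrow> e \<bullet> (G *v e) = 1"
      "\<And>e e'. e \<in> S \<Longrightarrow> e' \<in> S \<Longrightarrow> e \<noteq> e' \<Longrightarrow> e \<bullet> (G *v e') = 0"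
      "\<And>e. e \<in> S \<Longrightarrow> \<exists>l. T *v e = l *\<^sub>R (G *v e)"
  shows "\<exists>e. e \<bullet> (G *v e) = 1 \<and> (\<forall>s\<in>S. e \<bullet> (G *v s) = 0) \<and> (\<exists>l. T *v e = l *\<^sub>R (G *v e))"
proof -
  have Gs: "transpose G = G" and Gp: "\<And>v. v \<noteq> 0 \<Longrightarrow> v \<bullet> (G *v v) > 0"
    using G by (auto simp: posdef_def)
  define V where "V = {x. \<forall>s\<in>S. x \<bullet> (G *v s) = 0}"
  have V_closed: "closed V"
  proof -
    have "V = (\<Inter>s\<in>S. {x. x \<bullet> (G *v s) = 0})" by (auto simp: V_def)
    also have "closed \<dots>" by (intro closed_INT ballI closed_Collect_eq continuous_intros)
    finally show ?thesis .
  qed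
  have V_add: "x + y \<in> V" if "x \<in> V" "y \<in> V" for x y
    using that by (auto simp: V_def inner_add_left)
  have V_scale: "c *\<^sub>R x \<in> V" if "x \<in> V" for c x
    using that by (auto simp: V_def)
  have "dim (span ((\<lambda>s. G *v s) ` S)) < DIM(real^'n)"
    using dim_le_card'[of "(\<lambda>s. G *v s) ` S"] card_image_le[OF S(1), of "\<lambda>s. G *v s"] S(1,2) by simp
  then have "dim ((\<lambda>s. G *v s) ` S) < DIM(real^'n)" by simp
  then obtain x0 where x0: "x0 \<noteq> 0" "\<forall>y\<in>span ((\<lambda>s. G *v s) ` S). orthogonal x0 y"
    by (metis orthogonal_to_subspace_exists)
  have x0V: "x0 \<in> V"
    unfolding V_def
  proof (intro CollectI ballI)
    fix s assume "s \<in> S"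
    then have "G *v s \<in> span ((\<lambda>s. G *v s) ` S)" by (intro span_base imageI)
    then have "orthogonal x0 (G *v s)" using x0(2) by blast
    then show "x0 \<bullet> (G *v s) = 0" unfolding orthogonal_def .
  qed
  define q where "q x = (x \<bullet> (T *v x)) / (x \<bullet> (G *v x))" for x
  have G_nz: "x \<bullet> (G *v x) \<noteq> 0" if "x \<in> sphere 0 1 \<inter> V" for x
  proof -
    have "x \<noteq> 0" using that by auto
    then show ?thesis using Gp[of x] by linarith
  qed
  have cont_q: "continuous_on (sphere 0 1 \<inter> V) q"
    unfolding q_def by (intro continuous_intros matrix_vector_mult_linear_continuous_on)
      (use G_nz in blast)
  have "x0 /\<^sub>R norm x0 \<in> sphere 0 1 \<inter> V" using x0 x0V V_scale by simp
  then have "sphere 0 1 \<inter> V \<noteq> {}" by blast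
  then obtain e0 where e0: "e0 \<in> sphere 0 1 \<inter> V" "\<forall>y\<in>sphere 0 1 \<inter> V. q y \<le> q e0"
    using continuous_attains_sup[OF compact_Int_closed[OF compact_sphere V_closed] _ cont_q] by blast
  define \<mu> where "\<mu> = q e0"
  have e0nz: "e0 \<noteq> 0" using e0(1) by auto
  define B where "B = T - \<mu> *\<^sub>R G"
  have Bv: "B *v x = T *v x - \<mu> *\<^sub>R (G *v x)" for x
    by (simp add: B_def matrix_vector_mult_diff_rdistrib scaleR_matrix_vector_assoc)
  have Bs: "x \<bullet> (B *v y) = y \<bullet> (B *v x)" for x y
    using symmetric_matrix_inner[OF T, of x y] symmetric_matrix_inner[OF Gs, of x y]
    by (simp add: Bv inner_diff_right)
  have Bneg: "x \<bullet> (B *v x) \<le> 0" if "x \<in> V" for x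
  proof (cases "x = 0")
    case False
    have "x /\<^sub>R norm x \<in> sphere 0 1 \<inter> V" using that V_scale False by simp
    then have "q (x /\<^sub>R norm x) \<le> \<mu>" using e0 \<mu>_def by blast
    moreover have "q (x /\<^sub>R norm x) = q x"
      using False by (simp add: q_def matrix_vector_mult_scaleR)
    ultimately have "q x \<le> \<mu>" by simp
    then have "(x \<bullet> (T *v x)) \<le> \<mu> * (x \<bullet> (G *v x))"
      using Gp[OF False] by (simp add: q_def pos_divide_le_eq)
    then show ?thesis by (simp add: Bv inner_diff_right)
  qed simp
  have Be0: "e0 \<bullet> (B *v e0) = 0"
    using Gp[OF e0nz] by (simp add: Bv inner_diff_right \<mu>_def q_def)
  \<comment> \<open>At the maximizer the residual \<open>z\<close> is orthogonal to the complement \<open>V\<close> by the first-order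
    condition and to \<open>S\<close> because \<open>S\<close> consists of eigenvectors; the two together span everything.\<close>
  define z where "z = B *v e0"
  have zV: "y \<bullet> z = 0" if "y \<in> V" for y
  proof (rule nonpos_quadratic_imp_linear_zero)
    fix t
    have "(e0 + t *\<^sub>R y) \<bullet> (B *v (e0 + t *\<^sub>R y)) \<le> 0"
      using that e0 by (intro Bneg V_add V_scale) auto
    then show "2 * t * (y \<bullet> z) + t\<^sup>2 * (y \<bullet> (B *v y)) \<le> 0"
      using Be0 Bs[of e0 y]
      by (simp add: z_def matrix_vector_right_distrib matrix_vector_mult_scaleR inner_add_left
          inner_add_right power2_eq_square algebra_simps)
  qed
  have zS: "s \<bullet> z = 0" if s: "s \<in> S" for s
  proof -
    obtain l where "T *v s = l *\<^sub>R (G *v s)" using S(5)[OF s] by blast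
    then have "B *v s = (l - \<mu>) *\<^sub>R (G *v s)" by (simp add: Bv scaleR_left_diff_distrib)
    then have "e0 \<bullet> (B *v s) = 0" using e0(1) s by (auto simp: V_def)
    then show ?thesis using Bs[of e0 s] by (simp add: z_def)
  qed
  define y where "y = z - (\<Sum>s\<in>S. (z \<bullet> (G *v s)) *\<^sub>R s)"
  have "y \<in> V"
    unfolding V_def
  proof (intro CollectI ballI)
    fix s assume s: "s \<in> S"
    have "(\<Sum>s'\<in>S. (z \<bullet> (G *v s')) * (s' \<bullet> (G *v s)))
        = (\<Sum>s'\<in>S. if s' = s then z \<bullet> (G *v s) else 0)"
      using S(3,4) s by (intro sum.cong) auto
    then show "y \<bullet> (G *v s) = 0"
      using s S(1) by (simp add: y_def inner_diff_left inner_sum_left)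
  qed
  then have "y \<bullet> z = 0" by (rule zV)
  then have "z \<bullet> z = 0"
    using zS by (simp add: y_def inner_diff_left inner_sum_left)
  then have Te0: "T *v e0 = \<mu> *\<^sub>R (G *v e0)" by (simp add: z_def Bv)
  define c where "c = 1 / sqrt (e0 \<bullet> (G *v e0))"
  have "(c *\<^sub>R e0) \<bullet> (G *v (c *\<^sub>R e0)) = 1"
    using Gp[OF e0nz] by (simp add: c_def matrix_vector_mult_scaleR real_sqrt_mult[symmetric] field_simps)
  moreover have "\<forall>s\<in>S. (c *\<^sub>R e0) \<bullet> (G *v s) = 0" using e0(1) by (auto simp: V_def)
  moreover have "T *v (c *\<^sub>R e0) = \<mu> *\<^sub>R (G *v (c *\<^sub>R e0))"
    using Te0 by (simp add: matrix_vector_mult_scaleR)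
  ultimately show ?thesis by blast
qed

text \<open>A symmetric tensor has real eigenvalues with respect to a metric. This is used in two ways: it
shows that the eigenvalue vector of \<open>G\<^sup>-\<^sup>1 T\<close> really exists, and the basis \<open>h\<close> writes \<open>G\<^sup>-\<^sup>1\<close> as a sum
of squares.\<close>

lemma simultaneous_diagonalization:
  fixes G T :: "real^'n^'n"
  assumes G: "posdef G" and T: "transpose T = T"
  shows "\<exists>(h :: 'n \<Rightarrow> real^'n) (l :: 'n \<Rightarrow> real).
    (\<forall>i j. h i \<bullet> (G *v h j) = (if i = j then 1 else 0)) \<and> (\<forall>i. T *v h i = l i *\<^sub>R (G *v h i))"
proof -
  have "\<exists>S. finite S \<and> card S = k \<and> (\<forall>e\<in>S. e \<bullet> (G *v e) = 1) \<and>
      (\<forall>e\<in>S. \<forall>e'\<in>S. e \<noteq> e' \<longrightarrow> e \<bullet> (G *v e') = 0) \<and> (\<forall>e\<in>S. \<exists>l. T *v e = l *\<^sub>R (G *v e))"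
    if "k \<le> CARD('n)" for k
    using that
  proof (induction k)
    case 0
    then show ?case by (intro exI[of _ "{}"]) auto
  next
    case (Suc k)
    then obtain S where S: "finite S" "card S = k" "\<forall>e\<in>S. e \<bullet> (G *v e) = 1"
      "\<forall>e\<in>S. \<forall>e'\<in>S. e \<noteq> e' \<longrightarrow> e \<bullet> (G *v e') = 0" "\<forall>e\<in>S. \<exists>l. T *v e = l *\<^sub>R (G *v e)"
      by auto
    obtain e where e: "e \<bullet> (G *v e) = 1" "\<forall>s\<in>S. e \<bullet> (G *v s) = 0" "\<exists>l. T *v e = l *\<^sub>R (G *v e)"
      using orthonormal_eigenvectors_extend[OF G T, of S] S Suc.prems by auto
    have "e \<notin> S" using e by auto
    moreover have "\<forall>s\<in>S. s \<bullet> (G *v e) = 0"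
      using e(2) symmetric_matrix_inner[of G e] G unfolding posdef_def by metis
    ultimately show ?case using S e by (intro exI[of _ "insert e S"]) auto
  qed
  from this[of "CARD('n)"] obtain S where S: "finite S" "card S = CARD('n)" "\<forall>e\<in>S. e \<bullet> (G *v e) = 1"
      "\<forall>e\<in>S. \<forall>e'\<in>S. e \<noteq> e' \<longrightarrow> e \<bullet> (G *v e') = 0" "\<forall>e\<in>S. \<exists>l. T *v e = l *\<^sub>R (G *v e)"
    by auto
  obtain h :: "'n \<Rightarrow> real^'n" where h: "bij_betw h UNIV S"
    using finite_same_card_bij[of "UNIV :: 'n set" S] S by auto
  obtain l where l: "\<And>e. e \<in> S \<Longrightarrow> T *v e = l e *\<^sub>R (G *v e)"
    using S(5) by metis
  show ?thesis
  proof (intro exI conjI allI)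
    show "h i \<bullet> (G *v h j) = (if i = j then 1 else 0)" for i j
      using h S(3,4) unfolding bij_betw_def inj_on_def by (metis UNIV_I imageI)
    show "T *v h i = (l \<circ> h) i *\<^sub>R (G *v h i)" for i
      using h l by (auto simp: bij_betw_def)
  qed
qed

lemma posdef_det_nonzero: "posdef G \<Longrightarrow> det G \<noteq> 0"
proof -
  assume G: "posdef G"
  have "\<forall>x. G *v x = 0 \<longrightarrow> x = 0"
    using G by (metis inner_zero_right less_irrefl posdef_def)
  then have "invertible G"
    by (metis invertible_def matrix_left_invertible_ker matrix_left_right_inverse)
  then show ?thesis by (simp add: invertible_det_nz)
qed

lemma matrix_inv_inverse:
  assumes "det (G :: real^'n^'n) \<noteq> 0"
  shows "matrix_inv G ** G = mat 1" "G ** matrix_inv G = mat 1"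
proof -
  have "\<exists>A'. G ** A' = mat 1 \<and> A' ** G = mat 1"
    using assms by (simp add: invertible_det_nz[symmetric] invertible_def)
  from someI_ex[OF this] show "matrix_inv G ** G = mat 1" "G ** matrix_inv G = mat 1"
    by (simp_all add: matrix_inv_def)
qed

lemma matrix_inv_eqI:
  assumes "A ** (G :: real^'n^'n) = mat 1"
  shows "matrix_inv G = A"
proof -
  have "det A * det G = 1" using assms by (metis det_mul det_I)
  then have "det G \<noteq> 0" by auto
  then have "matrix_inv G = (A ** G) ** matrix_inv G" using assms by simp
  also have "\<dots> = A" by (simp add: matrix_mul_assoc[symmetric] matrix_inv_inverse[OF \<open>det G \<noteq> 0\<close>])
  finally show ?thesis .
qed

lemma matrix_inv_orthonormal:
  fixes G :: "real^'n^'n"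
  assumes "\<And>i j. h i \<bullet> (G *v h j) = (if i = j then 1 else 0)"
  shows "matrix_inv G = (\<chi> i j. h j $ i) ** transpose (\<chi> i j. h j $ i)" (is "_ = ?E ** _")
    and "det (\<chi> i j. h j $ i) \<noteq> 0"
proof -
  have "(transpose ?E ** G) ** ?E = mat 1"
  proof -
    have "((transpose ?E ** G) ** ?E) $ i $ j = h i \<bullet> (G *v h j)" for i j
      by (simp add: matrix_mul_assoc[symmetric])
         (simp add: matrix_matrix_mult_def matrix_vector_mult_def inner_vec_def transpose_def)
    then show ?thesis using assms by (simp add: vec_eq_iff mat_def)
  qed
  moreover from this have "?E ** (transpose ?E ** G) = mat 1"
    using matrix_left_right_inverse by blast
  ultimately show "matrix_inv G = ?E ** transpose ?E"
    by (intro matrix_inv_eqI) (simp add: matrix_mul_assoc)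
  have "det (transpose ?E ** G) * det ?E = 1"
    using \<open>(transpose ?E ** G) ** ?E = mat 1\<close> by (metis det_mul det_I)
  then show "det ?E \<noteq> 0" by auto
qed

text \<open>The eigenvalue vector is only determined up to order, by the roots of a polynomial; sums over it
are nevertheless well defined.\<close>

lemma sum_roots_unique:
  fixes l l' :: "'n::finite \<Rightarrow> real"
  assumes "\<And>x. (\<Prod>i\<in>UNIV. x - l i) = (\<Prod>i\<in>UNIV. x - l' i)"
  shows "(\<Sum>i\<in>UNIV. l i) = (\<Sum>i\<in>UNIV. l' i)"
proof -
  have "poly (\<Prod>i\<in>UNIV. [:- l i, 1:]) = poly (\<Prod>i\<in>UNIV. [:- l' i, 1:])"
    using assms by (simp add: fun_eq_iff poly_prod)
  then have "proots (\<Prod>i\<in>UNIV. [:- l i, 1:]) = proots (\<Prod>i\<in>UNIV. [:- l' i, 1:])"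
    by (simp add: poly_eq_poly_eq_iff)
  then have "(\<Sum>i\<in>UNIV. {#l i#}) = (\<Sum>i\<in>UNIV. {#l' i#})"
    by (simp add: proots_prod)
  then have eq: "sum_mset (\<Sum>i\<in>UNIV. {#l i#}) = sum_mset (\<Sum>i\<in>UNIV. {#l' i#})"
    by (rule arg_cong)
  have "sum_mset (\<Sum>i\<in>A. {#k i#}) = (\<Sum>i\<in>A. k i)" for A and k :: "'n \<Rightarrow> real"
    by (induction A rule: infinite_finite_induct) auto
  from eq[unfolded this] show ?thesis .
qed

lemma matrix_sub_ldistrib: "(A :: real^'n^'m) ** (B - C) = A ** B - A ** (C :: real^'k^'n)"
  by (simp add: vec_eq_iff matrix_matrix_mult_def right_diff_distrib sum_subtractf)

lemma matrix_sub_rdistrib: "((A :: real^'n^'m) - B) ** C = A ** C - B ** (C :: real^'k^'n)"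
  by (simp add: vec_eq_iff matrix_matrix_mult_def left_diff_distrib sum_subtractf)

lemma matrix_add_rdistrib: "((A :: real^'k^'m) + B) ** C = A ** C + B ** (C :: real^'l^'k)"
  by (simp add: vec_eq_iff matrix_matrix_mult_def distrib_right sum.distrib)

text \<open>Since \<open>eigenvalues\<close> selects an arbitrary factorization of the characteristic polynomial, one
factorization has to be exhibited; it comes from the simultaneous diagonalization.\<close>

lemma sum_eigenvalues:
  fixes G T :: "real^'n^'n"
  assumes G: "posdef G" and T: "transpose T = T"
  shows "(\<Sum>i\<in>UNIV. eigenvalues G T $ i) = trace (matrix_inv G ** T)"
proof -
  obtain h :: "'n \<Rightarrow> real^'n" and l where hl: "\<forall>i j. h i \<bullet> (G *v h j) = (if i = j then 1 else (0::real))"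
      "\<forall>i. T *v h i = l i *\<^sub>R (G *v h i)"
    using simultaneous_diagonalization[OF G T] by blast
  note h = hl(1)[rule_format] and l = hl(2)[rule_format]
  define E :: "real^'n^'n" where "E = (\<chi> i j. h j $ i)"
  define L :: "real^'n^'n" where "L = (\<chi> i j. if i = j then l i else 0)"
  have E: "det E \<noteq> 0" unfolding E_def using matrix_inv_orthonormal(2)[OF h] .
  have TE: "T ** E = (G ** E) ** L"
  proof -
    have "(T ** E) $ i $ j = (T *v h j) $ i" "(G ** E) $ i $ j = (G *v h j) $ i" for i j
      by (simp_all add: E_def matrix_matrix_mult_def matrix_vector_mult_def)
    moreover have "(A ** L) $ i $ j = A $ i $ j * l j" for A :: "real^'n^'n" and i j
      by (simp add: matrix_matrix_mult_def L_def if_distrib[of "\<lambda>x. _ * x"] cong: if_cong)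
    ultimately show ?thesis by (simp add: vec_eq_iff l)
  qed
  define M where "M = matrix_inv G ** T"
  have "M ** E = (matrix_inv G ** G) ** E ** L"
    using TE by (simp add: M_def matrix_mul_assoc[symmetric])
  then have ME: "M ** E = E ** L"
    by (simp add: matrix_inv_inverse(1)[OF posdef_det_nonzero[OF G]])
  have char: "det (mat x - M) = (\<Prod>i\<in>UNIV. x - l i)" for x
  proof -
    have xE: "mat x ** E = E ** mat x"
      by (simp add: vec_eq_iff matrix_matrix_mult_def mat_def if_distrib[of "\<lambda>x. _ * x"]
          if_distrib[of "\<lambda>x. x * _"] mult.commute cong: if_cong)
    have "(mat x - M) ** E = E ** (mat x - L)"
      by (simp add: matrix_sub_rdistrib matrix_sub_ldistrib ME xE)
    then have "det (mat x - M) * det E = det E * det (mat x - L)"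
      by (metis det_mul)
    then have "det (mat x - M) = det (mat x - L)" using E by simp
    also have "\<dots> = (\<Prod>i\<in>UNIV. (mat x - L) $ i $ i)"
      by (rule det_diagonal) (simp add: L_def mat_def)
    finally show ?thesis by (simp add: L_def mat_def)
  qed
  have "\<exists>l :: real^'n. \<forall>x. det (mat x - M) = (\<Prod>i\<in>UNIV. x - l $ i)"
    using char by (intro exI[of _ "\<chi> i. l i"]) simp
  then have "\<forall>x. det (mat x - M) = (\<Prod>i\<in>UNIV. x - eigenvalues G T $ i)"
    unfolding eigenvalues_def M_def by (rule someI_ex)
  then have "(\<Sum>i\<in>UNIV. eigenvalues G T $ i) = (\<Sum>i\<in>UNIV. l i)"
    using char by (intro sum_roots_unique) simp
  also have "\<dots> = trace L" by (simp add: trace_def L_def)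
  also have "\<dots> = trace (L ** (matrix_inv E ** E))" by (simp add: matrix_inv_inverse[OF E])
  also have "\<dots> = trace ((M ** E) ** matrix_inv E)"
    by (metis ME matrix_mul_assoc trace_mul_sym)
  also have "\<dots> = trace M" by (simp add: matrix_mul_assoc[symmetric] matrix_inv_inverse[OF E])
  finally show ?thesis by (simp add: M_def)
qed

text \<open>Contraction with an inverse metric preserves signs. In the maximum principle \<open>W\<close> is the Hessian
at an interior maximum.\<close>

lemma contract_nonpos:
  fixes G W :: "real^'n^'n"
  assumes G: "posdef G" and W: "\<And>v. (\<Sum>j\<in>UNIV. \<Sum>k\<in>UNIV. v $ j * v $ k * W $ j $ k) \<le> 0"
  shows "(\<Sum>j\<in>UNIV. \<Sum>k\<in>UNIV. matrix_inv G $ j $ k * W $ j $ k) \<le> 0"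
proof -
  have Gs: "transpose G = G" using G by (simp add: posdef_def)
  obtain h :: "'n \<Rightarrow> real^'n" where "\<forall>i j. h i \<bullet> (G *v h j) = (if i = j then 1 else (0::real))"
    using simultaneous_diagonalization[OF G Gs] by blast
  note h = this[rule_format]
  have "matrix_inv G $ j $ k = (\<Sum>i\<in>UNIV. h i $ j * h i $ k)" for j k
    unfolding matrix_inv_orthonormal(1)[OF h] by (simp add: matrix_matrix_mult_def transpose_def)
  then have "(\<Sum>j\<in>UNIV. \<Sum>k\<in>UNIV. matrix_inv G $ j $ k * W $ j $ k)
      = (\<Sum>j\<in>UNIV. \<Sum>k\<in>UNIV. \<Sum>i\<in>UNIV. h i $ j * h i $ k * W $ j $ k)"
    by (simp add: sum_distrib_right)
  also have "\<dots> = (\<Sum>j\<in>UNIV. \<Sum>i\<in>UNIV. \<Sum>k\<in>UNIV. h i $ j * h i $ k * W $ j $ k)"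
    by (intro sum.cong refl sum.swap)
  also have "\<dots> = (\<Sum>i\<in>UNIV. \<Sum>j\<in>UNIV. \<Sum>k\<in>UNIV. h i $ j * h i $ k * W $ j $ k)"
    by (rule sum.swap)
  also have "\<dots> \<le> 0" by (intro sum_nonpos W)
  finally show ?thesis .
qed

lemma symmetric_matrix_inv:
  assumes "transpose (G :: real^'n^'n) = G" "det G \<noteq> 0"
  shows "transpose (matrix_inv G) = matrix_inv G"
proof -
  have "transpose (G ** matrix_inv G) = mat 1"
    using assms by (simp add: matrix_inv_inverse transpose_mat)
  then have "transpose (matrix_inv G) ** G = mat 1" by (simp add: matrix_transpose_mul assms)
  then show ?thesis using matrix_inv_eqI[of "transpose (matrix_inv G)" G] by simp
qed

text \<open>Cramer's rule, which shows that the inverse of a smoothly varying matrix is smooth.\<close>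

lemma matrix_inv_nth:
  fixes A :: "real^'n^'n"
  assumes "det A \<noteq> 0"
  shows "matrix_inv A $ k $ l = det (\<chi> i j. if j = k then axis l 1 $ i else A $ i $ j) / det A"
proof -
  have "A *v (matrix_inv A *v axis l 1) = axis l 1"
    by (simp add: matrix_vector_mul_assoc matrix_inv_inverse[OF assms])
  then have "matrix_inv A *v axis l 1 = (\<chi> k. det (\<chi> i j. if j = k then axis l 1 $ i else A $ i $ j) / det A)"
    using cramer[OF assms] by blast
  moreover have "(matrix_inv A *v axis l 1) $ k = matrix_inv A $ k $ l"
    by (simp add: matrix_vector_mult_basis column_def)
  ultimately show ?thesis by simp
qed

section \<open>Curvature of a metric in a coordinate domain\<close>

text \<open>Smoothness is required of the components, so that scaling by a conformal factor is a product of
real functions.\<close>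

definition metric_on :: "(real^'n) set \<Rightarrow> (real^'n \<Rightarrow> real^'n^'n) \<Rightarrow> bool" where
  "metric_on S G \<longleftrightarrow> open S \<and> (\<forall>i j. smooth_on S (\<lambda>x. G x $ i $ j)) \<and> (\<forall>x\<in>S. posdef (G x))"

lemma smooth_on_det:
  fixes A :: "real^'m \<Rightarrow> real^'n^'n"
  assumes "open S" "\<And>i j. smooth_on S (\<lambda>x. A x $ i $ j)"
  shows "smooth_on S (\<lambda>x. det (A x))"
  unfolding det_def using assms
  by (intro smooth_on_sum smooth_on_mult smooth_on_prod smooth_on_const) auto

locale coordinate_metric =
  fixes S :: "(real^'n) set" and G :: "real^'n \<Rightarrow> real^'n^'n"
  assumes metric: "metric_on S G"
begin

abbreviation "Gi \<equiv> \<lambda>x. matrix_inv (G x)"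

lemma open_S: "open S" and smooth_G_nth: "smooth_on S (\<lambda>x. G x $ i $ j)"
  and posdef_G: "x \<in> S \<Longrightarrow> posdef (G x)"
  using metric by (auto simp: metric_on_def)

lemma G_sym: "x \<in> S \<Longrightarrow> G x $ i $ j = G x $ j $ i"
proof -
  assume "x \<in> S"
  then have "transpose (G x) $ i $ j = G x $ i $ j"
    using posdef_G[of x] by (simp add: posdef_def)
  then show ?thesis by (simp add: transpose_def)
qed

lemma Gi_sym: "x \<in> S \<Longrightarrow> Gi x $ i $ j = Gi x $ j $ i"
proof -
  assume "x \<in> S"
  then have "transpose (Gi x) $ i $ j = Gi x $ i $ j"
    using symmetric_matrix_inv[of "G x"] posdef_det_nonzero[OF posdef_G[of x]] posdef_G[of x]
    by (simp add: posdef_def)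
  then show ?thesis by (simp add: transpose_def)
qed

lemma Gi_G: "x \<in> S \<Longrightarrow> (\<Sum>k\<in>UNIV. Gi x $ i $ k * G x $ k $ j) = (if i = j then 1 else 0)"
  using matrix_inv_inverse(1)[OF posdef_det_nonzero[OF posdef_G[of x]]]
  by (auto simp: vec_eq_iff matrix_matrix_mult_def mat_def)

lemma G_Gi: "x \<in> S \<Longrightarrow> (\<Sum>k\<in>UNIV. G x $ i $ k * Gi x $ k $ j) = (if i = j then 1 else 0)"
  using matrix_inv_inverse(2)[OF posdef_det_nonzero[OF posdef_G[of x]]]
  by (auto simp: vec_eq_iff matrix_matrix_mult_def mat_def)

lemma smooth_Gi_nth: "smooth_on S (\<lambda>x. Gi x $ k $ l)"
proof -
  have "smooth_on S (\<lambda>x. det (\<chi> i j. if j = k then axis l 1 $ i else G x $ i $ j))"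
  proof (rule smooth_on_det[OF open_S])
    fix i j
    show "smooth_on S (\<lambda>x. (\<chi> i j. if j = k then axis l 1 $ i else G x $ i $ j) $ i $ j)"
      by (cases "j = k") (simp_all add: smooth_on_const smooth_G_nth)
  qed
  moreover have "smooth_on S (\<lambda>x. inverse (det (G x)))"
    using posdef_det_nonzero[OF posdef_G]
    by (intro smooth_on_inverse smooth_on_det open_S smooth_G_nth) auto
  ultimately have "smooth_on S (\<lambda>x. det (\<chi> i j. if j = k then axis l 1 $ i else G x $ i $ j)
      * inverse (det (G x)))"
    by (intro smooth_on_mult open_S)
  then show ?thesis
    by (rule smooth_on_cong[OF open_S, rotated])
      (simp add: matrix_inv_nth[OF posdef_det_nonzero[OF posdef_G]] divide_inverse)
qed

lemma smooth_christoffel: "smooth_on S (christoffel G k i j)"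
  unfolding christoffel_def[abs_def]
  by (intro smooth_on_intros open_S smooth_Gi_nth smooth_G_nth)

lemma smooth_riemann: "smooth_on S (riemann G l k i j)"
  unfolding riemann_def[abs_def]
  by (intro smooth_on_intros open_S smooth_christoffel)

lemma smooth_ricci: "smooth_on S (\<lambda>x. ricci G x $ j $ k)"
  unfolding ricci_def by (simp, intro smooth_on_intros open_S smooth_riemann)

lemma smooth_scalar_curv: "smooth_on S (scalar_curv G)"
  unfolding scalar_curv_def[abs_def]
  by (intro smooth_on_intros open_S smooth_ricci smooth_Gi_nth)

lemmas smooth_metric_intros = smooth_on_intros open_S smooth_G_nth smooth_Gi_nth smooth_christoffel

lemmas diff_christoffel = smooth_on_imp_differentiable[OF smooth_christoffel]
lemmas diff_G = smooth_on_imp_differentiable[OF smooth_G_nth]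
lemmas diff_Gi = smooth_on_imp_differentiable[OF smooth_Gi_nth]
lemmas diff_dG = smooth_on_imp_differentiable[OF smooth_on_pderiv[OF smooth_G_nth]]

lemma pderiv_G_sym: "x \<in> S \<Longrightarrow> pderiv_at k (\<lambda>y. G y $ i $ j) x = pderiv_at k (\<lambda>y. G y $ j $ i) x"
  using G_sym by (intro pderiv_at_cong_open[OF open_S]) auto

lemma christoffel_sym: "x \<in> S \<Longrightarrow> christoffel G k i j x = christoffel G k j i x"
  unfolding christoffel_def using pderiv_G_sym
  by (intro arg_cong[of _ _ "\<lambda>x. 1 / 2 * x"] sum.cong refl) (simp add: algebra_simps)

lemma lower_christoffel:
  assumes "x \<in> S"
  shows "(\<Sum>k\<in>UNIV. G x $ l $ k * christoffel G k i j x) = (1/2) *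
    (pderiv_at i (\<lambda>y. G y $ j $ l) x + pderiv_at j (\<lambda>y. G y $ i $ l) x - pderiv_at l (\<lambda>y. G y $ i $ j) x)"
proof -
  let ?L = "\<lambda>l. pderiv_at i (\<lambda>y. G y $ j $ l) x + pderiv_at j (\<lambda>y. G y $ i $ l) x - pderiv_at l (\<lambda>y. G y $ i $ j) x"
  have "(\<Sum>k\<in>UNIV. G x $ l $ k * christoffel G k i j x)
      = (\<Sum>k\<in>UNIV. \<Sum>m\<in>UNIV. (1/2) * (G x $ l $ k * Gi x $ k $ m * ?L m))"
    by (simp add: christoffel_def sum_distrib_left mult_ac)
  also have "\<dots> = (\<Sum>m\<in>UNIV. \<Sum>k\<in>UNIV. (1/2) * (G x $ l $ k * Gi x $ k $ m * ?L m))"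
    by (rule sum.swap)
  also have "\<dots> = (\<Sum>m\<in>UNIV. (1/2) * ((\<Sum>k\<in>UNIV. G x $ l $ k * Gi x $ k $ m) * ?L m))"
    by (simp add: sum_distrib_left sum_distrib_right)
  also have "\<dots> = (1/2) * ?L l"
    by (simp only: G_Gi[OF assms] if_distrib[of "\<lambda>x. x * _"] if_distrib[of "\<lambda>x. _ * x"]
        mult_1_left mult_zero_left mult_zero_right sum.delta finite UNIV_I if_True)
      (simp add: sum.delta')
  finally show ?thesis .
qed

subsection \<open>Symmetry of the Ricci tensor\<close>

text \<open>This contraction is half the logarithmic derivative of \<open>det G\<close>, which is why its derivative, a term of
the Ricci tensor, is symmetric in the two indices.\<close>

lemma christoffel_trace:
  assumes "x \<in> S"
  shows "(\<Sum>i\<in>UNIV. christoffel G i i k x)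
    = (1/2) * (\<Sum>i\<in>UNIV. \<Sum>l\<in>UNIV. Gi x $ i $ l * pderiv_at k (\<lambda>y. G y $ i $ l) x)"
proof -
  have sw: "(\<Sum>i\<in>UNIV. \<Sum>l\<in>UNIV. Gi x $ i $ l * pderiv_at i (\<lambda>y. G y $ k $ l) x)
      = (\<Sum>i\<in>UNIV. \<Sum>l\<in>UNIV. Gi x $ i $ l * pderiv_at l (\<lambda>y. G y $ i $ k) x)"
    using Gi_sym[OF assms] pderiv_G_sym[OF assms] by (subst sum.swap) simp
  have "(\<Sum>i\<in>UNIV. christoffel G i i k x) = (1/2) * (\<Sum>i\<in>UNIV. \<Sum>l\<in>UNIV. Gi x $ i $ l *
     (pderiv_at i (\<lambda>y. G y $ k $ l) x + pderiv_at k (\<lambda>y. G y $ i $ l) x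
        - pderiv_at l (\<lambda>y. G y $ i $ k) x))"
    by (simp add: christoffel_def sum_distrib_left)
  also have "\<dots> = (1/2) * (\<Sum>i\<in>UNIV. \<Sum>l\<in>UNIV. Gi x $ i $ l * pderiv_at k (\<lambda>y. G y $ i $ l) x)"
    using sw by (simp add: algebra_simps sum.distrib sum_subtractf)
  finally show ?thesis .
qed

lemma pderiv_Gi:
  assumes x: "x \<in> S"
  shows "(\<chi> i l. pderiv_at j (\<lambda>y. Gi y $ i $ l) x)
    = - (Gi x ** (\<chi> i l. pderiv_at j (\<lambda>y. G y $ i $ l) x) ** Gi x)" (is "?dGi = - (_ ** ?dG ** _)")
proof -
  have "?dGi ** G x + Gi x ** ?dG = 0"
  proof -
    have "pderiv_at j (\<lambda>y. \<Sum>k\<in>UNIV. Gi y $ a $ k * G y $ k $ b) x = 0" for a b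
      using pderiv_at_cong_open[OF open_S x, of "\<lambda>y. \<Sum>k\<in>UNIV. Gi y $ a $ k * G y $ k $ b"
          "\<lambda>y. if a = b then 1 else 0" j] by (simp add: Gi_G)
    moreover have "pderiv_at j (\<lambda>y. \<Sum>k\<in>UNIV. Gi y $ a $ k * G y $ k $ b) x
      = (\<Sum>k\<in>UNIV. pderiv_at j (\<lambda>y. Gi y $ a $ k) x * G x $ k $ b + Gi x $ a $ k * pderiv_at j (\<lambda>y. G y $ k $ b) x)" for a b
      using x by (simp add: pderiv_at_sum pderiv_at_mult diff_G diff_Gi)
    ultimately show ?thesis
      by (simp add: vec_eq_iff matrix_matrix_mult_def sum.distrib)
  qed
  then have "?dGi ** G x = - (Gi x ** ?dG)" by (simp add: eq_neg_iff_add_eq_0)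
  then have "(?dGi ** G x) ** Gi x = (- (Gi x ** ?dG)) ** Gi x" by simp
  then have "?dGi ** (G x ** Gi x) = - (Gi x ** ?dG ** Gi x)"
    by (simp add: matrix_mul_assoc) (simp add: matrix_matrix_mult_def vec_eq_iff sum_negf)
  then show ?thesis
    by (simp add: matrix_inv_inverse[OF posdef_det_nonzero[OF posdef_G[OF x]]])
qed

lemma pderiv_christoffel_trace_sym:
  assumes x: "x \<in> S"
  shows "(\<Sum>i\<in>UNIV. pderiv_at j (christoffel G i i k) x) = (\<Sum>i\<in>UNIV. pderiv_at k (christoffel G i i j) x)"
proof -
  define D where "D j = (\<chi> i l. pderiv_at j (\<lambda>y. G y $ i $ l) x)" for j
  define H where "H j k = (\<Sum>i\<in>UNIV. \<Sum>l\<in>UNIV. Gi x $ i $ l * pderiv_at j (pderiv_at k (\<lambda>y. G y $ i $ l)) x)" for j k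
  have E: "(\<Sum>i\<in>UNIV. pderiv_at j (christoffel G i i k) x)
      = - (1/2) * trace (Gi x ** D j ** Gi x ** D k) + (1/2) * H j k" for j k
  proof -
    have "(\<Sum>i\<in>UNIV. pderiv_at j (christoffel G i i k) x)
        = pderiv_at j (\<lambda>y. \<Sum>i\<in>UNIV. christoffel G i i k y) x"
      using x by (simp add: pderiv_at_sum diff_christoffel)
    also have "\<dots> = pderiv_at j (\<lambda>y. (1/2) * (\<Sum>i\<in>UNIV. \<Sum>l\<in>UNIV. Gi y $ i $ l * pderiv_at k (\<lambda>y. G y $ i $ l) y)) x"
      by (rule pderiv_at_cong_open[OF open_S x]) (rule christoffel_trace)
    also have "\<dots> = (1/2) * pderiv_at j (\<lambda>y. (\<Sum>i\<in>UNIV. \<Sum>l\<in>UNIV. Gi y $ i $ l * pderiv_at k (\<lambda>y. G y $ i $ l) y)) x"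
    proof -
      have "smooth_on S (\<lambda>y. \<Sum>i\<in>UNIV. \<Sum>l\<in>UNIV. Gi y $ i $ l * pderiv_at k (\<lambda>y. G y $ i $ l) y)"
        by (intro smooth_metric_intros)
      then show ?thesis
        using x by (subst pderiv_at_mult) (auto intro: smooth_on_imp_differentiable)
    qed
    also have "pderiv_at j (\<lambda>y. (\<Sum>i\<in>UNIV. \<Sum>l\<in>UNIV. Gi y $ i $ l * pderiv_at k (\<lambda>y. G y $ i $ l) y)) x
       = (\<Sum>i\<in>UNIV. \<Sum>l\<in>UNIV. pderiv_at j (\<lambda>y. Gi y $ i $ l) x * D k $ i $ l) + H j k"
      using x by (simp add: pderiv_at_sum pderiv_at_mult diff_Gi diff_dG D_def H_def sum.distrib)
    also have "(\<Sum>i\<in>UNIV. \<Sum>l\<in>UNIV. pderiv_at j (\<lambda>y. Gi y $ i $ l) x * D k $ i $ l)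
       = trace ((\<chi> i l. pderiv_at j (\<lambda>y. Gi y $ i $ l) x) ** D k)"
      using pderiv_G_sym[OF x, of k]
      by (simp add: trace_def matrix_matrix_mult_def D_def)
    also have "\<dots> = - trace (Gi x ** D j ** Gi x ** D k)"
      unfolding pderiv_Gi[OF x]
      by (simp add: D_def trace_def matrix_matrix_mult_def sum_negf)
    finally show ?thesis by (simp add: algebra_simps)
  qed
  have t: "trace (Gi x ** D j ** Gi x ** D k) = trace (Gi x ** D k ** Gi x ** D j)"
    using trace_mul_sym[of "Gi x ** D j" "Gi x ** D k"] by (simp add: matrix_mul_assoc)
  have h: "H j k = H k j"
    unfolding H_def using pderiv_at_commute[OF open_S smooth_G_nth x] by simp
  show ?thesis unfolding E t h ..
qed

text \<open>Symmetry of the Ricci tensor is what makes the eigenvalues in the equation real.\<close>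

lemma ricci_sym:
  assumes x: "x \<in> S"
  shows "ricci G x $ j $ k = ricci G x $ k $ j"
proof -
  have a: "pderiv_at i (christoffel G i j k) x = pderiv_at i (christoffel G i k j) x" for i
    by (rule pderiv_at_cong_open[OF open_S x]) (rule christoffel_sym)
  have b: "(\<Sum>i\<in>UNIV. \<Sum>p\<in>UNIV. christoffel G i j p x * christoffel G p i k x)
      = (\<Sum>i\<in>UNIV. \<Sum>p\<in>UNIV. christoffel G i k p x * christoffel G p i j x)"
    by (subst sum.swap) (simp add: christoffel_sym[OF x, of _ j] christoffel_sym[OF x, of _ _ k] mult.commute)
  show ?thesis
    using pderiv_christoffel_trace_sym[OF x, of j k] a b christoffel_sym[OF x, of _ j k]
    by (simp add: ricci_def riemann_def sum.distrib sum_subtractf)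
qed

end

section \<open>Conformal change of the scalar curvature\<close>

text \<open>The difference of the Christoffel symbols of \<open>exp (2 w) G\<close> and \<open>G\<close>, where \<open>\<xi>\<close> is the gradient of
\<open>w\<close>. In the scalar curvature it produces terms linear and quadratic in \<open>\<xi>\<close>, collected in
\<open>conf_linear\<close> and \<open>conf_quadratic\<close>. In invariant terms the linear part is the first-order part of
\<open>- 2 (n - 1) \<Delta> w\<close> and the quadratic part is \<open>- (n - 1) (n - 2) \<bar>\<xi>\<bar>\<^sup>2\<close>; the argument below needs
only continuity and homogeneity, so the contracted expressions are left as they arise.\<close>

definition conf_tensor :: "(real^'n \<Rightarrow> real^'n^'n) \<Rightarrow> real^'n \<Rightarrow> ('n \<Rightarrow> real) \<Rightarrow> 'n \<Rightarrow> 'n \<Rightarrow> 'n \<Rightarrow> real" where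
  "conf_tensor G x \<xi> k i j = (if k = i then \<xi> j else 0) + (if k = j then \<xi> i else 0)
     - G x $ i $ j * (\<Sum>l\<in>UNIV. matrix_inv (G x) $ k $ l * \<xi> l)"

definition conf_linear :: "(real^'n \<Rightarrow> real^'n^'n) \<Rightarrow> real^'n \<Rightarrow> ('n \<Rightarrow> real) \<Rightarrow> real" where
  "conf_linear G x \<xi> = (\<Sum>j\<in>UNIV. \<Sum>k\<in>UNIV. matrix_inv (G x) $ j $ k *
     ((\<Sum>i\<in>UNIV. \<Sum>p\<in>UNIV. christoffel G i i p x * conf_tensor G x \<xi> p j k
         + conf_tensor G x \<xi> i i p * christoffel G p j k x
         - christoffel G i j p x * conf_tensor G x \<xi> p i k
         - conf_tensor G x \<xi> i j p * christoffel G p i k x)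
      - (\<Sum>i\<in>UNIV. pderiv_at i (\<lambda>y. G y $ j $ k) x * (\<Sum>l\<in>UNIV. matrix_inv (G x) $ i $ l * \<xi> l))
      - G x $ j $ k * (\<Sum>i\<in>UNIV. \<Sum>l\<in>UNIV. pderiv_at i (\<lambda>y. matrix_inv (G y) $ i $ l) x * \<xi> l)))"

definition conf_quadratic :: "(real^'n \<Rightarrow> real^'n^'n) \<Rightarrow> real^'n \<Rightarrow> ('n \<Rightarrow> real) \<Rightarrow> real" where
  "conf_quadratic G x \<xi> = (\<Sum>j\<in>UNIV. \<Sum>k\<in>UNIV. matrix_inv (G x) $ j $ k *
     (\<Sum>i\<in>UNIV. \<Sum>p\<in>UNIV. conf_tensor G x \<xi> i i p * conf_tensor G x \<xi> p j k
        - conf_tensor G x \<xi> i j p * conf_tensor G x \<xi> p i k))"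

lemma conf_tensor_scale: "conf_tensor G x (\<lambda>i. c * \<xi> i) k i j = c * conf_tensor G x \<xi> k i j"
  by (simp add: conf_tensor_def algebra_simps sum_distrib_left)

lemma conf_linear_scale: "conf_linear G x (\<lambda>i. c * \<xi> i) = c * conf_linear G x \<xi>"
  unfolding conf_linear_def conf_tensor_scale
  by (simp add: sum_distrib_left algebra_simps sum.distrib sum_subtractf)

lemma conf_quadratic_scale: "conf_quadratic G x (\<lambda>i. c * \<xi> i) = c\<^sup>2 * conf_quadratic G x \<xi>"
  unfolding conf_quadratic_def conf_tensor_scale
  by (simp add: sum_distrib_left algebra_simps power2_eq_square)

lemma (in coordinate_metric) continuous_on_conf:
  assumes "T \<subseteq> S" "\<And>i. continuous_on T (\<lambda>x. \<xi> x i)"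
  shows "continuous_on T (\<lambda>x. conf_linear G x (\<xi> x))"
    and "continuous_on T (\<lambda>x. conf_quadratic G x (\<xi> x))"
proof -
  note smooth_cont = smooth_on_imp_continuous_on[THEN continuous_on_subset, OF _ assms(1)]
  note cont = continuous_on_sum continuous_on_mult continuous_on_add continuous_on_diff assms(2)
    smooth_cont[OF smooth_G_nth] smooth_cont[OF smooth_Gi_nth]
    smooth_cont[OF smooth_on_pderiv[OF smooth_G_nth]] smooth_cont[OF smooth_on_pderiv[OF smooth_Gi_nth]]
    smooth_cont[OF smooth_christoffel]
  have if_cont: "continuous_on T (\<lambda>x. if P then \<xi> x j else 0)" for P j
    by (cases P) (simp_all add: assms(2))
  have c: "continuous_on T (\<lambda>x. conf_tensor G x (\<xi> x) k i j)" for k i j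
    unfolding conf_tensor_def by (intro cont if_cont)
  show "continuous_on T (\<lambda>x. conf_linear G x (\<xi> x))"
    unfolding conf_linear_def
    by (intro cont c)
  show "continuous_on T (\<lambda>x. conf_quadratic G x (\<xi> x))"
    unfolding conf_quadratic_def
    by (intro cont c)
qed

lemma metric_on_conformal:
  assumes "metric_on S G" "smooth_on S w"
  shows "metric_on S (\<lambda>x. exp (2 * w x) *\<^sub>R G x)"
proof -
  interpret coordinate_metric S G using assms(1) by unfold_locales
  have 1: "smooth_on S (\<lambda>x. exp (2 * w x))"
    by (intro smooth_on_exp smooth_on_mult smooth_on_const assms(2) open_S)
  have "smooth_on S (\<lambda>x. (exp (2 * w x) *\<^sub>R G x) $ i $ j)" for i j
    using smooth_on_mult[OF open_S 1 smooth_G_nth] by simp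
  moreover have "posdef (exp (2 * w x) *\<^sub>R G x)" if "x \<in> S" for x
    using posdef_G[OF that] by (simp add: posdef_def scaleR_matrix_vector_assoc[symmetric] transpose_scalar)
  ultimately show ?thesis using open_S by (simp add: metric_on_def)
qed

lemma matrix_inv_scaleR:
  fixes A :: "real^'n^'n"
  assumes "det A \<noteq> 0" "c \<noteq> 0"
  shows "matrix_inv (c *\<^sub>R A) = inverse c *\<^sub>R matrix_inv A"
proof (rule matrix_inv_eqI)
  have "(inverse c *\<^sub>R matrix_inv A) ** (c *\<^sub>R A) = matrix_inv A ** A"
    using assms(2) by (simp add: vec_eq_iff matrix_matrix_mult_def field_simps)
  then show "(inverse c *\<^sub>R matrix_inv A) ** (c *\<^sub>R A) = mat 1"
    by (simp add: matrix_inv_inverse[OF assms(1)])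
qed

context coordinate_metric
begin

lemma christoffel_conformal:
  assumes w: "smooth_on S w" and x: "x \<in> S"
  shows "christoffel (\<lambda>x. exp (2 * w x) *\<^sub>R G x) k i j x
    = christoffel G k i j x + conf_tensor G x (\<lambda>i. pderiv_at i w x) k i j"
proof -
  let ?e = "exp (2 * w x)"
  have dw: "w differentiable (at x)" using smooth_on_imp_differentiable[OF w x] .
  have d2w: "pderiv_at i (\<lambda>y. 2 * w y) x = 2 * pderiv_at i w x" for i
    using dw by (simp add: pderiv_at_mult)
  have de: "(\<lambda>y. exp (2 * w y)) differentiable (at x)"
    by (rule smooth_on_imp_differentiable[of S])
      (intro smooth_on_exp smooth_on_mult smooth_on_const w open_S x)+
  have p: "pderiv_at i (\<lambda>y. exp (2 * w y) * G y $ a $ b) x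
      = ?e * (2 * pderiv_at i w x * G x $ a $ b + pderiv_at i (\<lambda>y. G y $ a $ b) x)" for i a b
    using dw de x by (simp add: pderiv_at_mult diff_G pderiv_at_exp d2w algebra_simps)
  have inv: "matrix_inv (?e *\<^sub>R G x) = inverse ?e *\<^sub>R Gi x"
    by (rule matrix_inv_scaleR[OF posdef_det_nonzero[OF posdef_G[OF x]]]) simp
  have s: "(\<Sum>l\<in>UNIV. Gi x $ k $ l * G x $ a $ l) = (if k = a then 1 else 0)" for a
    using Gi_G[OF x, of k a] G_sym[OF x] by simp
  have "christoffel (\<lambda>x. exp (2 * w x) *\<^sub>R G x) k i j x = (1/2) * (\<Sum>l\<in>UNIV. Gi x $ k $ l *
     (pderiv_at i (\<lambda>y. G y $ j $ l) x + pderiv_at j (\<lambda>y. G y $ i $ l) x - pderiv_at l (\<lambda>y. G y $ i $ j) x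
      + 2 * (pderiv_at i w x * G x $ j $ l + pderiv_at j w x * G x $ i $ l - pderiv_at l w x * G x $ i $ j)))"
    unfolding christoffel_def inv
    by (intro arg_cong[of _ _ "\<lambda>x. 1 / 2 * x"] sum.cong refl)
      (simp only: p vector_scaleR_component real_scaleR_def, simp add: field_simps)
  also have "\<dots> = christoffel G k i j x + (pderiv_at i w x * (\<Sum>l\<in>UNIV. Gi x $ k $ l * G x $ j $ l)
      + pderiv_at j w x * (\<Sum>l\<in>UNIV. Gi x $ k $ l * G x $ i $ l)
      - G x $ i $ j * (\<Sum>l\<in>UNIV. Gi x $ k $ l * pderiv_at l w x))"
    unfolding christoffel_def
    by (simp add: algebra_simps sum.distrib sum_subtractf sum_distrib_left)
  also have "\<dots> = christoffel G k i j x + conf_tensor G x (\<lambda>i. pderiv_at i w x) k i j"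
    by (simp add: s conf_tensor_def)
  finally show ?thesis .
qed

lemma conf_tensor_trace:
  assumes "x \<in> S"
  shows "(\<Sum>i\<in>UNIV. conf_tensor G x \<xi> i i k) = real CARD('n) * \<xi> k"
proof -
  have "(\<Sum>i\<in>UNIV. G x $ i $ k * (\<Sum>l\<in>UNIV. Gi x $ i $ l * \<xi> l))
      = (\<Sum>i\<in>UNIV. \<Sum>l\<in>UNIV. G x $ k $ i * Gi x $ i $ l * \<xi> l)"
    using G_sym[OF assms] by (simp add: sum_distrib_left mult_ac)
  also have "\<dots> = (\<Sum>l\<in>UNIV. (\<Sum>i\<in>UNIV. G x $ k $ i * Gi x $ i $ l) * \<xi> l)"
    by (subst sum.swap) (simp add: sum_distrib_right)
  also have "\<dots> = \<xi> k"
    by (simp add: G_Gi[OF assms] if_distrib[of "\<lambda>x. x * _"] cong: if_cong)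
  finally show ?thesis
    by (simp add: conf_tensor_def sum.distrib sum_subtractf)
qed

lemma smooth_conf_tensor:
  assumes "smooth_on S w"
  shows "smooth_on S (\<lambda>x. conf_tensor G x (\<lambda>i. pderiv_at i w x) k i j)"
proof -
  have "smooth_on S (\<lambda>x. if P then pderiv_at j w x else 0)" for P j
    using smooth_on_pderiv[OF assms] by (cases P) (simp_all add: smooth_on_const)
  then show ?thesis
    unfolding conf_tensor_def by (intro smooth_metric_intros assms)
qed

text \<open>The conformal transformation law \<open>exp (2 w) R' = R - 2 (n - 1) \<Delta> w - (n - 1) (n - 2) \<bar>\<nabla> w\<bar>\<^sup>2\<close>, with
only the second-order part of the Laplacian made explicit. The coefficient is
\<open>2 - n - n\<close>: two Hessian terms from the divergence of \<open>conf_tensor\<close>, \<open>n\<close> from the Laplacian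
contracted with \<open>G\<close>, and \<open>n\<close> from the derivative of the trace of \<open>conf_tensor\<close>.\<close>

theorem scalar_curv_conformal:
  assumes w: "smooth_on S w" and x: "x \<in> S"
  shows "exp (2 * w x) * scalar_curv (\<lambda>x. exp (2 * w x) *\<^sub>R G x) x
    = scalar_curv G x + conf_linear G x (\<lambda>i. pderiv_at i w x) + conf_quadratic G x (\<lambda>i. pderiv_at i w x)
      - 2 * (real CARD('n) - 1) * (\<Sum>j\<in>UNIV. \<Sum>k\<in>UNIV. Gi x $ j $ k * pderiv_at j (pderiv_at k w) x)"
proof -
  let ?n = "real CARD('n)"
  define G' where "G' = (\<lambda>x. exp (2 * w x) *\<^sub>R G x)"
  define \<xi> where "\<xi> y i = pderiv_at i w y" for y i
  define W where "W y i = (\<Sum>l\<in>UNIV. Gi y $ i $ l * \<xi> y l)" for y i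
  define c where "c k i j = christoffel G k i j x" for k i j
  define T where "T k i j = conf_tensor G x (\<xi> x) k i j" for k i j
  define D where "D j k = pderiv_at j (pderiv_at k w) x" for j k
  have eq: "christoffel G' k i j y = christoffel G k i j y + conf_tensor G y (\<xi> y) k i j" if "y \<in> S" for k i j y
    using christoffel_conformal[OF w that] by (simp add: G'_def \<xi>_def[abs_def])
  have smT: "smooth_on S (\<lambda>y. conf_tensor G y (\<xi> y) k i j)" for k i j
    using smooth_conf_tensor[OF w] by (simp add: \<xi>_def[abs_def])
  note diffT = smooth_on_imp_differentiable[OF smT x]
  have smxi: "smooth_on S (\<lambda>y. \<xi> y i)" for i
    using smooth_on_pderiv[OF w] by (simp add: \<xi>_def[abs_def])
  have smW: "smooth_on S (\<lambda>y. W y i)" for i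
    unfolding W_def by (intro smooth_metric_intros smxi)
  note diffs = smooth_on_imp_differentiable[OF smxi x] smooth_on_imp_differentiable[OF smW x]
    diff_G[OF x] diff_Gi[OF x]
  have dxi: "pderiv_at j (\<lambda>y. \<xi> y i) x = D j i" for i j
    by (simp add: \<xi>_def[abs_def] D_def)
  have pc: "pderiv_at l (christoffel G' k i j) x
      = pderiv_at l (christoffel G k i j) x + pderiv_at l (\<lambda>y. conf_tensor G y (\<xi> y) k i j) x" for l k i j
    using pderiv_at_cong_open[OF open_S x eq] by (simp add: pderiv_at_add[OF diff_christoffel[OF x] diffT])
  have dW: "(\<Sum>i\<in>UNIV. pderiv_at i (\<lambda>y. W y i) x)
      = (\<Sum>i\<in>UNIV. \<Sum>l\<in>UNIV. pderiv_at i (\<lambda>y. Gi y $ i $ l) x * \<xi> x l) + (\<Sum>i\<in>UNIV. \<Sum>l\<in>UNIV. Gi x $ i $ l * D i l)"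
    unfolding W_def by (simp add: pderiv_at_sum pderiv_at_mult diffs dxi sum.distrib)
  have div1: "(\<Sum>i\<in>UNIV. pderiv_at i (\<lambda>y. conf_tensor G y (\<xi> y) i j k) x)
      = D j k + D k j - (\<Sum>i\<in>UNIV. pderiv_at i (\<lambda>y. G y $ j $ k) x * W x i)
        - G x $ j $ k * (\<Sum>i\<in>UNIV. pderiv_at i (\<lambda>y. W y i) x)" for j k
  proof -
    have "pderiv_at i (\<lambda>y. conf_tensor G y (\<xi> y) i j k) x
       = (if i = j then D i k else 0) + (if i = k then D i j else 0)
         - (pderiv_at i (\<lambda>y. G y $ j $ k) x * W x i + G x $ j $ k * pderiv_at i (\<lambda>y. W y i) x)" for i
      unfolding conf_tensor_def W_def[symmetric]
      by (cases "i = j"; cases "i = k")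
        (simp_all add: pderiv_at_add pderiv_at_diff pderiv_at_minus pderiv_at_mult diffs dxi)
    then show ?thesis
      by (simp add: sum.distrib sum_subtractf sum_distrib_left)
  qed
  have div2: "(\<Sum>i\<in>UNIV. pderiv_at j (\<lambda>y. conf_tensor G y (\<xi> y) i i k) x) = ?n * D j k" for j k
  proof -
    have "(\<Sum>i\<in>UNIV. pderiv_at j (\<lambda>y. conf_tensor G y (\<xi> y) i i k) x)
        = pderiv_at j (\<lambda>y. \<Sum>i\<in>UNIV. conf_tensor G y (\<xi> y) i i k) x"
      using diffT by (simp add: pderiv_at_sum)
    also have "\<dots> = pderiv_at j (\<lambda>y. ?n * \<xi> y k) x"
      by (rule pderiv_at_cong_open[OF open_S x]) (rule conf_tensor_trace)
    also have "\<dots> = ?n * D j k" by (simp add: pderiv_at_mult diffs dxi)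
    finally show ?thesis .
  qed
  have ric: "ricci G' x $ j $ k = ricci G x $ j $ k
     + ((\<Sum>i\<in>UNIV. \<Sum>p\<in>UNIV. c i i p * T p j k + T i i p * c p j k - c i j p * T p i k - T i j p * c p i k)
        - (\<Sum>i\<in>UNIV. pderiv_at i (\<lambda>y. G y $ j $ k) x * W x i)
        - G x $ j $ k * (\<Sum>i\<in>UNIV. \<Sum>l\<in>UNIV. pderiv_at i (\<lambda>y. Gi y $ i $ l) x * \<xi> x l))
     + (\<Sum>i\<in>UNIV. \<Sum>p\<in>UNIV. T i i p * T p j k - T i j p * T p i k)
     + (D j k + D k j - ?n * D j k - G x $ j $ k * (\<Sum>i\<in>UNIV. \<Sum>l\<in>UNIV. Gi x $ i $ l * D i l))" for j k
  proof -
    have "ricci G' x $ j $ k = (\<Sum>i\<in>UNIV. pderiv_at i (christoffel G i j k) x - pderiv_at j (christoffel G i i k) x)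
       + ((\<Sum>i\<in>UNIV. pderiv_at i (\<lambda>y. conf_tensor G y (\<xi> y) i j k) x)
          - (\<Sum>i\<in>UNIV. pderiv_at j (\<lambda>y. conf_tensor G y (\<xi> y) i i k) x))
       + (\<Sum>i\<in>UNIV. \<Sum>p\<in>UNIV. (c i i p + T i i p) * (c p j k + T p j k) - (c i j p + T i j p) * (c p i k + T p i k))"
      by (simp add: ricci_def riemann_def pc eq[OF x] c_def T_def sum.distrib sum_subtractf)
    also have "(\<Sum>i\<in>UNIV. \<Sum>p\<in>UNIV. (c i i p + T i i p) * (c p j k + T p j k) - (c i j p + T i j p) * (c p i k + T p i k))
      = (\<Sum>i\<in>UNIV. \<Sum>p\<in>UNIV. c i i p * c p j k - c i j p * c p i k)
       + (\<Sum>i\<in>UNIV. \<Sum>p\<in>UNIV. c i i p * T p j k + T i i p * c p j k - c i j p * T p i k - T i j p * c p i k)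
       + (\<Sum>i\<in>UNIV. \<Sum>p\<in>UNIV. T i i p * T p j k - T i j p * T p i k)"
      unfolding sum.distrib[symmetric]
      by (intro sum.cong refl) (simp add: algebra_simps)
    finally show ?thesis
      unfolding div1 div2 dW
      by (simp add: ricci_def riemann_def c_def sum.distrib sum_subtractf algebra_simps)
  qed
  have tr: "(\<Sum>j\<in>UNIV. \<Sum>k\<in>UNIV. Gi x $ j $ k * G x $ j $ k) = ?n"
    using Gi_G[OF x] G_sym[OF x] by simp
  have Dsym: "D j k = D k j" for j k
    unfolding D_def by (rule pderiv_at_commute[OF open_S w x])
  let ?S = "\<Sum>j\<in>UNIV. \<Sum>k\<in>UNIV. Gi x $ j $ k * D j k"
  have last: "(\<Sum>j\<in>UNIV. \<Sum>k\<in>UNIV. Gi x $ j $ k *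
       (D j k + D k j - ?n * D j k - G x $ j $ k * (\<Sum>i\<in>UNIV. \<Sum>l\<in>UNIV. Gi x $ i $ l * D i l)))
     = - 2 * (?n - 1) * ?S"
  proof -
    have "(\<Sum>j\<in>UNIV. \<Sum>k\<in>UNIV. Gi x $ j $ k * (D j k + D k j - ?n * D j k - G x $ j $ k * s))
      = (2 - ?n) * ?S - (\<Sum>j\<in>UNIV. \<Sum>k\<in>UNIV. Gi x $ j $ k * G x $ j $ k) * s" for s
      by (simp add: Dsym[of k j for j k] sum_distrib_left sum_distrib_right sum_subtractf[symmetric] algebra_simps)
    from this[of ?S] have "(\<Sum>j\<in>UNIV. \<Sum>k\<in>UNIV. Gi x $ j $ k * (D j k + D k j - ?n * D j k - G x $ j $ k * ?S))
      = (2 - ?n) * ?S - ?n * ?S" unfolding tr .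
    moreover have "(2 - ?n) * s - ?n * s = - 2 * (?n - 1) * s" for s
      by (simp add: algebra_simps)
    ultimately show ?thesis by simp
  qed
  have inv: "matrix_inv (G' x) = inverse (exp (2 * w x)) *\<^sub>R Gi x"
    unfolding G'_def
    by (rule matrix_inv_scaleR[OF posdef_det_nonzero[OF posdef_G[OF x]]]) simp
  have "exp (2 * w x) * scalar_curv G' x = (\<Sum>j\<in>UNIV. \<Sum>k\<in>UNIV. Gi x $ j $ k * ricci G' x $ j $ k)"
    unfolding scalar_curv_def inv sum_distrib_left
    by (intro sum.cong refl) (simp add: field_simps)
  also have "\<dots> = scalar_curv G x + conf_linear G x (\<xi> x) + conf_quadratic G x (\<xi> x) + (- 2 * (?n - 1) * ?S)"
    unfolding ric last[symmetric] scalar_curv_def conf_linear_def conf_quadratic_def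
      c_def[symmetric] T_def[symmetric] W_def[symmetric] distrib_left sum.distrib
    by simp
  finally show ?thesis by (simp add: G'_def D_def \<xi>_def[abs_def] left_diff_distrib)
qed

end

section \<open>Coordinate invariance of the scalar curvature\<close>

lemma pderiv_at_nth:
  fixes F :: "real^'n \<Rightarrow> real^'m"
  assumes "F differentiable (at x)"
  shows "pderiv_at i (\<lambda>x. F x $ a) x = frechet_derivative F (at x) (axis i 1) $ a"
  using pderiv_at_eq[OF bounded_linear.has_derivative[OF bounded_linear_vec_nth has_derivative_frechet[OF assms]]] .

text \<open>\<open>G\<close> and \<open>H\<close> are the component matrices of one metric in two charts, \<open>\<phi>\<close> is the change of coordinates
and \<open>J\<close> its Jacobian matrix.\<close>

locale metric_pullback = G: coordinate_metric S G + H: coordinate_metric S' H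
  for S S' :: "(real^'n) set" and G H :: "real^'n \<Rightarrow> real^'n^'n" +
  fixes \<phi> :: "real^'n \<Rightarrow> real^'n" and J :: "real^'n \<Rightarrow> real^'n^'n"
  assumes maps: "x \<in> S \<Longrightarrow> \<phi> x \<in> S'"
    and smooth_\<phi>: "smooth_on S \<phi>"
    and J_def: "J x = matrix (frechet_derivative \<phi> (at x))"
    and pullback: "x \<in> S \<Longrightarrow> G x = transpose (J x) ** H (\<phi> x) ** J x"
begin

lemma diff_\<phi>: "x \<in> S \<Longrightarrow> \<phi> differentiable (at x)"
  using smooth_\<phi> by (rule smooth_on_imp_differentiable)

lemma J_nth: "x \<in> S \<Longrightarrow> J x $ a $ i = pderiv_at i (\<lambda>x. \<phi> x $ a) x"
  by (simp add: J_def matrix_def pderiv_at_nth diff_\<phi>)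

lemma J_frechet: "J x $ a $ i = frechet_derivative \<phi> (at x) (axis i 1) $ a"
  by (simp add: J_def matrix_def)

lemma smooth_\<phi>_nth: "smooth_on S (\<lambda>x. \<phi> x $ a)"
  using smooth_on_nth[OF G.open_S smooth_\<phi>] .

lemma smooth_J: "smooth_on S (\<lambda>x. J x $ a $ i)"
  by (rule smooth_on_cong[OF G.open_S J_nth[symmetric] smooth_on_pderiv[OF smooth_\<phi>_nth]])

lemma pderiv_J_sym:
  assumes "x \<in> S"
  shows "pderiv_at j (\<lambda>x. J x $ a $ i) x = pderiv_at i (\<lambda>x. J x $ a $ j) x"
proof -
  have "pderiv_at j (\<lambda>x. J x $ a $ i) x = pderiv_at j (pderiv_at i (\<lambda>x. \<phi> x $ a)) x" for i j
    by (rule pderiv_at_cong_open[OF G.open_S assms J_nth])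
  then show ?thesis using pderiv_at_commute[OF G.open_S smooth_\<phi>_nth assms] by simp
qed

lemmas diff_J = smooth_on_imp_differentiable[OF smooth_J]

lemma J_nonsingular: "x \<in> S \<Longrightarrow> det (J x) \<noteq> 0"
  using pullback[of x] posdef_det_nonzero[OF G.posdef_G[of x]] by (auto simp: det_mul)

lemma pderiv_compose_\<phi>:
  fixes F :: "real^'n \<Rightarrow> real"
  assumes "x \<in> S" "smooth_on S' F"
  shows "pderiv_at i (\<lambda>x. F (\<phi> x)) x = (\<Sum>c\<in>UNIV. J x $ c $ i * pderiv_at c F (\<phi> x))"
  using pderiv_at_compose[OF diff_\<phi> smooth_on_imp_differentiable[OF assms(2) maps]] assms(1)
  by (simp add: J_frechet mult.commute)

lemma diff_compose_\<phi>:
  fixes F :: "real^'n \<Rightarrow> real"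
  assumes "x \<in> S" "smooth_on S' F"
  shows "(\<lambda>x. F (\<phi> x)) differentiable (at x)"
  using differentiable_chain_at[OF diff_\<phi> smooth_on_imp_differentiable[OF assms(2) maps]] assms(1)
  by (simp add: o_def)

lemma pullback_nth:
  "x \<in> S \<Longrightarrow> G x $ i $ j = (\<Sum>a\<in>UNIV. \<Sum>b\<in>UNIV. J x $ a $ i * H (\<phi> x) $ a $ b * J x $ b $ j)"
  unfolding pullback matrix_matrix_mult_def transpose_def
  by (simp add: sum_distrib_right) (rule sum.swap)

text \<open>The two kinds of terms in the derivative of \<open>J\<^sup>T (H \<circ> \<phi>) J\<close>: the derivative falls on \<open>H\<close> or on a
factor \<open>J\<close>. The second kind inherits a symmetry from the second derivatives of \<open>\<phi>\<close>; because of it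
exactly one such term survives in the Christoffel symbols.\<close>

definition third :: "real^'n \<Rightarrow> 'n \<Rightarrow> 'n \<Rightarrow> 'n \<Rightarrow> real" where
  "third x k i j = (\<Sum>c\<in>UNIV. \<Sum>a\<in>UNIV. \<Sum>b\<in>UNIV. J x $ c $ k * J x $ a $ i * J x $ b $ j *
      pderiv_at c (\<lambda>y. H y $ a $ b) (\<phi> x))"

definition hess :: "real^'n \<Rightarrow> 'n \<Rightarrow> 'n \<Rightarrow> 'n \<Rightarrow> real" where
  "hess x k i j = (\<Sum>a\<in>UNIV. \<Sum>b\<in>UNIV. pderiv_at k (\<lambda>x. J x $ a $ i) x * H (\<phi> x) $ a $ b * J x $ b $ j)"

lemma hess_sym: "x \<in> S \<Longrightarrow> hess x k i j = hess x i k j"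
  unfolding hess_def using pderiv_J_sym by simp

lemma pderiv_pullback:
  assumes x: "x \<in> S"
  shows "pderiv_at k (\<lambda>x. G x $ i $ j) x = third x k i j + hess x k i j + hess x k j i"
proof -
  note dH = diff_compose_\<phi>[OF x H.smooth_G_nth]
  have "pderiv_at k (\<lambda>x. G x $ i $ j) x
     = pderiv_at k (\<lambda>x. \<Sum>a\<in>UNIV. \<Sum>b\<in>UNIV. J x $ a $ i * H (\<phi> x) $ a $ b * J x $ b $ j) x"
    by (rule pderiv_at_cong_open[OF G.open_S x pullback_nth])
  also have "\<dots> = (\<Sum>a\<in>UNIV. \<Sum>b\<in>UNIV.
      (pderiv_at k (\<lambda>x. J x $ a $ i) x * H (\<phi> x) $ a $ b
        + J x $ a $ i * (\<Sum>c\<in>UNIV. J x $ c $ k * pderiv_at c (\<lambda>y. H y $ a $ b) (\<phi> x))) * J x $ b $ j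
      + J x $ a $ i * H (\<phi> x) $ a $ b * pderiv_at k (\<lambda>x. J x $ b $ j) x)"
    using x by (simp add: pderiv_at_sum pderiv_at_mult diff_J dH pderiv_compose_\<phi>[OF x H.smooth_G_nth])
  also have "\<dots> = hess x k i j
      + (\<Sum>a\<in>UNIV. \<Sum>b\<in>UNIV. \<Sum>c\<in>UNIV. J x $ c $ k * J x $ a $ i * J x $ b $ j * pderiv_at c (\<lambda>y. H y $ a $ b) (\<phi> x))
      + (\<Sum>a\<in>UNIV. \<Sum>b\<in>UNIV. J x $ a $ i * H (\<phi> x) $ a $ b * pderiv_at k (\<lambda>x. J x $ b $ j) x)"
    by (simp add: hess_def sum.distrib distrib_right distrib_left sum_distrib_left sum_distrib_right mult_ac)
  also have "(\<Sum>a\<in>UNIV. \<Sum>b\<in>UNIV. \<Sum>c\<in>UNIV. J x $ c $ k * J x $ a $ i * J x $ b $ j * pderiv_at c (\<lambda>y. H y $ a $ b) (\<phi> x))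
     = (\<Sum>a\<in>UNIV. \<Sum>c\<in>UNIV. \<Sum>b\<in>UNIV. J x $ c $ k * J x $ a $ i * J x $ b $ j * pderiv_at c (\<lambda>y. H y $ a $ b) (\<phi> x))"
    by (rule sum.cong[OF refl], rule sum.swap)
  also have "\<dots> = third x k i j"
    unfolding third_def by (rule sum.swap)
  also have "(\<Sum>a\<in>UNIV. \<Sum>b\<in>UNIV. J x $ a $ i * H (\<phi> x) $ a $ b * pderiv_at k (\<lambda>x. J x $ b $ j) x)
     = (\<Sum>b\<in>UNIV. \<Sum>a\<in>UNIV. J x $ a $ i * H (\<phi> x) $ a $ b * pderiv_at k (\<lambda>x. J x $ b $ j) x)"
    by (rule sum.swap)
  also have "\<dots> = hess x k j i"
    unfolding hess_def using H.G_sym[OF maps[OF x]] by (simp add: mult_ac)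
  finally show ?thesis by simp
qed

text \<open>The Levi-Civita connection as a matrix-valued one-form: \<open>conn\<close> in the first chart, and \<open>conn'\<close> for
the form of the second chart pulled back by \<open>\<phi>\<close>, still expressed in the frame of the second chart.\<close>

definition conn :: "'n \<Rightarrow> real^'n \<Rightarrow> real^'n^'n" where
  "conn i x = (\<chi> k j. christoffel G k i j x)"

definition conn' :: "'n \<Rightarrow> real^'n \<Rightarrow> real^'n^'n" where
  "conn' i x = (\<chi> a c. \<Sum>b\<in>UNIV. J x $ b $ i * christoffel H a b c (\<phi> x))"

definition dJ :: "'n \<Rightarrow> real^'n \<Rightarrow> real^'n^'n" where
  "dJ i x = (\<chi> a k. pderiv_at i (\<lambda>y. J y $ a $ k) x)"

text \<open>The inhomogeneous transformation law of the Christoffel symbols says that \<open>conn\<close> and \<open>conn'\<close>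
are related by the gauge transformation \<open>J\<close>. In this form the transformation law of the curvature
becomes a short computation with matrices instead of a long one with indices.\<close>

lemma gauge_transformation:
  assumes x: "x \<in> S"
  shows "J x ** conn i x = dJ i x + conn' i x ** J x"
proof -
  let ?H = "H (\<phi> x)"
  let ?d = "\<lambda>a b c. pderiv_at a (\<lambda>y. H y $ b $ c) (\<phi> x)"
  have lower: "(?H ** conn' i x) $ a $ c = (1/2) * (\<Sum>b\<in>UNIV. J x $ b $ i * (?d b c a + ?d c b a - ?d a b c))" for a c
  proof -
    have "(?H ** conn' i x) $ a $ c = (\<Sum>k\<in>UNIV. \<Sum>b\<in>UNIV. J x $ b $ i * (?H $ a $ k * christoffel H k b c (\<phi> x)))"
      by (simp add: matrix_matrix_mult_def conn'_def sum_distrib_left mult_ac)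
    also have "\<dots> = (\<Sum>b\<in>UNIV. J x $ b $ i * (\<Sum>k\<in>UNIV. ?H $ a $ k * christoffel H k b c (\<phi> x)))"
      by (subst sum.swap) (simp add: sum_distrib_left)
    finally show ?thesis
      unfolding H.lower_christoffel[OF maps[OF x]] by (simp add: sum_distrib_left)
  qed
  have "(transpose (J x) ** ?H ** conn' i x ** J x) $ l $ j
      = (1/2) * (third x i j l + third x j i l - third x l i j)" for l j
  proof -
    have "(transpose (J x) ** ?H ** conn' i x ** J x) $ l $ j
       = (transpose (J x) ** (?H ** conn' i x) ** J x) $ l $ j"
      by (simp add: matrix_mul_assoc)
    also have "\<dots> = (\<Sum>c\<in>UNIV. (\<Sum>a\<in>UNIV. J x $ a $ l * (?H ** conn' i x) $ a $ c) * J x $ c $ j)"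
    proof -
      have "(transpose (J x) ** A) $ l $ c = (\<Sum>a\<in>UNIV. J x $ a $ l * A $ a $ c)"
        and "(A ** J x) $ l $ j = (\<Sum>c\<in>UNIV. A $ l $ c * J x $ c $ j)" for A :: "real^'n^'n" and c
        by (simp_all add: matrix_matrix_mult_def transpose_def)
      then show ?thesis by simp
    qed
    also have "\<dots> = (1/2) * (\<Sum>c\<in>UNIV. \<Sum>a\<in>UNIV. \<Sum>b\<in>UNIV. J x $ b $ i * J x $ c $ j * J x $ a $ l * (?d b c a + ?d c b a - ?d a b c))"
      unfolding lower by (simp add: sum_distrib_left sum_distrib_right mult_ac)
    also have "\<dots> = (1/2) *
       ((\<Sum>c\<in>UNIV. \<Sum>a\<in>UNIV. \<Sum>b\<in>UNIV. J x $ b $ i * J x $ c $ j * J x $ a $ l * ?d b c a)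
      + (\<Sum>c\<in>UNIV. \<Sum>a\<in>UNIV. \<Sum>b\<in>UNIV. J x $ b $ i * J x $ c $ j * J x $ a $ l * ?d c b a)
      - (\<Sum>c\<in>UNIV. \<Sum>a\<in>UNIV. \<Sum>b\<in>UNIV. J x $ b $ i * J x $ c $ j * J x $ a $ l * ?d a b c))"
      by (simp add: distrib_left right_diff_distrib sum.distrib sum_subtractf)
    also have "(\<Sum>c\<in>UNIV. \<Sum>a\<in>UNIV. \<Sum>b\<in>UNIV. J x $ b $ i * J x $ c $ j * J x $ a $ l * ?d b c a) = third x i j l"
    proof -
      have "(\<Sum>c\<in>UNIV. \<Sum>a\<in>UNIV. \<Sum>b\<in>UNIV. J x $ b $ i * J x $ c $ j * J x $ a $ l * ?d b c a)
         = (\<Sum>c\<in>UNIV. \<Sum>b\<in>UNIV. \<Sum>a\<in>UNIV. J x $ b $ i * J x $ c $ j * J x $ a $ l * ?d b c a)"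
        by (rule sum.cong[OF refl], rule sum.swap)
      also have "\<dots> = third x i j l" unfolding third_def by (rule sum.swap)
      finally show ?thesis .
    qed
    also have "(\<Sum>c\<in>UNIV. \<Sum>a\<in>UNIV. \<Sum>b\<in>UNIV. J x $ b $ i * J x $ c $ j * J x $ a $ l * ?d c b a) = third x j i l"
    proof -
      have "(\<Sum>c\<in>UNIV. \<Sum>a\<in>UNIV. \<Sum>b\<in>UNIV. J x $ b $ i * J x $ c $ j * J x $ a $ l * ?d c b a)
         = (\<Sum>c\<in>UNIV. \<Sum>b\<in>UNIV. \<Sum>a\<in>UNIV. J x $ b $ i * J x $ c $ j * J x $ a $ l * ?d c b a)"
        by (rule sum.cong[OF refl], rule sum.swap)
      also have "\<dots> = third x j i l" unfolding third_def by (simp add: mult_ac)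
      finally show ?thesis .
    qed
    also have "(\<Sum>c\<in>UNIV. \<Sum>a\<in>UNIV. \<Sum>b\<in>UNIV. J x $ b $ i * J x $ c $ j * J x $ a $ l * ?d a b c) = third x l i j"
    proof -
      have "(\<Sum>c\<in>UNIV. \<Sum>a\<in>UNIV. \<Sum>b\<in>UNIV. J x $ b $ i * J x $ c $ j * J x $ a $ l * ?d a b c)
         = (\<Sum>a\<in>UNIV. \<Sum>c\<in>UNIV. \<Sum>b\<in>UNIV. J x $ b $ i * J x $ c $ j * J x $ a $ l * ?d a b c)"
        by (rule sum.swap)
      also have "\<dots> = (\<Sum>a\<in>UNIV. \<Sum>b\<in>UNIV. \<Sum>c\<in>UNIV. J x $ b $ i * J x $ c $ j * J x $ a $ l * ?d a b c)"
        by (rule sum.cong[OF refl], rule sum.swap)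
      also have "\<dots> = third x l i j" unfolding third_def by (simp add: mult_ac)
      finally show ?thesis .
    qed
    finally show ?thesis .
  qed
  moreover have "(transpose (J x) ** ?H ** dJ i x) $ l $ j = hess x i j l" for l j
  proof -
    have "(transpose (J x) ** ?H ** dJ i x) $ l $ j
      = (\<Sum>b\<in>UNIV. \<Sum>a\<in>UNIV. J x $ a $ l * ?H $ a $ b * pderiv_at i (\<lambda>y. J y $ b $ j) x)"
      by (simp add: matrix_matrix_mult_def transpose_def dJ_def sum_distrib_right)
    also have "\<dots> = hess x i j l"
      unfolding hess_def using H.G_sym[OF maps[OF x]] by (simp add: mult_ac)
    finally show ?thesis .
  qed
  moreover have "(G x ** conn i x) $ l $ j
      = (1/2) * (third x i j l + third x j i l - third x l i j) + hess x i j l" for l j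
  proof -
    have "(G x ** conn i x) $ l $ j = (\<Sum>k\<in>UNIV. G x $ l $ k * christoffel G k i j x)"
      by (simp add: matrix_matrix_mult_def conn_def)
    also have "\<dots> = (1/2) * (third x i j l + third x j i l - third x l i j) + hess x i j l"
      unfolding G.lower_christoffel[OF x] pderiv_pullback[OF x]
      using hess_sym[OF x, of i j l] hess_sym[OF x, of i l j] hess_sym[OF x, of j l i]
      by simp
    finally show ?thesis .
  qed
  ultimately have "G x ** conn i x = transpose (J x) ** ?H ** dJ i x + transpose (J x) ** ?H ** conn' i x ** J x"
    by (simp add: vec_eq_iff)
  then have "(transpose (J x) ** ?H) ** (J x ** conn i x) = (transpose (J x) ** ?H) ** (dJ i x + conn' i x ** J x)"
    unfolding pullback[OF x] by (simp add: matrix_mul_assoc matrix_add_ldistrib)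
  moreover have "det (transpose (J x) ** ?H) \<noteq> 0"
    using J_nonsingular[OF x] posdef_det_nonzero[OF H.posdef_G[OF maps[OF x]]]
    by (simp add: det_mul)
  ultimately show ?thesis
    using matrix_inv_inverse(1)[of "transpose (J x) ** ?H"]
    by (metis matrix_mul_assoc matrix_mul_lid)
qed

text \<open>Curvature as a matrix-valued two-form: like \<open>conn'\<close>, \<open>curv'\<close> is pulled back by \<open>\<phi>\<close> only in its form
indices and remains an endomorphism in the frame of the second chart.\<close>

definition curv :: "'n \<Rightarrow> 'n \<Rightarrow> real^'n \<Rightarrow> real^'n^'n" where
  "curv i j x = (\<chi> l k. riemann G l k i j x)"

definition curv' :: "'n \<Rightarrow> 'n \<Rightarrow> real^'n \<Rightarrow> real^'n^'n" where
  "curv' i j x = (\<chi> m c. \<Sum>e\<in>UNIV. \<Sum>b\<in>UNIV. J x $ e $ i * J x $ b $ j * riemann H m c e b (\<phi> x))"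

definition dconn :: "'n \<Rightarrow> 'n \<Rightarrow> real^'n \<Rightarrow> real^'n^'n" where
  "dconn i j x = (\<chi> l k. pderiv_at i (\<lambda>y. conn j y $ l $ k) x)"

definition dconn' :: "'n \<Rightarrow> 'n \<Rightarrow> real^'n \<Rightarrow> real^'n^'n" where
  "dconn' i j x = (\<chi> l k. pderiv_at i (\<lambda>y. conn' j y $ l $ k) x)"

definition ddJ :: "'n \<Rightarrow> 'n \<Rightarrow> real^'n \<Rightarrow> real^'n^'n" where
  "ddJ i j x = (\<chi> l k. pderiv_at i (\<lambda>y. dJ j y $ l $ k) x)"

lemma curv_eq:
  "curv i j x = dconn i j x - dconn j i x + conn i x ** conn j x - conn j x ** conn i x"
  by (simp add: curv_def dconn_def conn_def riemann_def vec_eq_iff matrix_matrix_mult_def sum_subtractf)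

lemma diff_conn: "x \<in> S \<Longrightarrow> (\<lambda>y. conn j y $ l $ k) differentiable (at x)"
  by (simp add: conn_def G.diff_christoffel)

lemma diff_conn': "x \<in> S \<Longrightarrow> (\<lambda>y. conn' j y $ l $ k) differentiable (at x)"
  by (simp add: conn'_def diff_J diff_compose_\<phi>[OF _ H.smooth_christoffel])

lemma diff_dJ: "x \<in> S \<Longrightarrow> (\<lambda>y. dJ j y $ l $ k) differentiable (at x)"
  using smooth_on_imp_differentiable[OF smooth_on_pderiv[OF smooth_J]] by (simp add: dJ_def)

lemma dconn'_nth:
  assumes x: "x \<in> S"
  shows "dconn' i j x $ m $ c
    = (\<Sum>b\<in>UNIV. \<Sum>e\<in>UNIV. J x $ e $ i * J x $ b $ j * pderiv_at e (christoffel H m b c) (\<phi> x))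
     + (\<Sum>b\<in>UNIV. dJ i x $ b $ j * christoffel H m b c (\<phi> x))"
proof -
  have "dconn' i j x $ m $ c = (\<Sum>b\<in>UNIV. pderiv_at i (\<lambda>y. J y $ b $ j) x * christoffel H m b c (\<phi> x)
     + J x $ b $ j * (\<Sum>e\<in>UNIV. J x $ e $ i * pderiv_at e (christoffel H m b c) (\<phi> x)))"
    using x by (simp add: dconn'_def conn'_def pderiv_at_sum pderiv_at_mult diff_J
        diff_compose_\<phi>[OF _ H.smooth_christoffel] pderiv_compose_\<phi>[OF _ H.smooth_christoffel])
  then show ?thesis
    by (simp add: dJ_def sum.distrib sum_distrib_left mult_ac)
qed

lemma conn'_mult_nth:
  "(conn' i x ** conn' j x) $ m $ c
    = (\<Sum>e\<in>UNIV. \<Sum>b\<in>UNIV. J x $ e $ i * J x $ b $ j *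
        (\<Sum>p\<in>UNIV. christoffel H m e p (\<phi> x) * christoffel H p b c (\<phi> x)))"
proof -
  have "(conn' i x ** conn' j x) $ m $ c
    = (\<Sum>p\<in>UNIV. \<Sum>e\<in>UNIV. \<Sum>b\<in>UNIV. (J x $ e $ i * christoffel H m e p (\<phi> x)) * (J x $ b $ j * christoffel H p b c (\<phi> x)))"
    by (simp add: matrix_matrix_mult_def conn'_def sum_product)
  also have "\<dots> = (\<Sum>e\<in>UNIV. \<Sum>p\<in>UNIV. \<Sum>b\<in>UNIV. (J x $ e $ i * christoffel H m e p (\<phi> x)) * (J x $ b $ j * christoffel H p b c (\<phi> x)))"
    by (rule sum.swap)
  also have "\<dots> = (\<Sum>e\<in>UNIV. \<Sum>b\<in>UNIV. \<Sum>p\<in>UNIV. (J x $ e $ i * christoffel H m e p (\<phi> x)) * (J x $ b $ j * christoffel H p b c (\<phi> x)))"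
    by (rule sum.cong[OF refl], rule sum.swap)
  finally show ?thesis by (simp add: sum_distrib_left mult_ac)
qed

text \<open>The pulled-back curvature is the curvature of the pulled-back connection: the second derivatives of
\<open>\<phi>\<close> that enter through \<open>dconn'\<close> are symmetric and cancel.\<close>

lemma curv'_eq:
  assumes x: "x \<in> S"
  shows "curv' i j x = dconn' i j x - dconn' j i x + conn' i x ** conn' j x - conn' j x ** conn' i x"
proof -
  have "dJ i x $ b $ j = dJ j x $ b $ i" for b
    using pderiv_J_sym[OF x] by (simp add: dJ_def)
  moreover have "(\<Sum>b\<in>UNIV. \<Sum>e\<in>UNIV. J x $ e $ i * J x $ b $ j * pderiv_at e (christoffel H m b c) (\<phi> x))
     = (\<Sum>e\<in>UNIV. \<Sum>b\<in>UNIV. J x $ e $ i * J x $ b $ j * pderiv_at e (christoffel H m b c) (\<phi> x))" for m c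
    by (rule sum.swap)
  moreover have "(\<Sum>b\<in>UNIV. \<Sum>e\<in>UNIV. J x $ e $ j * J x $ b $ i * pderiv_at e (christoffel H m b c) (\<phi> x))
     = (\<Sum>e\<in>UNIV. \<Sum>b\<in>UNIV. J x $ e $ i * J x $ b $ j * pderiv_at b (christoffel H m e c) (\<phi> x))" for m c
    by (simp add: mult_ac)
  moreover have "(conn' j x ** conn' i x) $ m $ c
    = (\<Sum>e\<in>UNIV. \<Sum>b\<in>UNIV. J x $ e $ i * J x $ b $ j *
        (\<Sum>p\<in>UNIV. christoffel H m b p (\<phi> x) * christoffel H p e c (\<phi> x)))" for m c
    unfolding conn'_mult_nth by (subst sum.swap) (simp add: mult_ac)
  ultimately show ?thesis
    by (simp add: vec_eq_iff curv'_def dconn'_nth[OF x] conn'_mult_nth riemann_def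
        distrib_left right_diff_distrib sum.distrib sum_subtractf)
qed

lemma derived_gauge_transformation:
  assumes x: "x \<in> S"
  shows "dJ i x ** conn j x + J x ** dconn i j x = ddJ i j x + dconn' i j x ** J x + conn' j x ** dJ i x"
proof -
  have "(dJ i x ** conn j x + J x ** dconn i j x) $ l $ k
      = (ddJ i j x + dconn' i j x ** J x + conn' j x ** dJ i x) $ l $ k" for l k
  proof -
    have "pderiv_at i (\<lambda>y. \<Sum>m\<in>UNIV. J y $ l $ m * conn j y $ m $ k) x
       = pderiv_at i (\<lambda>y. dJ j y $ l $ k + (\<Sum>m\<in>UNIV. conn' j y $ l $ m * J y $ m $ k)) x"
      by (rule pderiv_at_cong_open[OF G.open_S x])
        (use gauge_transformation in \<open>simp add: vec_eq_iff matrix_matrix_mult_def\<close>)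
    then show ?thesis
      using x by (simp add: pderiv_at_sum pderiv_at_mult pderiv_at_add diff_J diff_conn diff_conn' diff_dJ
          ddJ_def dconn_def dconn'_def matrix_matrix_mult_def sum.distrib dJ_def[symmetric])
        (simp add: dJ_def)
  qed
  then show ?thesis by (simp add: vec_eq_iff)
qed

lemma ddJ_sym:
  assumes x: "x \<in> S"
  shows "ddJ i j x = ddJ j i x"
  using pderiv_at_commute[OF G.open_S smooth_J x] by (simp add: ddJ_def dJ_def)

text \<open>Antisymmetrize the differentiated gauge law and eliminate the derivatives of \<open>J\<close> by the gauge law
itself; the second derivatives of \<open>J\<close> cancel.\<close>

lemma curv_transformation:
  assumes x: "x \<in> S"
  shows "J x ** curv i j x = curv' i j x ** J x"
proof -
  note d = derived_gauge_transformation[OF x]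
  have e: "dJ i x = J x ** conn i x - conn' i x ** J x" for i
    using gauge_transformation[OF x, of i] by simp
  have 1: "J x ** dconn i j x = ddJ i j x + dconn' i j x ** J x
      + conn' j x ** (J x ** conn i x) - conn' j x ** (conn' i x ** J x)
      - (J x ** conn i x) ** conn j x + (conn' i x ** J x) ** conn j x" for i j
    using d[of i j] unfolding e
    by (simp add: matrix_sub_ldistrib matrix_sub_rdistrib algebra_simps)
  show ?thesis
    unfolding curv_eq curv'_eq[OF x]
    by (simp add: matrix_sub_ldistrib matrix_sub_rdistrib matrix_add_ldistrib matrix_add_rdistrib 1
        ddJ_sym[OF x, of j i] matrix_mul_assoc algebra_simps)
qed

lemma ricci_transformation:
  assumes x: "x \<in> S"
  shows "ricci G x = transpose (J x) ** ricci H (\<phi> x) ** J x"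
proof -
  let ?K = "matrix_inv (J x)"
  have KJ: "(\<Sum>i\<in>UNIV. J x $ e $ i * ?K $ i $ m) = (if e = m then 1 else 0)" for e m
    using matrix_inv_inverse(2)[OF J_nonsingular[OF x]]
    by (auto simp: vec_eq_iff matrix_matrix_mult_def mat_def)
  have "ricci G x $ j $ k = (transpose (J x) ** ricci H (\<phi> x) ** J x) $ j $ k" for j k
  proof -
    define Q where "Q m e c = (\<Sum>b\<in>UNIV. J x $ b $ j * riemann H m c e b (\<phi> x))" for m e c
    have c': "curv' i j x $ m $ c = (\<Sum>e\<in>UNIV. J x $ e $ i * Q m e c)" for i m c
      by (simp add: curv'_def Q_def sum_distrib_left mult_ac)
    have "curv i j x = ?K ** (curv' i j x ** J x)" for i
      using curv_transformation[OF x, of i j] matrix_inv_inverse(1)[OF J_nonsingular[OF x]]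
      by (metis matrix_mul_assoc matrix_mul_lid)
    then have "ricci G x $ j $ k = (\<Sum>i\<in>UNIV. (?K ** (curv' i j x ** J x)) $ i $ k)"
      by (simp add: ricci_def curv_def vec_eq_iff)
    also have "\<dots> = (\<Sum>i\<in>UNIV. ((?K ** curv' i j x) ** J x) $ i $ k)"
      by (simp add: matrix_mul_assoc)
    also have "\<dots> = (\<Sum>i\<in>UNIV. \<Sum>c\<in>UNIV. (\<Sum>m\<in>UNIV. \<Sum>e\<in>UNIV. J x $ e $ i * ?K $ i $ m * Q m e c) * J x $ c $ k)"
      by (simp add: matrix_matrix_mult_def c' sum_distrib_left mult_ac)
    also have "\<dots> = (\<Sum>c\<in>UNIV. \<Sum>i\<in>UNIV. (\<Sum>m\<in>UNIV. \<Sum>e\<in>UNIV. J x $ e $ i * ?K $ i $ m * Q m e c) * J x $ c $ k)"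
      by (rule sum.swap)
    also have "\<dots> = (\<Sum>c\<in>UNIV. (\<Sum>i\<in>UNIV. \<Sum>m\<in>UNIV. \<Sum>e\<in>UNIV. J x $ e $ i * ?K $ i $ m * Q m e c) * J x $ c $ k)"
      by (simp only: sum_distrib_right)
    also have "\<dots> = (\<Sum>c\<in>UNIV. (\<Sum>m\<in>UNIV. Q m m c) * J x $ c $ k)"
    proof -
      have "(\<Sum>i\<in>UNIV. \<Sum>m\<in>UNIV. \<Sum>e\<in>UNIV. J x $ e $ i * ?K $ i $ m * Q m e c) = (\<Sum>m\<in>UNIV. Q m m c)" for c
      proof -
        have "(\<Sum>i\<in>UNIV. \<Sum>m\<in>UNIV. \<Sum>e\<in>UNIV. J x $ e $ i * ?K $ i $ m * Q m e c)
          = (\<Sum>m\<in>UNIV. \<Sum>i\<in>UNIV. \<Sum>e\<in>UNIV. J x $ e $ i * ?K $ i $ m * Q m e c)"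
          by (rule sum.swap)
        also have "\<dots> = (\<Sum>m\<in>UNIV. \<Sum>e\<in>UNIV. \<Sum>i\<in>UNIV. J x $ e $ i * ?K $ i $ m * Q m e c)"
          by (rule sum.cong[OF refl], rule sum.swap)
        also have "\<dots> = (\<Sum>m\<in>UNIV. \<Sum>e\<in>UNIV. (if e = m then 1 else 0) * Q m e c)"
          by (simp only: sum_distrib_right[symmetric] KJ)
        also have "\<dots> = (\<Sum>m\<in>UNIV. Q m m c)"
          by (simp add: if_distrib[of "\<lambda>x. x * _"] cong: if_cong)
        finally show ?thesis .
      qed
      then show ?thesis by simp
    qed
    also have "\<dots> = (\<Sum>c\<in>UNIV. (\<Sum>b\<in>UNIV. J x $ b $ j * ricci H (\<phi> x) $ b $ c) * J x $ c $ k)"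
    proof -
      have "(\<Sum>m\<in>UNIV. Q m m c) = (\<Sum>b\<in>UNIV. J x $ b $ j * ricci H (\<phi> x) $ b $ c)" for c
        unfolding Q_def ricci_def by (subst sum.swap) (simp add: sum_distrib_left)
      then show ?thesis by simp
    qed
    also have "\<dots> = (transpose (J x) ** ricci H (\<phi> x) ** J x) $ j $ k"
      by (simp add: matrix_matrix_mult_def transpose_def)
    finally show ?thesis .
  qed
  then show ?thesis by (simp add: vec_eq_iff)
qed

end

lemma scalar_curv_trace: "scalar_curv G x = trace (matrix_inv (G x) ** transpose (ricci G x))"
  by (simp add: scalar_curv_def trace_def matrix_matrix_mult_def transpose_def)

text \<open>Each point of the manifold carries its own preferred chart, in which the equation is formulated. The
equation can be studied in one fixed chart around a point only because of this invariance.\<close>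

theorem scalar_curv_invariant:
  fixes G H :: "real^'n \<Rightarrow> real^'n^'n"
  assumes "metric_on S G" "metric_on S' H" "\<And>x. x \<in> S \<Longrightarrow> \<phi> x \<in> S'" "smooth_on S \<phi>"
    and "\<And>x. x \<in> S \<Longrightarrow> G x = transpose (matrix (frechet_derivative \<phi> (at x))) ** H (\<phi> x)
             ** matrix (frechet_derivative \<phi> (at x))"
    and x: "x \<in> S"
  shows "scalar_curv G x = scalar_curv H (\<phi> x)"
proof -
  define J where "J x = matrix (frechet_derivative \<phi> (at x))" for x
  interpret metric_pullback S S' G H \<phi> J
    using assms by unfold_locales (auto simp: J_def)
  let ?K = "matrix_inv (J x)" and ?H = "H (\<phi> x)"
  have J: "?K ** J x = mat 1" "J x ** ?K = mat 1"
    using matrix_inv_inverse[OF J_nonsingular[OF x]] by auto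
  then have JT: "transpose ?K ** transpose (J x) = mat 1"
    by (metis matrix_transpose_mul transpose_mat)
  have H: "matrix_inv ?H ** ?H = mat 1"
    using matrix_inv_inverse[OF posdef_det_nonzero[OF H.posdef_G[OF maps[OF x]]]] by auto
  have "(?K ** matrix_inv ?H ** transpose ?K) ** G x
      = ?K ** (matrix_inv ?H ** ((transpose ?K ** transpose (J x)) ** (?H ** J x)))"
    unfolding pullback[OF x] by (simp add: matrix_mul_assoc)
  also have "\<dots> = ?K ** ((matrix_inv ?H ** ?H) ** J x)"
    unfolding JT by (simp add: matrix_mul_assoc)
  also have "\<dots> = mat 1" unfolding H using J by simp
  finally have inv: "matrix_inv (G x) = ?K ** matrix_inv ?H ** transpose ?K"
    by (rule matrix_inv_eqI)
  have "matrix_inv (G x) ** transpose (ricci G x)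
     = ?K ** (matrix_inv ?H ** ((transpose ?K ** transpose (J x)) ** (transpose (ricci H (\<phi> x)) ** J x)))"
    unfolding inv ricci_transformation[OF x]
    by (simp add: matrix_transpose_mul matrix_mul_assoc)
  also have "\<dots> = ?K ** ((matrix_inv ?H ** transpose (ricci H (\<phi> x))) ** J x)"
    unfolding JT by (simp add: matrix_mul_assoc)
  finally have "trace (matrix_inv (G x) ** transpose (ricci G x))
     = trace (?K ** ((matrix_inv ?H ** transpose (ricci H (\<phi> x))) ** J x))"
    by (rule arg_cong)
  also have "\<dots> = trace (((matrix_inv ?H ** transpose (ricci H (\<phi> x))) ** J x) ** ?K)"
    by (rule trace_mul_sym)
  also have "\<dots> = trace (matrix_inv ?H ** transpose (ricci H (\<phi> x)))"
    by (simp add: matrix_mul_assoc[symmetric] J)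
  finally show ?thesis by (simp add: scalar_curv_trace)
qed

section \<open>Interior upper bound on a coordinate ball\<close>

lemma second_derivative_test:
  fixes z :: "real^'n \<Rightarrow> real"
  assumes B: "open B" "x0 \<in> B" and diff: "\<And>x. x \<in> B \<Longrightarrow> z differentiable (at x)"
    and diff2: "\<And>k. pderiv_at k z differentiable (at x0)"
    and max: "\<And>x. x \<in> B \<Longrightarrow> z x \<le> z x0"
  shows "pderiv_at k z x0 = 0"
    and "(\<Sum>j\<in>UNIV. \<Sum>k\<in>UNIV. v $ j * v $ k * pderiv_at j (pderiv_at k z) x0) \<le> 0" (is "?L \<le> 0")
proof -
  have "frechet_derivative z (at x0) = (\<lambda>v. 0)"
    using differential_zero_maxmin[OF B(2,1) has_derivative_frechet[OF diff[OF B(2)]]] max by blast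
  then show crit: "pderiv_at k z x0 = 0" for k by (simp add: pderiv_at_def)
  show "?L \<le> 0"
  proof (rule ccontr)
    assume "\<not> ?L \<le> 0"
    then have L: "?L > 0" by simp
    obtain r where r: "r > 0" "ball x0 r \<subseteq> B"
      using B open_contains_ball by blast
    define d where "d = r / (norm v + 1)"
    have nv: "norm v + 1 > 0" using norm_ge_zero[of v] by linarith
    have d: "d > 0" using r nv by (simp add: d_def)
    have inB: "x0 + t *\<^sub>R v \<in> B" if "0 \<le> t" "t < d" for t
    proof -
      have "t * norm v \<le> t * (norm v + 1)" using that by (intro mult_left_mono) auto
      also have "\<dots> < r" using that(2) nv by (simp add: d_def pos_less_divide_eq)
      finally have "dist (x0 + t *\<^sub>R v) x0 < r" using that by (simp add: dist_norm)
      then show ?thesis using r(2) by (auto simp: dist_commute)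
    qed
    define \<phi> where "\<phi> t = z (x0 + t *\<^sub>R v)" for t
    define \<phi>' where "\<phi>' t = (\<Sum>k\<in>UNIV. v $ k * pderiv_at k z (x0 + t *\<^sub>R v))" for t
    have D1: "(\<phi> has_real_derivative \<phi>' t) (at t)" if "0 \<le> t" "t < d" for t
      unfolding \<phi>_def \<phi>'_def using diff[OF inB[OF that]] by (rule has_real_derivative_line)
    have "((\<lambda>t. pderiv_at k z (x0 + t *\<^sub>R v)) has_real_derivative
        (\<Sum>j\<in>UNIV. v $ j * pderiv_at j (pderiv_at k z) (x0 + 0 *\<^sub>R v))) (at 0)" for k
      using diff2[of k] by (intro has_real_derivative_line) simp
    then have "(\<phi>' has_real_derivative
        (\<Sum>k\<in>UNIV. v $ k * (\<Sum>j\<in>UNIV. v $ j * pderiv_at j (pderiv_at k z) (x0 + 0 *\<^sub>R v)))) (at 0)"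
      unfolding \<phi>'_def by (intro DERIV_sum DERIV_cmult)
    moreover have "(\<Sum>k\<in>UNIV. v $ k * (\<Sum>j\<in>UNIV. v $ j * pderiv_at j (pderiv_at k z) (x0 + 0 *\<^sub>R v))) = ?L"
      by (subst sum.swap) (simp add: sum_distrib_left mult_ac)
    ultimately have D2: "(\<phi>' has_real_derivative ?L) (at 0)" by simp
    obtain e where e: "e > 0" "\<forall>h>0. h < e \<longrightarrow> \<phi>' 0 < \<phi>' (0 + h)"
      using DERIV_pos_inc_right[OF D2 L] by blast
    define h where "h = min e d / 2"
    have h: "0 < h" "h < e" "h < d" using e(1) d by (auto simp: h_def min_def)
    obtain s where s: "0 < s" "s < h" "\<phi> h - \<phi> 0 = (h - 0) * \<phi>' s"
      using MVT2[of 0 h \<phi> \<phi>'] D1 h by auto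
    have "\<phi>' 0 = 0" by (simp add: \<phi>'_def crit)
    then have "\<phi>' s > 0" using e(2) s h by auto
    then have "h * \<phi>' s > 0" using h(1) by simp
    then have "\<phi> h > \<phi> 0" using s(3) by simp
    moreover have "\<phi> h \<le> \<phi> 0" using max[OF inB[of h]] h by (simp add: \<phi>_def)
    ultimately show False by simp
  qed
qed

lemma smooth_on_coordinate:
  assumes "open S"
  shows "smooth_on S (\<lambda>x :: real^'n. x $ i)"
proof -
  have "Ck_on k S (\<lambda>x :: real^'n. x)" for k
    using smooth_on_const[where 'b = "real^'n"] by (cases k) (auto simp: smooth_on_def)
  then have "smooth_on S (\<lambda>x :: real^'n. x)" by (simp add: smooth_on_def)
  then show ?thesis by (rule smooth_on_nth[OF assms])
qed

lemma pderiv_at_coordinate: "pderiv_at j (\<lambda>x. x $ i - c) x = (if i = j then 1 else 0)"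
proof -
  have "((\<lambda>x. x $ i - c) has_derivative (\<lambda>v. v $ i)) (at x)"
    by (auto intro!: derivative_eq_intros bounded_linear.has_derivative[OF bounded_linear_vec_nth])
  from pderiv_at_eq[OF this] show ?thesis by (simp add: axis_def)
qed

text \<open>The barrier argument. With \<open>\<rho> x = r\<^sup>2 - \<bar>x - a\<bar>\<^sup>2\<close>, the function \<open>\<rho> exp w\<close> vanishes on the boundary of the
ball and so has an interior maximum, where the gradient of \<open>w\<close> equals that of \<open>- ln \<rho>\<close> and
its Hessian is at most that of \<open>- ln \<rho>\<close>. There \<open>exp (2 w) R'\<close> is bounded below by
\<open>F / \<rho>\<^sup>2\<close> with \<open>F\<close> continuous on the closed ball and independent of \<open>w\<close>, while the hypothesis bounds
it above by \<open>- \<kappa> exp (2 w)\<close>. This bounds the maximum of \<open>\<rho> exp w\<close>, hence \<open>w\<close> on the half ball, whatever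
the values of \<open>w\<close> at the boundary.\<close>

theorem coordinate_upper_bound:
  fixes G :: "real^'n \<Rightarrow> real^'n^'n"
  assumes G: "metric_on S G" and r: "0 < r" and sub: "cball a r \<subseteq> S"
    and \<kappa>: "continuous_on (cball a r) \<kappa>" "\<And>x. x \<in> cball a r \<Longrightarrow> \<kappa> x > 0"
  shows "\<exists>C. \<forall>w. smooth_on S w \<and>
      (\<forall>x\<in>cball a r. scalar_curv (\<lambda>x. exp (2 * w x) *\<^sub>R G x) x \<le> - \<kappa> x)
      \<longrightarrow> (\<forall>x\<in>ball a (r / 2). w x \<le> C)"
proof -
  interpret coordinate_metric S G using G by unfold_locales
  let ?n = "real CARD('n)"
  define \<rho> where "\<rho> x = r\<^sup>2 - (\<Sum>i\<in>UNIV. (x $ i - a $ i) * (x $ i - a $ i))" for x :: "real^'n"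
  define \<eta> where "\<eta> x i = 2 * (x $ i - a $ i)" for x :: "real^'n" and i
  have \<rho>_eq: "\<rho> x = r\<^sup>2 - (dist a x)\<^sup>2" for x
    by (simp add: \<rho>_def dist_norm norm_minus_commute[of a] power2_norm_eq_inner inner_vec_def)
  have \<rho>_pos_iff: "\<rho> x > 0 \<longleftrightarrow> x \<in> ball a r" for x
    using r by (simp add: \<rho>_eq) (metis abs_of_nonneg abs_of_pos abs_square_less_1 power2_less_imp_less power_strict_mono zero_le_dist less_imp_le zero_less_numeral pos2)
  have sm_c: "smooth_on UNIV (\<lambda>x. x $ i - a $ i)" for i :: 'n
    by (intro smooth_on_diff smooth_on_coordinate smooth_on_const open_UNIV)
  have sm_\<rho>: "smooth_on UNIV \<rho>"
    unfolding \<rho>_def[abs_def] 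
    by (rule smooth_on_diff[OF open_UNIV smooth_on_const smooth_on_sum[OF open_UNIV]])
      (rule smooth_on_mult[OF open_UNIV sm_c sm_c])
  have sm_\<eta>: "smooth_on UNIV (\<lambda>x. \<eta> x i)" for i
    unfolding \<eta>_def by (intro smooth_on_mult smooth_on_const sm_c open_UNIV)
  have d_c: "(\<lambda>x. x $ i - a $ i) differentiable (at x)" for x :: "real^'n" and i
    using smooth_on_imp_differentiable[OF sm_c] by simp
  have d_\<rho>: "\<rho> differentiable (at x)" for x
    using smooth_on_imp_differentiable[OF sm_\<rho>] by simp
  have d_\<eta>: "(\<lambda>x. \<eta> x i) differentiable (at x)" for x i
    using smooth_on_imp_differentiable[OF sm_\<eta>] by simp
  have p_\<eta>: "pderiv_at j (\<lambda>x. \<eta> x k) x = (if j = k then 2 else 0)" for j k x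
    unfolding \<eta>_def
    by (subst pderiv_at_mult[OF _ d_c]) (auto simp: pderiv_at_coordinate)
  have p_\<rho>: "pderiv_at j \<rho> x = - \<eta> x j" for j x
  proof -
    have "pderiv_at j (\<lambda>x. (x $ i - a $ i) * (x $ i - a $ i)) x
        = 2 * (x $ i - a $ i) * (if i = j then 1 else 0)" for i
      unfolding pderiv_at_mult[OF d_c d_c] pderiv_at_coordinate by simp
    then have "pderiv_at j \<rho> x = - (\<Sum>i\<in>UNIV. 2 * (x $ i - a $ i) * (if i = j then 1 else 0))"
      unfolding \<rho>_def[abs_def]
      by (subst pderiv_at_diff) (simp_all add: pderiv_at_sum d_c)
    then show ?thesis by (simp add: \<eta>_def if_distrib[of "\<lambda>x. _ * x"] cong: if_cong)
  qed
  \<comment> \<open>\<open>\<rho>\<^sup>2\<close> times the right-hand side of the conformal law with \<open>w\<close> replaced by \<open>- ln \<rho>\<close>, whose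
    gradient is \<open>\<eta> / \<rho>\<close>. The factor clears all denominators, so \<open>F\<close> stays bounded up to the boundary.\<close>
  define F where "F x = (\<rho> x)\<^sup>2 * scalar_curv G x + \<rho> x * conf_linear G x (\<eta> x) + conf_quadratic G x (\<eta> x)
      - 2 * (?n - 1) * (\<Sum>j\<in>UNIV. \<Sum>k\<in>UNIV. Gi x $ j $ k * ((if j = k then 2 * \<rho> x else 0) + \<eta> x j * \<eta> x k))" for x
  have cont_\<rho>: "continuous_on T \<rho>" for T
    using smooth_on_imp_continuous_on[OF sm_\<rho>] continuous_on_subset by blast
  have cont_\<eta>: "continuous_on T (\<lambda>x. \<eta> x i)" for T i
    using smooth_on_imp_continuous_on[OF sm_\<eta>] continuous_on_subset by blast
  have "continuous_on (cball a r) F"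
  proof -
    note smooth_cont = smooth_on_imp_continuous_on[THEN continuous_on_subset, OF _ sub]
    have c: "continuous_on (cball a r) (\<lambda>x. if P then 2 * \<rho> x else 0)" for P
      by (cases P) (auto intro!: continuous_intros cont_\<rho>)
    show ?thesis
      unfolding F_def
      by (intro continuous_on_diff continuous_on_add continuous_on_mult continuous_on_power continuous_on_sum
          continuous_on_const cont_\<rho> cont_\<eta> c
          smooth_cont[OF smooth_scalar_curv] smooth_cont[OF smooth_Gi_nth]
          continuous_on_conf[OF sub])
  qed
  moreover have ne: "cball a r \<noteq> {}" using r by simp
  ultimately obtain x1 where x1: "x1 \<in> cball a r" "\<And>x. x \<in> cball a r \<Longrightarrow> F x1 \<le> F x"
    using continuous_attains_inf[of "cball a r" F] by auto
  obtain x2 where x2: "x2 \<in> cball a r" "\<And>x. x \<in> cball a r \<Longrightarrow> \<kappa> x2 \<le> \<kappa> x"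
    using continuous_attains_inf[OF compact_cball ne \<kappa>(1)] by auto
  define m where "m = \<kappa> x2"
  have m: "m > 0" "\<And>x. x \<in> cball a r \<Longrightarrow> m \<le> \<kappa> x" using x2 \<kappa>(2) by (auto simp: m_def)
  \<comment> \<open>The resulting bound for the maximum of \<open>\<rho> exp w\<close>.\<close>
  define Q where "Q = sqrt (\<bar>F x1\<bar> / m)"
  \<comment> \<open>On the half ball \<open>\<rho> \<ge> 3 r\<^sup>2 / 4\<close>, and \<open>w \<le> exp w\<close>.\<close>
  define C where "C = Q / (3 / 4 * r\<^sup>2)"
  have "w x \<le> C"
    if w: "smooth_on S w" and R: "\<forall>x\<in>cball a r. scalar_curv (\<lambda>x. exp (2 * w x) *\<^sub>R G x) x \<le> - \<kappa> x"
      and x: "x \<in> ball a (r / 2)" for w x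
  proof -
    define q where "q x = \<rho> x * exp (w x)" for x
    have "continuous_on (cball a r) q"
      unfolding q_def using smooth_on_imp_continuous_on[OF w] sub
      by (intro continuous_intros cont_\<rho>) (rule continuous_on_subset)
    then obtain x0 where x0: "x0 \<in> cball a r" "\<And>x. x \<in> cball a r \<Longrightarrow> q x \<le> q x0"
      using continuous_attains_sup[OF compact_cball ne] by blast
    have "q a > 0" using \<rho>_pos_iff[of a] r by (simp add: q_def)
    then have q0: "q x0 > 0" using x0(2)[of a] r by simp
    then have \<rho>0: "\<rho> x0 > 0" by (simp add: q_def zero_less_mult_iff)
    then have x0b: "x0 \<in> ball a r" using \<rho>_pos_iff by blast
    have bS: "y \<in> S" if "y \<in> ball a r" for y using that sub ball_subset_cball by blast
    define z where "z x = w x + ln (\<rho> x)" for x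
    have zd: "(z has_derivative (\<lambda>v. frechet_derivative w (at y) v + frechet_derivative \<rho> (at y) v * inverse (\<rho> y))) (at y)"
      if "y \<in> ball a r" for y
    proof -
      have "\<rho> y > 0" using \<rho>_pos_iff that by blast
      then show ?thesis
        unfolding z_def
        using has_derivative_frechet[OF smooth_on_imp_differentiable[OF w bS[OF that]]] has_derivative_frechet[OF d_\<rho>]
        by (auto intro!: derivative_eq_intros simp: field_simps)
    qed
    have pz: "pderiv_at k z y = pderiv_at k w y - \<eta> y k * inverse (\<rho> y)" if "y \<in> ball a r" for y k
      using pderiv_at_eq[OF zd[OF that], of k] p_\<rho>[of k y] by (simp add: pderiv_at_def)
    have d_i: "(\<lambda>y. inverse (\<rho> y)) differentiable (at x0)"
      using d_\<rho> \<rho>0 by (auto intro!: differentiable_inverse)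
    have p_i: "pderiv_at j (\<lambda>y. inverse (\<rho> y)) x0 = \<eta> x0 j * inverse (\<rho> x0) * inverse (\<rho> x0)" for j
    proof -
      have "((\<lambda>y. inverse (\<rho> y)) has_derivative
         (\<lambda>v. - (inverse (\<rho> x0) * frechet_derivative \<rho> (at x0) v * inverse (\<rho> x0)))) (at x0)"
        using has_derivative_inverse'[of "\<rho> x0"] \<rho>0 has_derivative_frechet[OF d_\<rho>, of x0]
        by (auto intro!: derivative_eq_intros)
      from pderiv_at_eq[OF this, of j] show ?thesis
        using p_\<rho>[of j x0] by (simp add: pderiv_at_def)
    qed
    have dw: "pderiv_at k w differentiable (at x0)" for k
      using smooth_on_imp_differentiable[OF smooth_on_pderiv[OF w] bS[OF x0b]] .
    have "(\<lambda>y. pderiv_at k w y - \<eta> y k * inverse (\<rho> y)) differentiable (at x0)" for k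
      using dw d_\<eta> d_i by (intro differentiable_diff differentiable_mult)
    then have d2z: "pderiv_at k z differentiable (at x0)" for k
      using differentiable_cong_open[OF open_ball x0b pz] by simp
    have ppz: "pderiv_at j (pderiv_at k z) x0 = pderiv_at j (pderiv_at k w) x0
       - ((if j = k then 2 * inverse (\<rho> x0) else 0) + \<eta> x0 j * \<eta> x0 k * (inverse (\<rho> x0))\<^sup>2)" for j k
    proof -
      have "pderiv_at j (pderiv_at k z) x0 = pderiv_at j (\<lambda>y. pderiv_at k w y - \<eta> y k * inverse (\<rho> y)) x0"
        by (rule pderiv_at_cong_open[OF open_ball x0b pz])
      also have "\<dots> = pderiv_at j (pderiv_at k w) x0
          - ((if j = k then 2 else 0) * inverse (\<rho> x0) + \<eta> x0 k * (\<eta> x0 j * inverse (\<rho> x0) * inverse (\<rho> x0)))"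
        using dw d_\<eta> d_i by (simp add: pderiv_at_diff pderiv_at_mult differentiable_mult p_\<eta> p_i)
      finally show ?thesis by (simp add: power2_eq_square mult_ac)
    qed
    have zmax: "z y \<le> z x0" if "y \<in> ball a r" for y
    proof -
      have p: "\<rho> y > 0" using \<rho>_pos_iff that by blast
      have "ln (q y) \<le> ln (q x0)"
        using x0(2)[of y] that p q0 by (subst ln_le_cancel_iff) (auto simp: q_def)
      moreover have "ln (q y) = z y" "ln (q x0) = z x0"
        using p \<rho>0 by (simp_all add: q_def z_def ln_mult)
      ultimately show ?thesis by simp
    qed
    have zdiff: "z differentiable (at y)" if "y \<in> ball a r" for y
      using zd[OF that] unfolding differentiable_def by blast
    note test = second_derivative_test[OF open_ball x0b zdiff d2z zmax]
    have grad: "pderiv_at k w x0 = inverse (\<rho> x0) * \<eta> x0 k" for k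
      using test(1)[of k] pz[OF x0b, of k] by simp
    define D where "D j k = pderiv_at j (pderiv_at k w) x0" for j k
    define E where "E j k = (if j = k then 2 * \<rho> x0 else 0) + \<eta> x0 j * \<eta> x0 k" for j k
    have E: "pderiv_at j (pderiv_at k z) x0 = D j k - E j k * (inverse (\<rho> x0))\<^sup>2" for j k
      using \<rho>0 unfolding ppz D_def E_def by (simp add: power2_eq_square algebra_simps)
    have "(\<Sum>j\<in>UNIV. \<Sum>k\<in>UNIV. Gi x0 $ j $ k * (\<chi> j k. pderiv_at j (pderiv_at k z) x0) $ j $ k) \<le> 0"
      using test(2) by (intro contract_nonpos posdef_G bS x0b) simp
    then have "(\<Sum>j\<in>UNIV. \<Sum>k\<in>UNIV. Gi x0 $ j $ k * D j k)
        \<le> (\<Sum>j\<in>UNIV. \<Sum>k\<in>UNIV. Gi x0 $ j $ k * E j k) * (inverse (\<rho> x0))\<^sup>2"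
      by (simp add: E right_diff_distrib sum_subtractf sum_distrib_right mult.assoc)
    then have "(\<rho> x0)\<^sup>2 * (\<Sum>j\<in>UNIV. \<Sum>k\<in>UNIV. Gi x0 $ j $ k * D j k)
        \<le> (\<rho> x0)\<^sup>2 * ((\<Sum>j\<in>UNIV. \<Sum>k\<in>UNIV. Gi x0 $ j $ k * E j k) * (inverse (\<rho> x0))\<^sup>2)"
      by (intro mult_left_mono) auto
    then have hess: "(\<rho> x0)\<^sup>2 * (\<Sum>j\<in>UNIV. \<Sum>k\<in>UNIV. Gi x0 $ j $ k * D j k)
        \<le> (\<Sum>j\<in>UNIV. \<Sum>k\<in>UNIV. Gi x0 $ j $ k * E j k)"
      using \<rho>0 by (simp add: power2_eq_square field_simps)
    have n1: "2 * (?n - 1) \<ge> 0" by (simp add: Suc_le_eq)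
    let ?R' = "scalar_curv (\<lambda>x. exp (2 * w x) *\<^sub>R G x) x0"
    have "(\<rho> x0)\<^sup>2 * (exp (2 * w x0) * ?R') = (\<rho> x0)\<^sup>2 * (scalar_curv G x0
       + conf_linear G x0 (\<lambda>i. inverse (\<rho> x0) * \<eta> x0 i) + conf_quadratic G x0 (\<lambda>i. inverse (\<rho> x0) * \<eta> x0 i)
       - 2 * (?n - 1) * (\<Sum>j\<in>UNIV. \<Sum>k\<in>UNIV. Gi x0 $ j $ k * D j k))"
      unfolding scalar_curv_conformal[OF w bS[OF x0b]] grad D_def ..
    also have "\<dots> = (\<rho> x0)\<^sup>2 * scalar_curv G x0 + \<rho> x0 * conf_linear G x0 (\<eta> x0) + conf_quadratic G x0 (\<eta> x0)
       - 2 * (?n - 1) * ((\<rho> x0)\<^sup>2 * (\<Sum>j\<in>UNIV. \<Sum>k\<in>UNIV. Gi x0 $ j $ k * D j k))"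
      unfolding conf_linear_scale conf_quadratic_scale
      using \<rho>0 by (simp add: power2_eq_square field_simps)
    also have "\<dots> \<ge> F x0"
      unfolding F_def E_def[symmetric] using mult_left_mono[OF hess n1] by linarith
    finally have "F x0 \<le> (\<rho> x0)\<^sup>2 * (exp (2 * w x0) * ?R')" .
    also have "\<dots> = (q x0)\<^sup>2 * ?R'"
      by (simp add: q_def power2_eq_square exp_add[symmetric] mult_ac) 
    also have "\<dots> \<le> (q x0)\<^sup>2 * (- m)"
      using R x0(1) m(2)[OF x0(1)] by (intro mult_left_mono) force+
    finally have "m * (q x0)\<^sup>2 \<le> - F x0" by (simp add: mult.commute)
    also have "\<dots> \<le> \<bar>F x1\<bar>" using x1(2)[OF x0(1)] by linarith
    finally have "(q x0)\<^sup>2 \<le> \<bar>F x1\<bar> / m" using m(1) by (simp add: field_simps)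
    then have qQ: "q x0 \<le> Q" unfolding Q_def by (rule real_le_rsqrt)
    have "dist a x < r / 2" using x by simp
    then have "(dist a x)\<^sup>2 \<le> (r / 2)\<^sup>2" by (intro power_mono) auto
    then have \<rho>x: "\<rho> x \<ge> 3 / 4 * r\<^sup>2" unfolding \<rho>_eq by (simp add: power2_eq_square)
    have "3 / 4 * r\<^sup>2 * exp (w x) \<le> q x" unfolding q_def using \<rho>x by (intro mult_right_mono) auto
    also have "\<dots> \<le> q x0" using x r by (intro x0(2)) auto
    also have "\<dots> \<le> Q" by (rule qQ)
    finally have "exp (w x) \<le> C" using r by (simp add: C_def field_simps)
    then show ?thesis using exp_ge_add_one_self[of "w x"] by linarith
  qed
  then show ?thesis by blast
qed

section \<open>The trace of the equation\<close>

lemma Gamma_1_sum: "l \<in> Gamma_k 1 \<longleftrightarrow> (\<Sum>i\<in>UNIV. l $ i) > 0"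
proof -
  have "{I :: 'a set. card I = 1} = range (\<lambda>i. {i})"
    by (auto simp: card_1_singleton_iff)
  then have "elem_sym 1 l = (\<Sum>i\<in>UNIV. l $ i)"
    by (simp add: elem_sym_def sum.reindex inj_on_def)
  then show ?thesis by (auto simp: Gamma_k_def le_antisym)
qed

text \<open>Every coordinate of the average is the same because composition with a transposition permutes the
summands.\<close>

lemma permutation_average:
  fixes l :: "real^'n"
  shows "(\<Sum>p | p permutes (UNIV :: 'n set). (1 / fact CARD('n)) *\<^sub>R (\<chi> i. l $ p i))
    = ((\<Sum>i\<in>UNIV. l $ i) / CARD('n)) *\<^sub>R (\<chi> i. 1)"
proof -
  let ?P = "{p. p permutes (UNIV :: 'n set)}"
  define s where "s i = (\<Sum>p\<in>?P. l $ p i)" for i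
  have s_const: "s i = s j" for i j
  proof -
    have "s i = (\<Sum>p\<in>?P. l $ (p \<circ> Transposition.transpose i j) i)"
      unfolding s_def by (rule sum_permutations_compose_right) (simp add: permutes_swap_id)
    then show ?thesis by (simp add: s_def)
  qed
  have "CARD('n) * s i = (\<Sum>j\<in>(UNIV :: 'n set). s i)" for i by simp
  also have "(\<Sum>j\<in>(UNIV :: 'n set). s i) = (\<Sum>j\<in>UNIV. s j)" for i
    by (intro sum.cong refl s_const)
  also have "(\<Sum>j\<in>UNIV. s j) = (\<Sum>p\<in>?P. \<Sum>j\<in>UNIV. l $ p j)"
    unfolding s_def by (rule sum.swap)
  also have "\<dots> = (\<Sum>p\<in>?P. \<Sum>j\<in>UNIV. l $ j)"
  proof (rule sum.cong[OF refl])
    fix p assume "p \<in> ?P"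
    then show "(\<Sum>j\<in>UNIV. l $ p j) = (\<Sum>j\<in>UNIV. l $ j)"
      using sum.permute[of p UNIV "\<lambda>j. l $ j"] by (simp add: o_def)
  qed
  also have "\<dots> = fact CARD('n) * (\<Sum>j\<in>UNIV. l $ j)"
    by (simp add: card_permutations[OF refl])
  finally have "s i / fact CARD('n) = (\<Sum>j\<in>UNIV. l $ j) / CARD('n)" for i
    by (simp add: field_simps)
  then show ?thesis
    by (simp add: vec_eq_iff s_def sum_divide_distrib)
qed

text \<open>Jensen's inequality for the average over all permutations of the coordinates, which lies on the
diagonal, where \<open>f\<close> is known by homogeneity.\<close>

lemma symmetric_concave_le_mean:
  fixes \<Gamma> :: "(real^'n) set"
  assumes cone: "admissible_cone \<Gamma>" and l: "l \<in> \<Gamma>"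
  shows "(\<chi> i. 1) \<in> \<Gamma>"
    and "admissible_function \<Gamma> f \<Longrightarrow> f l \<le> (\<Sum>i\<in>UNIV. l $ i) / CARD('n)"
proof -
  let ?P = "{p. p permutes (UNIV :: 'n set)}"
  define t where "t = (\<Sum>i\<in>UNIV. l $ i) / CARD('n)"
  have fin: "finite ?P" by (simp add: finite_permutations)
  have card: "card ?P = fact CARD('n)" by (simp add: card_permutations[OF refl])
  have y: "(\<chi> i. l $ p i) \<in> \<Gamma>" if "p \<in> ?P" for p
    using that cone l by (auto simp: admissible_cone_def symmetric_set_def permutes_bij)
  have "(\<Sum>p\<in>?P. (1 / fact CARD('n)) *\<^sub>R (\<chi> i. l $ p i)) \<in> \<Gamma>"
    using cone y fin card by (intro convex_sum) (auto simp: admissible_cone_def)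
  then have t1: "t *\<^sub>R (\<chi> i. 1) \<in> \<Gamma>"
    unfolding permutation_average t_def .
  have "l \<in> Gamma_k 1" using cone l by (auto simp: admissible_cone_def)
  then have t: "t > 0" unfolding Gamma_1_sum t_def by simp
  then have "(1 / t) *\<^sub>R (t *\<^sub>R (\<chi> i. 1)) \<in> \<Gamma>"
    using t1 cone unfolding admissible_cone_def by (metis zero_less_divide_1_iff)
  then show one: "(\<chi> i. 1) \<in> \<Gamma>" using t by simp
  show "f l \<le> (\<Sum>i\<in>UNIV. l $ i) / CARD('n)" if f: "admissible_function \<Gamma> f"
  proof -
    have "f l = (\<Sum>p\<in>?P. (1 / fact CARD('n)) * f (\<chi> i. l $ p i))"
    proof -
      have "f (\<chi> i. l $ p i) = f l" if "p \<in> ?P" for p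
        using that f l by (auto simp: admissible_function_def symmetric_fun_on_def permutes_bij)
      then have "(\<Sum>p\<in>?P. (1 / fact CARD('n)) * f (\<chi> i. l $ p i)) = (\<Sum>p\<in>?P. (1 / fact CARD('n)) * f l)"
        by (intro sum.cong) auto
      then show ?thesis by (simp add: card)
    qed
    also have "\<dots> \<le> f (\<Sum>p\<in>?P. (1 / fact CARD('n)) *\<^sub>R (\<chi> i. l $ p i))"
    proof (rule concave_on_sum[OF fin])
      show "?P \<noteq> {}" using permutes_id by blast
      show "concave_on \<Gamma> f" using f by (simp add: admissible_function_def)
    qed (use y card in auto)
    also have "\<dots> = f (t *\<^sub>R (\<chi> i. 1))" unfolding permutation_average t_def ..
    also have "\<dots> = t" using f one t by (simp add: admissible_function_def)
    finally show ?thesis by (simp add: t_def)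
  qed
qed

text \<open>A vector with only negative coordinates has negative sum and is not in \<open>\<Gamma>\<^sub>1\<close>.\<close>

lemma kappa_less:
  fixes \<Gamma> :: "(real^'n::{finite,linorder}) set"
  assumes cone: "admissible_cone \<Gamma>"
  shows "kappa \<Gamma> < CARD('n)"
proof -
  define A where "A = {k. k \<le> CARD('n) \<and>
     (\<exists>a::real^'n::{finite,linorder}. (\<forall>i. a $ i > 0) \<and>
        (\<chi> i. if pos i \<le> k then - a $ i else a $ i) \<in> \<Gamma>)}"
  have "\<Gamma> \<noteq> {}" using cone by (auto simp: admissible_cone_def)
  then have one: "(\<chi> i. 1) \<in> \<Gamma>" using symmetric_concave_le_mean(1)[OF cone] by blast
  have pos: "pos i \<ge> 1" "pos i \<le> CARD('n)" for i :: 'n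
  proof -
    have "{j. j \<le> i} \<noteq> {}" by blast
    then show "pos i \<ge> 1" by (simp add: pos_def card_gt_0_iff Suc_le_eq)
    show "pos i \<le> CARD('n)" unfolding pos_def by (rule card_mono) auto
  qed
  have "0 \<in> A"
  proof -
    have "pos i \<noteq> 0" for i :: 'n using pos(1)[of i] by simp
    then have "(\<chi> i. if pos (i :: 'n) \<le> 0 then - (\<chi> i. 1) $ i else (\<chi> i. 1) $ i) = ((\<chi> i. 1) :: real^_)"
      by (simp add: vec_eq_iff)
    then show ?thesis unfolding A_def using one by (intro CollectI conjI exI[of _ "\<chi> i. 1"]) simp_all
  qed
  moreover have fin: "finite A" unfolding A_def by simp
  ultimately have "Max A \<in> A" by (intro Max_in) auto
  moreover have "CARD('n) \<notin> A"
  proof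
    assume "CARD('n) \<in> A"
    then obtain a :: "real^('n::{finite,linorder})" where a: "\<forall>i. a $ i > 0" "(\<chi> i. - a $ i) \<in> \<Gamma>"
      using pos(2) by (auto simp: A_def)
    then have "(\<chi> i. - a $ i) \<in> Gamma_k 1" using cone by (auto simp: admissible_cone_def)
    then have "(\<Sum>i\<in>UNIV. a $ i) < 0" unfolding Gamma_1_sum by (simp add: sum_negf)
    moreover have "(\<Sum>i\<in>UNIV. a $ i) \<ge> 0" using a(1) by (intro sum_nonneg) (simp add: less_imp_le)
    ultimately show False by simp
  qed
  ultimately show ?thesis
    unfolding kappa_def A_def[symmetric] by (auto simp: A_def le_less)
qed

text \<open>The trace of the modified Schouten tensor is a multiple of the scalar curvature; this is minus the
factor.\<close>

definition trace_const :: "nat \<Rightarrow> real \<Rightarrow> real \<Rightarrow> real" where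
  "trace_const n \<tau> \<alpha> = \<alpha> * (real n * \<tau> - 2 * (real n - 1)) / (2 * (real n - 1) * (real n - 2))"

text \<open>The hypotheses on \<open>\<tau>\<close> make the trace of the equation elliptic. For \<open>\<alpha> = 1\<close> one needs
\<open>\<tau> > 2 - 2 / n\<close>, and this follows because \<open>\<kappa> \<theta> \<le> (n - 1) / n\<close>.\<close>

lemma trace_const_pos:
  fixes \<Gamma> :: "(real^'n::{finite,linorder}) set"
  assumes dim: "CARD('n) \<ge> 3" and cone: "admissible_cone \<Gamma>"
    and theta: "0 < \<theta>" "\<theta> \<le> 1 / real CARD('n)"
    and alpha: "\<alpha> = 1 \<or> \<alpha> = -1"
    and tau: "\<alpha> = -1 \<Longrightarrow> \<tau> < 1"
      "\<alpha> = 1 \<Longrightarrow> \<tau> > 1 + (real CARD('n) - 2) * (1 - real (kappa \<Gamma>) * \<theta>)"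
  shows "trace_const CARD('n) \<tau> \<alpha> > 0"
proof -
  let ?n = "real CARD('n)"
  have n: "?n \<ge> 3" using dim by simp
  have "\<alpha> * (?n * \<tau> - 2 * (?n - 1)) > 0"
    using alpha
  proof
    assume a: "\<alpha> = -1"
    then have "?n * \<tau> < ?n * 1" using tau(1) n by (intro mult_strict_left_mono) auto
    then have "?n * \<tau> < ?n" by (simp only: mult_1_right)
    moreover have "x < 2 * (y - 1)" if "x < y" "3 \<le> y" for x y :: real
      using that by simp
    ultimately have "?n * \<tau> < 2 * (?n - 1)" using n by blast
    then show ?thesis using a by simp
  next
    assume a: "\<alpha> = 1"
    have "real (kappa \<Gamma>) \<le> ?n - 1" using kappa_less[OF cone] by simp
    then have "real (kappa \<Gamma>) * \<theta> \<le> (?n - 1) * (1 / ?n)"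
      using theta n by (intro mult_mono) auto
    then have "1 / ?n \<le> 1 - real (kappa \<Gamma>) * \<theta>" using n by (simp add: diff_divide_distrib)
    then have "(?n - 2) * (1 / ?n) \<le> (?n - 2) * (1 - real (kappa \<Gamma>) * \<theta>)"
      using n by (intro mult_left_mono) auto
    then have "\<tau> > 1 + (?n - 2) * (1 / ?n)" using tau(2)[OF a] by linarith
    then have "?n * \<tau> > ?n * (1 + (?n - 2) * (1 / ?n))" using n by (intro mult_strict_left_mono) auto
    also have "?n * (1 + (?n - 2) * (1 / ?n)) = 2 * (?n - 1)" using n by (simp add: field_simps)
    finally show ?thesis using a by simp
  qed
  moreover have "2 * (?n - 1) * (?n - 2) > 0" using n by simp
  ultimately show ?thesis unfolding trace_const_def by (rule divide_pos_pos)
qed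

text \<open>The eigenvalues are taken with respect to \<open>G\<close>, the curvature is that of \<open>G' = exp (2 w) G\<close>; this is the
origin of the factor \<open>exp (2 w)\<close>.\<close>

lemma sum_eigenvalues_schouten:
  fixes G :: "real^'n \<Rightarrow> real^'n^'n"
  assumes G: "metric_on S G" and w: "smooth_on S w" and x: "x \<in> S" and n: "CARD('n) \<ge> 3"
  defines "G' \<equiv> \<lambda>x. exp (2 * w x) *\<^sub>R G x"
  shows "(\<Sum>i\<in>UNIV. eigenvalues (G x) ((\<alpha> / (real CARD('n) - 2)) *\<^sub>R
        (ricci G' x - (\<tau> * scalar_curv G' x / (2 * (real CARD('n) - 1))) *\<^sub>R G' x)) $ i)
     = - trace_const CARD('n) \<tau> \<alpha> * exp (2 * w x) * scalar_curv G' x"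
proof -
  interpret coordinate_metric S G using G by unfold_locales
  interpret G': coordinate_metric S G' using metric_on_conformal[OF G w] by (simp add: coordinate_metric_def G'_def)
  let ?n = "real CARD('n)"
  let ?T = "(\<alpha> / (?n - 2)) *\<^sub>R (ricci G' x - (\<tau> * scalar_curv G' x / (2 * (?n - 1))) *\<^sub>R G' x)"
  define E where "E = exp (2 * w x)"
  have E: "E > 0" by (simp add: E_def)
  have "transpose ?T = ?T"
    using G'.ricci_sym[OF x] G'.G_sym[OF x] by (simp add: vec_eq_iff transpose_def)
  then have "(\<Sum>i\<in>UNIV. eigenvalues (G x) ?T $ i) = trace (Gi x ** ?T)"
    by (rule sum_eigenvalues[OF posdef_G[OF x]])
  also have "\<dots> = (\<alpha> / (?n - 2)) * ((\<Sum>j\<in>UNIV. \<Sum>k\<in>UNIV. Gi x $ j $ k * ricci G' x $ j $ k)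
      - (\<tau> * scalar_curv G' x / (2 * (?n - 1))) * (\<Sum>j\<in>UNIV. \<Sum>k\<in>UNIV. Gi x $ j $ k * G' x $ j $ k))"
  proof -
    have "trace (Gi x ** (a *\<^sub>R (ricci G' x - b *\<^sub>R G' x)))
      = a * ((\<Sum>j\<in>UNIV. \<Sum>k\<in>UNIV. Gi x $ j $ k * ricci G' x $ k $ j)
        - b * (\<Sum>j\<in>UNIV. \<Sum>k\<in>UNIV. Gi x $ j $ k * G' x $ k $ j))" for a b
      by (simp add: trace_def matrix_matrix_mult_def sum_distrib_left sum_subtractf algebra_simps)
    moreover have "(\<Sum>j\<in>UNIV. \<Sum>k\<in>UNIV. Gi x $ j $ k * ricci G' x $ k $ j)
        = (\<Sum>j\<in>UNIV. \<Sum>k\<in>UNIV. Gi x $ j $ k * ricci G' x $ j $ k)"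
      by (intro sum.cong refl arg_cong[of _ _ "\<lambda>r. _ * r"] G'.ricci_sym[OF x])
    moreover have "(\<Sum>j\<in>UNIV. \<Sum>k\<in>UNIV. Gi x $ j $ k * G' x $ k $ j)
        = (\<Sum>j\<in>UNIV. \<Sum>k\<in>UNIV. Gi x $ j $ k * G' x $ j $ k)"
      by (intro sum.cong refl arg_cong[of _ _ "\<lambda>r. _ * r"] G'.G_sym[OF x])
    ultimately show ?thesis by simp
  qed
  also have "(\<Sum>j\<in>UNIV. \<Sum>k\<in>UNIV. Gi x $ j $ k * G' x $ j $ k) = E * ?n"
  proof -
    have "(\<Sum>j\<in>UNIV. \<Sum>k\<in>UNIV. Gi x $ j $ k * G' x $ j $ k)
       = (\<Sum>j\<in>UNIV. E * (\<Sum>k\<in>UNIV. Gi x $ j $ k * G x $ k $ j))"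
      using G_sym[OF x] by (simp add: G'_def E_def sum_distrib_left mult_ac)
    then show ?thesis by (simp add: Gi_G[OF x])
  qed
  also have "(\<Sum>j\<in>UNIV. \<Sum>k\<in>UNIV. Gi x $ j $ k * ricci G' x $ j $ k) = E * scalar_curv G' x"
  proof -
    have "matrix_inv (G' x) = inverse E *\<^sub>R Gi x"
      unfolding G'_def E_def by (rule matrix_inv_scaleR[OF posdef_det_nonzero[OF posdef_G[OF x]]]) simp
    then have "E * (matrix_inv (G' x) $ j $ k * z) = Gi x $ j $ k * z" for j k z
      using E by (simp add: field_simps)
    then show ?thesis by (simp only: scalar_curv_def sum_distrib_left)
  qed
  also have "(\<alpha> / (?n - 2)) * (E * scalar_curv G' x - (\<tau> * scalar_curv G' x / (2 * (?n - 1))) * (E * ?n))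
     = - trace_const CARD('n) \<tau> \<alpha> * E * scalar_curv G' x"
    using n by (simp add: trace_const_def divide_simps) (simp add: algebra_simps)
  finally show ?thesis by (simp add: E_def)
qed

section \<open>Charts\<close>

lemma metric_on_subset: "metric_on S G \<Longrightarrow> open T \<Longrightarrow> T \<subseteq> S \<Longrightarrow> metric_on T G"
  unfolding metric_on_def using smooth_on_subset by blast

lemma conformal_chart:
  "conformal v g c \<circ> chart_inv c = (\<lambda>x. exp (2 * (v \<circ> chart_inv c) x) *\<^sub>R (g c \<circ> chart_inv c) x)"
  by (simp add: conformal_def fun_eq_iff)

context
  fixes \<A> :: "('a::topological_space, 'n::finite) chart set"
  assumes \<A>: "smooth_structure \<A>"
begin

lemma chart_inv:
  assumes "c \<in> \<A>"
  shows "p \<in> fst c \<Longrightarrow> chart_inv c (snd c p) = p"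
    and "x \<in> snd c ` fst c \<Longrightarrow> snd c (chart_inv c x) = x"
    and "x \<in> snd c ` fst c \<Longrightarrow> chart_inv c x \<in> fst c"
    and "open (fst c)" "continuous_on (fst c) (snd c)"
    and "open (snd c ` fst c)" "continuous_on (snd c ` fst c) (chart_inv c)"
proof -
  have "is_chart c" using assms \<A> unfolding smooth_structure_def by blast
  then have h: "open (fst c)" "open (snd c ` fst c)"
      "homeomorphism (fst c) (snd c ` fst c) (snd c) (chart_inv c)"
    unfolding is_chart_def by blast+
  show "p \<in> fst c \<Longrightarrow> chart_inv c (snd c p) = p"
    by (rule homeomorphism_apply1[OF h(3)])
  show "x \<in> snd c ` fst c \<Longrightarrow> snd c (chart_inv c x) = x"
    by (rule homeomorphism_apply2[OF h(3)])
  show "x \<in> snd c ` fst c \<Longrightarrow> chart_inv c x \<in> fst c"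
    using homeomorphism_image2[OF h(3)] by blast
  show "open (fst c)" "continuous_on (fst c) (snd c)"
    "open (snd c ` fst c)" "continuous_on (snd c ` fst c) (chart_inv c)"
    using h homeomorphism_cont1[OF h(3)] homeomorphism_cont2[OF h(3)] by blast+
qed

lemma open_chart_image:
  assumes "c \<in> \<A>" "open W"
  shows "open (snd c ` (fst c \<inter> W))"
proof -
  have "snd c ` (fst c \<inter> W) = snd c ` fst c \<inter> chart_inv c -` W"
  proof (intro equalityI subsetI)
    fix x assume "x \<in> snd c ` (fst c \<inter> W)"
    then show "x \<in> snd c ` fst c \<inter> chart_inv c -` W" using chart_inv(1)[OF assms(1)] by auto
  next
    fix x assume x: "x \<in> snd c ` fst c \<inter> chart_inv c -` W"
    then have "x = snd c (chart_inv c x)" "chart_inv c x \<in> fst c \<inter> W"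
      using chart_inv(2,3)[OF assms(1), of x] by auto
    then show "x \<in> snd c ` (fst c \<inter> W)" by (rule image_eqI)
  qed
  then show ?thesis
    using continuous_open_preimage[OF chart_inv(7,6)[OF assms(1)] assms(2)] by simp
qed

lemma chart_at: "chart_at \<A> p \<in> \<A>" "p \<in> fst (chart_at \<A> p)"
proof -
  have "(\<Union>c\<in>\<A>. fst c) = UNIV" using \<A> unfolding smooth_structure_def by blast
  then have "\<exists>c. c \<in> \<A> \<and> p \<in> fst c" by blast
  from someI_ex[OF this] show "chart_at \<A> p \<in> \<A>" "p \<in> fst (chart_at \<A> p)"
    by (simp_all add: chart_at_def)
qed

lemma metric_on_chart:
  assumes g: "riemannian_metric \<A> g" and c: "c \<in> \<A>"
  shows "metric_on (snd c ` fst c) (g c \<circ> chart_inv c)"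
proof -
  have sm: "smooth_on (snd c ` fst c) (g c \<circ> chart_inv c)"
    and pd: "\<forall>p\<in>fst c. transpose (g c p) = g c p \<and> (\<forall>v. v \<noteq> 0 \<longrightarrow> v \<bullet> (g c p *v v) > 0)"
    using g c unfolding riemannian_metric_def by blast+
  have "smooth_on (snd c ` fst c) (\<lambda>x. (g c \<circ> chart_inv c) x $ i $ j)" for i j
    using smooth_on_nth[OF chart_inv(6)[OF c] smooth_on_nth[OF chart_inv(6)[OF c] sm]] .
  moreover have "posdef ((g c \<circ> chart_inv c) x)" if "x \<in> snd c ` fst c" for x
    using pd chart_inv(3)[OF c that] by (simp add: posdef_def)
  ultimately show ?thesis using chart_inv(6)[OF c] by (simp add: metric_on_def)
qed

lemma metric_on_conformal_chart:
  assumes g: "riemannian_metric \<A> g" and c: "c \<in> \<A>" and W: "open W" "smooth_fun \<A> W v"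
  shows "metric_on (snd c ` (fst c \<inter> W)) (conformal v g c \<circ> chart_inv c)"
  unfolding conformal_chart
proof (rule metric_on_conformal)
  show "metric_on (snd c ` (fst c \<inter> W)) (g c \<circ> chart_inv c)"
    using metric_on_subset[OF metric_on_chart[OF g c] open_chart_image[OF c W(1)]] by blast
  show "smooth_on (snd c ` (fst c \<inter> W)) (v \<circ> chart_inv c)"
    using W(2) c by (simp add: smooth_fun_def)
qed

lemma scalar_curv_chart_invariant:
  assumes g: "riemannian_metric \<A> g" and c: "c \<in> \<A>" and d: "d \<in> \<A>"
    and W: "open W" "smooth_fun \<A> W v" and p: "p \<in> fst c \<inter> fst d \<inter> W"
  shows "scalar_curv (conformal v g c \<circ> chart_inv c) (snd c p)
    = scalar_curv (conformal v g d \<circ> chart_inv d) (snd d p)"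
proof -
  let ?S = "snd c ` (fst c \<inter> (fst d \<inter> W))"
  define \<phi> where "\<phi> = snd d \<circ> chart_inv c"
  have "scalar_curv (conformal v g c \<circ> chart_inv c) (snd c p)
    = scalar_curv (conformal v g d \<circ> chart_inv d) (\<phi> (snd c p))"
  proof (rule scalar_curv_invariant)
    show "metric_on ?S (conformal v g c \<circ> chart_inv c)"
      by (rule metric_on_subset[OF metric_on_conformal_chart[OF g c W]])
        (use open_chart_image[OF c] chart_inv(4)[OF d] W in auto)
    show "metric_on (snd d ` (fst d \<inter> W)) (conformal v g d \<circ> chart_inv d)"
      by (rule metric_on_conformal_chart[OF g d W])
    show "smooth_on ?S \<phi>"
    proof -
      have "smooth_on (snd c ` (fst c \<inter> fst d)) \<phi>"
        using \<A> c d by (auto simp: smooth_structure_def compatible_def \<phi>_def)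
      then show ?thesis by (rule smooth_on_subset) auto
    qed
    show "snd c p \<in> ?S" using p by auto
    fix x assume x: "x \<in> ?S"
    then obtain q where q: "q \<in> fst c" "q \<in> fst d" "q \<in> W" "x = snd c q" by auto
    have inv: "chart_inv c x = q" "\<phi> x = snd d q" "chart_inv d (\<phi> x) = q"
      using q chart_inv(1)[OF c] chart_inv(1)[OF d] by (simp_all add: \<phi>_def)
    show "\<phi> x \<in> snd d ` (fst d \<inter> W)" using q inv by auto
    let ?J = "matrix (frechet_derivative \<phi> (at x))"
    have "g c q = transpose ?J ** g d q ** ?J"
      using g c d q unfolding riemannian_metric_def Let_def \<phi>_def by blast
    then have "exp (2 * v q) *\<^sub>R g c q = transpose ?J ** (exp (2 * v q) *\<^sub>R g d q) ** ?J"
      by (simp add: vec_eq_iff matrix_matrix_mult_def sum_distrib_left sum_distrib_right mult_ac)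
    then show "(conformal v g c \<circ> chart_inv c) x
        = transpose ?J ** (conformal v g d \<circ> chart_inv d) (\<phi> x) ** ?J"
      using chart_inv(1)[OF d q(2)] by (simp add: conformal_def inv)
  qed
  then show ?thesis using p chart_inv(1)[OF c] by (simp add: \<phi>_def)
qed

end

section \<open>The local upper bound\<close>

text \<open>The factor \<open>exp (2 v)\<close> on the right-hand side of the equation cancels against the one in the trace:
the equation forces the scalar curvature of the solution metric to be at most a fixed negative
function.\<close>

lemma scalar_curv_upper_bound:
  fixes \<A> :: "('a::topological_space, 'n::{finite,linorder}) chart set"
    and \<Gamma> :: "(real^'n::{finite,linorder}) set"
  assumes \<A>: "smooth_structure \<A>" and g: "riemannian_metric \<A> g" and dim: "CARD('n) \<ge> 3"
    and cone: "admissible_cone \<Gamma>" and f: "admissible_function \<Gamma> f"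
    and \<beta>: "trace_const CARD('n) \<tau> \<alpha> > 0"
    and W: "open W" "smooth_fun \<A> W v"
    and c: "c \<in> \<A>" and p: "p \<in> fst c" "p \<in> W"
    and eig: "eig \<A> g (A_tensor \<tau> \<alpha> (conformal v g)) p \<in> \<Gamma>"
      "f (eig \<A> g (A_tensor \<tau> \<alpha> (conformal v g)) p) = \<psi> p * exp (2 * v p)"
  shows "scalar_curv (conformal v g c \<circ> chart_inv c) (snd c p)
    \<le> - (real CARD('n) * \<psi> p / trace_const CARD('n) \<tau> \<alpha>)"
proof -
  let ?d = "chart_at \<A> p"
  let ?n = "real CARD('n)" and ?\<beta> = "trace_const CARD('n) \<tau> \<alpha>"
  let ?R = "scalar_curv (conformal v g ?d \<circ> chart_inv ?d) (snd ?d p)"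
  let ?l = "eig \<A> g (A_tensor \<tau> \<alpha> (conformal v g)) p"
  note d = chart_at[OF \<A>, of p]
  have inv: "chart_inv ?d (snd ?d p) = p" using chart_inv(1)[OF \<A> d] .
  have S: "metric_on (snd ?d ` (fst ?d \<inter> W)) (g ?d \<circ> chart_inv ?d)"
    using metric_on_subset[OF metric_on_chart[OF \<A> g d(1)] open_chart_image[OF \<A> d(1) W(1)]] by blast
  have sm: "smooth_on (snd ?d ` (fst ?d \<inter> W)) (v \<circ> chart_inv ?d)"
    using W(2) d(1) by (simp add: smooth_fun_def)
  have x: "snd ?d p \<in> snd ?d ` (fst ?d \<inter> W)" using d p by auto
  have "(\<Sum>i\<in>UNIV. ?l $ i) = - ?\<beta> * exp (2 * v p) * ?R"
    using sum_eigenvalues_schouten[OF S sm x dim, of \<alpha> \<tau>]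
    by (simp add: eig_def A_tensor_def Let_def conformal_chart inv) (simp add: conformal_def o_def)
  moreover have "\<psi> p * exp (2 * v p) \<le> (\<Sum>i\<in>UNIV. ?l $ i) / ?n"
    using symmetric_concave_le_mean(2)[OF cone eig(1) f] eig(2) by simp
  then have "\<psi> p * exp (2 * v p) * ?n \<le> (\<Sum>i\<in>UNIV. ?l $ i)"
    by (subst (asm) pos_le_divide_eq) simp_all
  ultimately have "\<psi> p * exp (2 * v p) * ?n \<le> - ?\<beta> * exp (2 * v p) * ?R" by simp
  then have "exp (2 * v p) * (?n * \<psi> p + ?\<beta> * ?R) \<le> 0" by (simp add: algebra_simps)
  then have "?n * \<psi> p + ?\<beta> * ?R \<le> 0" by (simp add: mult_le_0_iff)
  then have "?R \<le> - (?n * \<psi> p / ?\<beta>)" using \<beta> by (simp add: field_simps)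
  then show ?thesis
    using scalar_curv_chart_invariant[OF \<A> g c d(1) W, of p] p d by simp
qed

text \<open>The neighbourhood and the constant are chosen before the solution, which is what makes the final
constant uniform over all exhaustions and all \<open>k\<close>.\<close>

lemma local_upper_bound:
  fixes \<A> :: "('a::topological_space, 'n::{finite,linorder}) chart set"
    and \<Gamma> :: "(real^'n::{finite,linorder}) set"
  assumes \<A>: "smooth_structure \<A>" and g: "riemannian_metric \<A> g" and dim: "CARD('n) \<ge> 3"
    and psi: "smooth_fun \<A> UNIV \<psi>" "\<forall>p. \<psi> p > 0"
    and cone: "admissible_cone \<Gamma>" and f: "admissible_function \<Gamma> f"
    and \<beta>: "trace_const CARD('n) \<tau> \<alpha> > 0"
    and D: "open D" "p \<in> D"
  shows "\<exists>U C. open U \<and> p \<in> U \<and> (\<forall>W v. open W \<and> D \<subseteq> W \<and> smooth_fun \<A> W v \<and>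
      (\<forall>q\<in>D. eig \<A> g (A_tensor \<tau> \<alpha> (conformal v g)) q \<in> \<Gamma> \<and>
        f (eig \<A> g (A_tensor \<tau> \<alpha> (conformal v g)) q) = \<psi> q * exp (2 * v q))
      \<longrightarrow> (\<forall>q\<in>U. v q \<le> C))"
proof -
  let ?c = "chart_at \<A> p"
  let ?n = "real CARD('n)" and ?\<beta> = "trace_const CARD('n) \<tau> \<alpha>"
  note c = chart_at[OF \<A>, of p]
  note cinv = chart_inv[OF \<A> c(1)]
  define S where "S = snd ?c ` (fst ?c \<inter> D)"
  have S: "open S" unfolding S_def by (rule open_chart_image[OF \<A> c(1) D(1)])
  have SD: "chart_inv ?c x \<in> fst ?c" "chart_inv ?c x \<in> D" "snd ?c (chart_inv ?c x) = x" if "x \<in> S" for x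
    using that cinv(1) by (auto simp: S_def)
  have "snd ?c p \<in> S" using c D by (auto simp: S_def)
  then obtain r where r: "r > 0" "cball (snd ?c p) r \<subseteq> S"
    using S open_contains_cball by blast
  have G: "metric_on S (g ?c \<circ> chart_inv ?c)"
    by (rule metric_on_subset[OF metric_on_chart[OF \<A> g c(1)] S]) (auto simp: S_def)
  define \<kappa> where "\<kappa> x = ?n * \<psi> (chart_inv ?c x) / ?\<beta>" for x
  have "continuous_on (snd ?c ` fst ?c) (\<psi> \<circ> chart_inv ?c)"
    using psi(1) c(1) by (intro smooth_on_imp_continuous_on) (auto simp: smooth_fun_def)
  then have "continuous_on S (\<psi> \<circ> chart_inv ?c)"
    by (rule continuous_on_subset) (auto simp: S_def)
  then have "continuous_on S (\<lambda>x. \<psi> (chart_inv ?c x))" by (simp add: o_def)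
  then have \<kappa>: "continuous_on (cball (snd ?c p) r) \<kappa>"
    unfolding \<kappa>_def using \<beta> r(2) by (intro continuous_intros) (auto intro: continuous_on_subset)
  have \<kappa>_pos: "\<kappa> x > 0" for x using psi(2) \<beta> by (simp add: \<kappa>_def)
  obtain C where C: "\<And>w. smooth_on S w \<Longrightarrow>
      (\<forall>x\<in>cball (snd ?c p) r. scalar_curv (\<lambda>x. exp (2 * w x) *\<^sub>R (g ?c \<circ> chart_inv ?c) x) x \<le> - \<kappa> x)
      \<Longrightarrow> (\<forall>x\<in>ball (snd ?c p) (r / 2). w x \<le> C)"
    using coordinate_upper_bound[OF G r \<kappa> \<kappa>_pos] by blast
  define U where "U = fst ?c \<inter> snd ?c -` ball (snd ?c p) (r / 2)"
  have "open U"
    unfolding U_def by (rule continuous_open_preimage[OF cinv(5,4) open_ball])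
  moreover have "p \<in> U" using c r(1) by (simp add: U_def)
  moreover have "\<forall>W v. open W \<and> D \<subseteq> W \<and> smooth_fun \<A> W v \<and>
      (\<forall>q\<in>D. eig \<A> g (A_tensor \<tau> \<alpha> (conformal v g)) q \<in> \<Gamma> \<and>
        f (eig \<A> g (A_tensor \<tau> \<alpha> (conformal v g)) q) = \<psi> q * exp (2 * v q))
      \<longrightarrow> (\<forall>q\<in>U. v q \<le> C)"
  proof (intro allI impI, elim conjE)
    fix W v
    assume W: "open W" "smooth_fun \<A> W v" and DW: "D \<subseteq> W"
      and sol: "\<forall>q\<in>D. eig \<A> g (A_tensor \<tau> \<alpha> (conformal v g)) q \<in> \<Gamma> \<and>
        f (eig \<A> g (A_tensor \<tau> \<alpha> (conformal v g)) q) = \<psi> q * exp (2 * v q)"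
    have eig: "eig \<A> g (A_tensor \<tau> \<alpha> (conformal v g)) q \<in> \<Gamma>"
      "f (eig \<A> g (A_tensor \<tau> \<alpha> (conformal v g)) q) = \<psi> q * exp (2 * v q)" if "q \<in> D" for q
      using sol that by blast+
    have sm: "smooth_on S (v \<circ> chart_inv ?c)"
    proof -
      have "smooth_on (snd ?c ` (fst ?c \<inter> W)) (v \<circ> chart_inv ?c)"
        using W(2) c(1) by (simp add: smooth_fun_def)
      then show ?thesis by (rule smooth_on_subset) (use DW in \<open>auto simp: S_def\<close>)
    qed
    have "\<forall>x\<in>ball (snd ?c p) (r / 2). (v \<circ> chart_inv ?c) x \<le> C"
    proof (rule C[OF sm], intro ballI)
      fix x assume "x \<in> cball (snd ?c p) r"
      then have x: "x \<in> S" using r(2) by auto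
      have "scalar_curv (conformal v g ?c \<circ> chart_inv ?c) (snd ?c (chart_inv ?c x)) \<le> - \<kappa> x"
        unfolding \<kappa>_def
        using SD[OF x] DW
        by (intro scalar_curv_upper_bound[OF \<A> g dim cone f \<beta> W c(1)] eig) auto
      then show "scalar_curv (\<lambda>x. exp (2 * (v \<circ> chart_inv ?c) x) *\<^sub>R (g ?c \<circ> chart_inv ?c) x) x \<le> - \<kappa> x"
        unfolding conformal_chart SD(3)[OF x] .
    qed
    then show "\<forall>q\<in>U. v q \<le> C" using cinv(1) by (auto simp: U_def)
  qed
  ultimately show ?thesis by (intro exI[of _ U] exI[of _ C] conjI)
qed

section \<open>The uniform bound on a compact set\<close>

lemma exhaustion_mono:
  assumes "exhaustion \<A> M" "1 \<le> m" "m \<le> k"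
  shows "M m \<subseteq> M k"
  using assms(3)
proof (induction rule: dec_induct)
  case (step k)
  then have "closure (M k) \<subseteq> M (Suc k)" using assms by (simp add: exhaustion_def)
  then show ?case using step closure_subset by blast
qed simp

theorem theorem4p2:
  fixes \<A> :: "('a::{t2_space,second_countable_topology}, 'n::{finite,linorder}) chart set"
    and g :: "('a, 'n) tensor2"
    and \<psi> u\<^sub>0 :: "'a \<Rightarrow> real"
    and \<Gamma> :: "(real^('n::{finite,linorder})) set"
    and f :: "real^('n::{finite,linorder}) \<Rightarrow> real"
    and \<theta> \<tau> \<alpha> \<Lambda>\<^sub>0 :: real
    and K\<^sub>0 K D :: "'a set"
  assumes dim: "CARD('n) \<ge> 3"
    and manifold: "smooth_structure \<A>" "connected (UNIV :: 'a set)" "\<not> compact (UNIV :: 'a set)"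
    and metric: "riemannian_metric \<A> g" "complete_metric \<A> g"
    and psi: "smooth_fun \<A> UNIV \<psi>" "\<forall>p. \<psi> p > 0"
    and cone: "admissible_cone \<Gamma>"
    and f: "admissible_function \<Gamma> f"
    and theta: "0 < \<theta>" "\<theta> \<le> 1 / real CARD('n)" "theta_property \<Gamma> \<theta>"
    and alpha: "\<alpha> = 1 \<or> \<alpha> = -1"
    and tau: "\<alpha> = -1 \<Longrightarrow> \<tau> < 1"
      "\<alpha> = 1 \<Longrightarrow> \<tau> > 1 + (real CARD('n) - 2) * (1 - real (kappa \<Gamma>) * \<theta>)"
    and u0: "smooth_fun \<A> UNIV u\<^sub>0" "complete_metric \<A> (conformal u\<^sub>0 g)"
      "\<forall>p. eig \<A> (conformal u\<^sub>0 g) (A_tensor \<tau> \<alpha> (conformal u\<^sub>0 g)) p \<in> \<Gamma>"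
    and K0: "compact K\<^sub>0" "\<Lambda>\<^sub>0 > 0"
      "\<forall>p\<in>UNIV - K\<^sub>0. f (eig \<A> (conformal u\<^sub>0 g) (A_tensor \<tau> \<alpha> (conformal u\<^sub>0 g)) p) \<ge> \<Lambda>\<^sub>0 * \<psi> p"
    and K: "compact K" "K \<subseteq> D"
  shows "\<exists>C>0. \<forall>(M :: nat \<Rightarrow> 'a set) (u :: nat \<Rightarrow> 'a \<Rightarrow> real) m.
           exhaustion \<A> M \<and>
           (\<forall>k\<ge>1. admissible_dirichlet_solution \<A> g \<tau> \<alpha> \<Gamma> f \<psi> u\<^sub>0 (M k) (u k)) \<and>
           m \<ge> 1 \<and> M m = D
           \<longrightarrow> (\<forall>k\<ge>m. (SUP p\<in>K. ereal (u k p)) \<le> ereal C)"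
proof (cases "open D")
  case False
  \<comment> \<open>The members of an exhaustion are open, so otherwise there is nothing to bound.\<close>
  have "open D" if "exhaustion \<A> M" "m \<ge> 1" "M m = D" for M m
    using that by (auto simp: exhaustion_def smooth_compact_domain_def)
  with False show ?thesis by (intro exI[of _ 1]) auto
next
  case True
  define good where "good v \<longleftrightarrow> (\<exists>W. open W \<and> D \<subseteq> W \<and> smooth_fun \<A> W v) \<and>
      (\<forall>q\<in>D. eig \<A> g (A_tensor \<tau> \<alpha> (conformal v g)) q \<in> \<Gamma> \<and>
        f (eig \<A> g (A_tensor \<tau> \<alpha> (conformal v g)) q) = \<psi> q * exp (2 * v q))" for v
  have \<beta>: "trace_const CARD('n) \<tau> \<alpha> > 0"
    by (rule trace_const_pos[OF dim cone theta(1,2) alpha tau])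
  have "\<exists>U C. open U \<and> p \<in> U \<and> (\<forall>v. good v \<longrightarrow> (\<forall>q\<in>U. v q \<le> C))" if p: "p \<in> D" for p
  proof -
    obtain U C where U: "open U" "p \<in> U" and *: "\<forall>W v. open W \<and> D \<subseteq> W \<and> smooth_fun \<A> W v \<and>
      (\<forall>q\<in>D. eig \<A> g (A_tensor \<tau> \<alpha> (conformal v g)) q \<in> \<Gamma> \<and>
        f (eig \<A> g (A_tensor \<tau> \<alpha> (conformal v g)) q) = \<psi> q * exp (2 * v q))
      \<longrightarrow> (\<forall>q\<in>U. v q \<le> C)"
      using local_upper_bound[OF manifold(1) metric(1) dim psi cone f \<beta> True p] by (elim exE conjE)
    have "\<forall>q\<in>U. v q \<le> C" if v: "good v" for v
    proof -
      obtain W where "open W" "D \<subseteq> W" "smooth_fun \<A> W v" using v unfolding good_def by blast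
      then show ?thesis using v *[rule_format, of W v] unfolding good_def by blast
    qed
    then show ?thesis using U by blast
  qed
  then obtain U C where U: "\<And>p. p \<in> D \<Longrightarrow> open (U p)" "\<And>p. p \<in> D \<Longrightarrow> p \<in> U p"
    and C: "\<And>p v q. p \<in> D \<Longrightarrow> good v \<Longrightarrow> q \<in> U p \<Longrightarrow> v q \<le> C p"
    by metis
  have "open (U p)" if "p \<in> K" for p using U(1) K(2) that by blast
  moreover have "K \<subseteq> (\<Union>p\<in>K. U p)" using U(2) K(2) by auto
  ultimately obtain I where I: "I \<subseteq> K" "finite I" "K \<subseteq> (\<Union>p\<in>I. U p)"
    by (rule compactE_image[OF K(1)])
  define C0 where "C0 = 1 + (\<Sum>p\<in>I. \<bar>C p\<bar>)"
  have bound: "v q \<le> C0" if v: "good v" and q: "q \<in> K" for v q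
  proof -
    obtain p where p: "p \<in> I" "q \<in> U p" using I(3) q by blast
    have "v q \<le> C p" using C[of p v q] p I K v by blast
    also have "\<dots> \<le> \<bar>C p\<bar>" by simp
    also have "\<dots> \<le> (\<Sum>p\<in>I. \<bar>C p\<bar>)" using p I by (intro member_le_sum) auto
    finally show ?thesis by (simp add: C0_def)
  qed
  have "(SUP p\<in>K. ereal (u k p)) \<le> ereal C0"
    if ex: "exhaustion \<A> M" and sol: "\<forall>k\<ge>1. admissible_dirichlet_solution \<A> g \<tau> \<alpha> \<Gamma> f \<psi> u\<^sub>0 (M k) (u k)"
      and m: "m \<ge> 1" "M m = D" and k: "k \<ge> m" for M u m k
  proof -
    have DM: "D \<subseteq> M k" using exhaustion_mono[OF ex m(1) k] m(2) by simp
    then have Dcl: "D \<subseteq> closure (M k)" using closure_subset by blast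
    have "admissible_dirichlet_solution \<A> g \<tau> \<alpha> \<Gamma> f \<psi> u\<^sub>0 (M k) (u k)" using sol m k by simp
    then obtain W v where W: "open W" "closure (M k) \<subseteq> W" "smooth_fun \<A> W v"
      and vu: "\<forall>p\<in>closure (M k). v p = u k p"
      and eig: "\<forall>p\<in>closure (M k). eig \<A> g (A_tensor \<tau> \<alpha> (conformal v g)) p \<in> \<Gamma>"
        "\<forall>p\<in>M k. f (eig \<A> g (A_tensor \<tau> \<alpha> (conformal v g)) p) = \<psi> p * exp (2 * v p)"
      unfolding admissible_dirichlet_solution_def by blast
    have "good v" unfolding good_def using W eig DM Dcl by blast
    then have "u k p \<le> C0" if "p \<in> K" for p
      using bound[of v p] vu that K(2) Dcl by force
    then show ?thesis by (intro SUP_least) simp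
  qed
  moreover have "C0 > 0" unfolding C0_def by (simp add: add_pos_nonneg sum_nonneg)
  ultimately show ?thesis by (intro exI[of _ C0]) blast
qed

end
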